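(* Let $P,Q$ be polynomials and let $p,q,N,a,b,c,d,D,\theta_k,\Gamma_k,G_k(r,\delta),\Lambda_k(r,C)$ be as described in the context. Let $g$ be a nontrivial entire solution of $$g''-\frac{P'}{P}g'+\frac QP g=0 .$$ Then for each $k=0,\dots,N+1$ there exist $r>0$, $\delta>0$ and a fundamental pair of analytic solutions $g_k^+,g_k^-$ of this equation in $G_k(r,\delta)$ such that $$g=\lambda_k^+g_k^++\lambda_k^-g_k^-$$ there, with some constants $\lambda_k^\pm\in\mathbb C$, and, as $z\to\infty$, $z\in G_k(r,\delta)$, $$g_k^\pm(z)=(z-d)^{\frac{3p-q}{4}}\exp\!\left(\frac{\pm2i\sqrt b}{N+2}(z-d)^{\frac{N+2}{2}}(1+o(1))\right)\bigl(1+O((z-d)^{-1})\bigr),$$ $$(g_k^\pm)'(z)=\pm i\sqrt b\,(z-d)^{\frac{p+q}{4}}\exp\!\left(\frac{\pm2i\sqrt b}{N+2}(z-d)^{\frac{N+2}{2}}(1+o(1))\right)\bigl(1+O((z-d)^{-1})\bigr).$$ Moreover, $g$ has infinitely many zeros in $G_k(r,\delta)$ if and only if $\lambda_k^+\lambda_k^-\ne0$. In this case all but finitely many zeros $t_n$ of $g$ in $G_k(r,\delta)$ belong to $\Lambda_k(r,C)$ for some $C>0$, and (with a suitable enumeration) $$t_n-d\sim\left(\frac{\pi^2(N+2)^2}{4b}\right)^{\frac1{N+2}}e^{\frac{2\pi ik}{N+2}}\,n^{\frac2{N+2}},\qquad g'(t_n)\sim(-1)^na_k\,n^{\frac{p+q}{2(N+2)}},\qquad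 n\to\infty,$$ where $a_k\ne0$ depends on $k$ and on the coefficients $\lambda_k^\pm$. Furthermore, $$\operatorname{dist}(t_n,\Gamma_k)=\begin{cases}O(|t_n|^{-1}),&N\ge3,\\ O\!\left(\dfrac{\log|t_n|}{|t_n|}\right),&N=2,\\ O(|t_n|^{-1/2}),&N=1,\\ O(|D|\log|t_n|+1),&N=0.\end{cases}$$ In particular, for $N>0$ the zeros approach the Stokes ray $\Gamma_k$ in the Euclidean metric, whereas for $N=0$ one obtains in general only logarithmic localization.
   Context: Setting. $P(z)=z^p+az^{p-1}+O(z^{p-2})$ and $Q(z)=bz^q+cz^{q-1}+O(z^{q-2})$ are polynomials, $b\ne0$, $q\ge p\ge0$, $N=q-p$. With $p_1,\dots,p_p$ the zeros of $P$ counted with multiplicity, one has $\frac QP=S+\sum_{j=1}^p\frac{D_j}{z-p_j}$ with a polynomial $S$ of degree $N$ (so $Q/P$ has at most simple poles). Put $d=\frac{ab-c}{bN}$ if $N\ge1$ and $d=0$ if $N=0$. For $k\in\mathbb Z$ put $\theta_k=\frac{2\pi k-\arg b}{N+2}$ (a value of $\arg b$ is fixed; indices $k$ are taken modulo $N+2$, $\arg(z-d)$ modulo $2\pi$). The Stokes rays are $\Gamma_k=\{z:\arg(z-d)=\theta_k\}$, $k=0,\dots,N+1$. For $r,\delta,C>0$, $$G_k(r,\delta)=\{z:|z-d|>r,\ \arg(z-d)\in(\theta_{k-1}+\delta,\theta_{k+1}-\delta)\},$$ $$\Lambda_k(r,C)=\{z:|z-d|>r,\ |\arg(z-d)-\theta_k|<C\,\varepsilon_{N,D}(|z-d|)\},$$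 where $\varepsilon_{N,D}(r)=r^{-2}$ if $N\ge3$; $(\log r)r^{-2}$ if $N=2$; $r^{-3/2}$ if $N=1$; $(1+|D|\log r)r^{-1}$ if $N=0$. Here, for $N=0$, $D=b^{-1/2}\sum_{j=1}^pD_j$ (the coefficient of $1/z$ after the normalization $\mu^2R(\mu z)=1+D/z+O(z^{-2})$, $\mu=b^{-1/2}$, of $R=\frac12\bigl(\frac{P''}{P}-\frac32(\frac{P'}{P})^2\bigr)+\frac QP$). Fractional powers of $z-d$ are analytic branches in the sector $G_k(r,\delta)$, $\sqrt b=|b|^{1/2}e^{i\arg b/2}$, and $b^{-1/(N+2)}$ has argument $-\arg b/(N+2)$. *)

theory Defs
  imports "HOL-Complex_Analysis.Complex_Analysis" "HOL-Library.Landau_Symbols"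
begin

text \<open>
  Throughout, \<open>\<beta>\<close> is the fixed value of \<open>arg b\<close>. Indices \<open>k\<close> are integers; replacing \<open>k\<close> by
  \<open>k + (N + 2)\<close> shifts \<open>\<theta>\<^sub>k\<close> by \<open>2\<pi>\<close> and leaves all the sets below unchanged. A condition on
  \<open>arg(z - d)\<close> (modulo \<open>2\<pi>\<close>) is expressed as the existence of a value \<open>\<phi>\<close> of the argument that
  satisfies it.
\<close>

definition stokes_angle :: "nat \<Rightarrow> real \<Rightarrow> int \<Rightarrow> real" where
  "stokes_angle N \<beta> k = (2 * pi * of_int k - \<beta>) / (real N + 2)"

definition is_arg_of :: "real \<Rightarrow> complex \<Rightarrow> bool" where
  "is_arg_of \<phi> w \<longleftrightarrow> w \<noteq> 0 \<and> w = of_real (cmod w) * cis \<phi>"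

definition stokes_ray :: "nat \<Rightarrow> real \<Rightarrow> complex \<Rightarrow> int \<Rightarrow> complex set" where
  "stokes_ray N \<beta> d k = {z. is_arg_of (stokes_angle N \<beta> k) (z - d)}"

definition sector :: "nat \<Rightarrow> real \<Rightarrow> complex \<Rightarrow> int \<Rightarrow> real \<Rightarrow> real \<Rightarrow> complex set" where
  "sector N \<beta> d k r \<delta> =
     {z. cmod (z - d) > r \<and>
         (\<exists>\<phi>. is_arg_of \<phi> (z - d) \<and>
              stokes_angle N \<beta> (k - 1) + \<delta> < \<phi> \<and> \<phi> < stokes_angle N \<beta> (k + 1) - \<delta>)}"

definition loc_width :: "nat \<Rightarrow> complex \<Rightarrow> real \<Rightarrow> real" where
  "loc_width N D r =
     (if N \<ge> 3 then 1 / r ^ 2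
      else if N = 2 then ln r / r ^ 2
      else if N = 1 then r powr (- 3 / 2)
      else (1 + cmod D * ln r) / r)"

definition loc_region :: "nat \<Rightarrow> real \<Rightarrow> complex \<Rightarrow> complex \<Rightarrow> int \<Rightarrow> real \<Rightarrow> real \<Rightarrow> complex set" where
  "loc_region N \<beta> d D k r C =
     {z. cmod (z - d) > r \<and>
         (\<exists>\<phi>. is_arg_of \<phi> (z - d) \<and>
              \<bar>\<phi> - stokes_angle N \<beta> k\<bar> < C * loc_width N D (cmod (z - d)))}"

text \<open>
  The differential equation is imposed wherever its coefficients are defined, i.e.\ off the zeros
  of \<open>P\<close>.
\<close>

definition analytic_solution ::
    "complex poly \<Rightarrow> complex poly \<Rightarrow> complex set \<Rightarrow> (complex \<Rightarrow> complex) \<Rightarrow> bool" where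
  "analytic_solution P Q A g \<longleftrightarrow>
     g holomorphic_on A \<and>
     (\<forall>z\<in>A. poly P z \<noteq> 0 \<longrightarrow>
        deriv (deriv g) z - poly (pderiv P) z / poly P z * deriv g z
          + poly Q z / poly P z * g z = 0)"

definition fundamental_pair ::
    "complex poly \<Rightarrow> complex poly \<Rightarrow> complex set \<Rightarrow> (complex \<Rightarrow> complex) \<Rightarrow> (complex \<Rightarrow> complex) \<Rightarrow> bool"
  where
  "fundamental_pair P Q A f\<^sub>1 f\<^sub>2 \<longleftrightarrow>
     analytic_solution P Q A f\<^sub>1 \<and> analytic_solution P Q A f\<^sub>2 \<and>
     (\<forall>\<alpha>\<^sub>1 \<alpha>\<^sub>2. (\<forall>z\<in>A. \<alpha>\<^sub>1 * f\<^sub>1 z + \<alpha>\<^sub>2 * f\<^sub>2 z = 0) \<longrightarrow> \<alpha>\<^sub>1 = 0 \<and> \<alpha>\<^sub>2 = 0)"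

text \<open>
  All fractional powers of \<open>z - d\<close> come from one analytic branch \<open>L\<close> of \<open>log (z - d)\<close>, so that the
  branches of the different powers are compatible.
\<close>

definition log_branch :: "complex \<Rightarrow> complex set \<Rightarrow> (complex \<Rightarrow> complex) \<Rightarrow> bool" where
  "log_branch d A L \<longleftrightarrow> L holomorphic_on A \<and> (\<forall>z\<in>A. exp (L z) = z - d)"

definition branch_powr :: "(complex \<Rightarrow> complex) \<Rightarrow> real \<Rightarrow> complex \<Rightarrow> complex" where
  "branch_powr L s z = exp (of_real s * L z)"

text \<open>
  The two asymptotic formulas for a solution \<open>f\<close> and its derivative, as \<open>z\<close> tends to infinity inside
  \<open>A\<close>; \<open>\<sigma>\<close> is the sign and \<open>sb\<close> the chosen square root of \<open>b\<close>. The \<open>o(1)\<close> in the exponent is the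
  same function \<open>e\<close> in both formulas, the terms \<open>O((z - d)\<^sup>-\<^sup>1)\<close> are \<open>h\<^sub>0\<close> and \<open>h\<^sub>1\<close>.
\<close>

definition exp_factor ::
    "nat \<Rightarrow> complex \<Rightarrow> (complex \<Rightarrow> complex) \<Rightarrow> complex \<Rightarrow> (complex \<Rightarrow> complex) \<Rightarrow> complex \<Rightarrow> complex" where
  "exp_factor N sb L \<sigma> e z =
     exp (\<sigma> * 2 * \<i> * sb / of_nat (N + 2) * branch_powr L ((real N + 2) / 2) z * (1 + e z))"

definition solution_asymptotics ::
    "nat \<Rightarrow> nat \<Rightarrow> complex \<Rightarrow> complex \<Rightarrow> (complex \<Rightarrow> complex) \<Rightarrow> complex set \<Rightarrow> complex
      \<Rightarrow> (complex \<Rightarrow> complex) \<Rightarrow> bool" where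
  "solution_asymptotics p q sb d L A \<sigma> f \<longleftrightarrow>
     (let F = inf at_infinity (principal A); N = q - p in
      \<exists>e h\<^sub>0 h\<^sub>1.
        e \<in> o[F](\<lambda>_. 1) \<and> h\<^sub>0 \<in> O[F](\<lambda>z. 1 / (z - d)) \<and> h\<^sub>1 \<in> O[F](\<lambda>z. 1 / (z - d)) \<and>
        (\<forall>\<^sub>F z in F.
           f z = branch_powr L ((3 * real p - real q) / 4) z * exp_factor N sb L \<sigma> e z * (1 + h\<^sub>0 z)) \<and>
        (\<forall>\<^sub>F z in F.
           deriv f z =
             \<sigma> * \<i> * sb * branch_powr L ((real p + real q) / 4) z * exp_factor N sb L \<sigma> e z
               * (1 + h\<^sub>1 z)))"

end

theory Submission
  imports Defs "HOL-Real_Asymp.Real_Asymp"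
begin

text \<open>
  In the coordinate \<open>\<zeta>\<close> with \<open>\<alpha>\<^sup>2 b (z - d)\<^sup>N\<^sup>+\<^sup>2 = \<zeta>\<^sup>2\<close>, \<open>\<alpha> = 2 / (N + 2)\<close>, the Stokes ray \<open>\<Gamma>\<^sub>k\<close> is
  the positive real axis, and a narrow sector around it is a wedge \<open>\<bar>Im \<zeta>\<bar> < Re \<zeta>\<close>; \<open>\<delta>\<close> may be
  chosen large enough for this. The equation becomes \<open>G'' - a G' + (1 + V) G = 0\<close>, and
  \<open>G'/G = \<plusminus> i + a/2 + n\<close> turns it into the Riccati equation
  \<open>n' \<plusminus> 2 i n + n\<^sup>2 + W = 0\<close> with \<open>W = V + a'/2 - a\<^sup>2/4\<close>. For either sign the wedge contains rays, in the
  direction \<open>1 \<plusminus> i\<close>, along which the linear part has an exponentially decaying kernel, and \<open>|\<zeta>|\<close> grows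
  along them. So Picard iteration gives a solution with \<open>|n| \<le> 2 \<rho>\<close> whenever \<open>|W| \<le> \<rho>\<close>, with no
  integrability of \<open>W\<close> needed. The shift \<open>d\<close> makes \<open>V = O((z - d)\<^sup>-\<^sup>2)\<close> for \<open>N \<ge> 1\<close>, whereas for
  \<open>N = 0\<close> the term of order \<open>1 / z\<close> is proportional to \<open>D\<close>.

  The quotient of the two solutions is \<open>exp (2 i (\<zeta> + E))\<close> with \<open>|E'| \<le> 2 \<rho>\<close>. So the zeros of a combination
  are the solutions of \<open>\<zeta> + E = \<kappa> + \<pi> n\<close>, one for each large \<open>n\<close>, and \<open>Im \<zeta> = O(1 + \<integral> \<rho>)\<close> there, which is
  the localization. The product of the two solutions is given by their Wronskian, which yields \<open>g'\<close> at the
  zeros.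
\<close>

section \<open>Bounded solutions of a first-order linear equation in a wedge\<close>

text \<open>The coordinate straightens only the leading term of \<open>Q / P\<close>, so the
  remainder is of the order |\<zeta>|^(-2 \<alpha>), with |\<zeta>|^(-\<alpha>) in addition for N =
  0. This is integrable at infinity only if 2 \<alpha> > 1 and the extra term is absent; for N \<ge>
  2 the usual integral equations for perturbed exponentials would diverge. Passing to the
  logarithmic derivative removes the obstacle: n need only be small pointwise, and its possibly
  unbounded integral stays in the exponent, where the claimed o(1) leaves room for it, since a
  function whose derivative tends to 0 is o(\<zeta>). The same freedom makes the power in front of
  the solution almost costless; what carries content is that one function e serves the solution and
  its derivative, that is, the size of G'/G. The asymptotics of g' at the zeros is finer: a power of
  n would be lost inside e. Hence the product of the two solutions is computed up to a convergent
  factor, not only estimated. Each sign needs rays in its own direction 1 + i or 1 - i, and the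
  wedge has exactly these as its edges. Its half-opening \<pi>/4 shrinks to \<alpha> \<pi>/4 around
  the Stokes ray.\<close>

definition wedge :: "real \<Rightarrow> complex set" where
  "wedge A = {z. A < Re z \<and> \<bar>Im z\<bar> < Re z}"

lemma open_wedge [intro]: "open (wedge A)"
  unfolding wedge_def
  by (intro open_Collect_conj open_Collect_less continuous_intros)

lemma convex_wedge [intro]: "convex (wedge A)"
proof -
  have "wedge A = {z. Re z > A} \<inter> ({z. Re (z * (1 + \<i>)) > 0} \<inter> {z. Re (z * (1 - \<i>)) > 0})"
    by (auto simp: wedge_def)
  moreover have "convex {z. Re (z * c) > 0}" for c
    by (simp add: convex_def algebra_simps) (smt (verit) mult_nonneg_nonneg mult_pos_pos distrib_left right_diff_distrib')
  ultimately show ?thesis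
    by (simp only: convex_Int convex_halfspace_Re_gt)
qed

lemma wedge_mono: "A \<le> B \<Longrightarrow> wedge B \<subseteq> wedge A"
  by (auto simp: wedge_def)

lemma wedge_norm:
  assumes "z \<in> wedge A"
  shows "Re z \<le> norm z" "norm z \<le> 2 * Re z" "0 < Re z" "A < norm z" "z \<noteq> 0"
proof -
  show "Re z \<le> norm z" by (rule complex_Re_le_cmod)
  show "norm z \<le> 2 * Re z" using cmod_le[of z] assms by (auto simp: wedge_def)
  show "0 < Re z" using assms by (auto simp: wedge_def)
  then show "z \<noteq> 0" by auto
  show "A < norm z" using assms \<open>Re z \<le> norm z\<close> by (auto simp: wedge_def)
qed

text \<open>Moving along the ray adds the same amount s to the real part and at most s to |Im z|, so
  no edge is crossed. The modulus grows because the direction has inner product Re z + \<sigma> Im z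
  \<ge> 0 with z.\<close>

lemma wedge_ray:
  assumes "z \<in> wedge A" "0 \<le> s" "\<bar>\<sigma>\<bar> = 1"
  shows "z + of_real s * Complex 1 \<sigma> \<in> wedge A" "norm z \<le> norm (z + of_real s * Complex 1 \<sigma>)"
proof -
  have s: "\<bar>s * \<sigma>\<bar> = s" using assms by (simp add: abs_mult)
  then show "z + of_real s * Complex 1 \<sigma> \<in> wedge A" using assms by (auto simp: wedge_def)
  have "(Re z + s)\<^sup>2 + (Im z + s * \<sigma>)\<^sup>2 = (Re z)\<^sup>2 + (Im z)\<^sup>2 + 2 * s * (Re z + \<sigma> * Im z) + s\<^sup>2 + (s * \<sigma>)\<^sup>2"
    by (simp add: power2_eq_square algebra_simps)
  moreover have "0 \<le> Re z + \<sigma> * Im z" using assms by (auto simp: wedge_def abs_if split: if_splits)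
  ultimately have "(Re z)\<^sup>2 + (Im z)\<^sup>2 \<le> (Re z + s)\<^sup>2 + (Im z + s * \<sigma>)\<^sup>2" using assms(2)
    by simp
  then show "norm z \<le> norm (z + of_real s * Complex 1 \<sigma>)" by (simp add: cmod_def)
qed

text \<open>The real part of 2 \<sigma> i s (1 + \<sigma> i) is -2 s, as
  \<open>\<sigma> * \<sigma> = 1\<close>. So each sign has its own direction of exponential
  decay.\<close>

lemma norm_exp_ray:
  assumes "\<bar>\<sigma>\<bar> = 1"
  shows "norm (exp (2 * of_real \<sigma> * \<i> * (z + of_real s * Complex 1 \<sigma>)))
         = norm (exp (2 * of_real \<sigma> * \<i> * z)) * exp (- (2 * s))"
proof -
  have "\<sigma> * \<sigma> = 1" using assms by (auto simp: abs_if split: if_splits)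
  then have "\<sigma> * (s * \<sigma>) = s" by (simp add: mult.left_commute)
  then show ?thesis by (simp add: norm_exp_eq_Re exp_add[symmetric] algebra_simps)
qed

lemma primitive_ray_bound:
  assumes F: "\<And>z. z \<in> wedge A \<Longrightarrow>
                DERIV F z :> exp (2 * of_real \<sigma> * \<i> * z) * f z"
    and z: "z \<in> wedge A" and \<sigma>: "\<bar>\<sigma>\<bar> = 1" and s: "0 \<le> s"
    and M: "\<And>s. 0 \<le> s \<Longrightarrow> norm (f (z + of_real s * Complex 1 \<sigma>)) \<le> M"
  shows "norm (F (z + of_real s * Complex 1 \<sigma>) - F z)
           \<le> norm (exp (2 * of_real \<sigma> * \<i> * z)) * M * (1 - exp (- (2 * s)))"
proof (cases "s = 0")
  case False
  let ?\<omega> = "Complex 1 \<sigma>" and ?K = "norm (exp (2 * of_real \<sigma> * \<i> * z))"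
  define h where "h = (\<lambda>t. F (z + of_real t * ?\<omega>))"
  define \<phi> where "\<phi> = (\<lambda>t. - ?K * M * exp (- (2 * t)))"
  have h': "(h has_vector_derivative
       (exp (2 * of_real \<sigma> * \<i> * (z + of_real t * ?\<omega>)) * f (z + of_real t * ?\<omega>)) * ?\<omega>) (at t)"
    if "0 \<le> t" for t
  proof -
    have "DERIV (\<lambda>t. F (z + t * ?\<omega>)) (of_real t) :> (exp (2 * of_real \<sigma> * \<i> * (z + of_real t * ?\<omega>)) * f (z + of_real t * ?\<omega>)) * ?\<omega>"
      by (rule DERIV_chain2[where f = F and g = "\<lambda>t. z + t * ?\<omega>", OF F[OF wedge_ray(1)[OF z that \<sigma>]]])
         (auto intro!: derivative_eq_intros)
    then show ?thesis unfolding h_def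
      by (rule has_vector_derivative_real_field)
  qed
  have \<phi>': "(\<phi> has_vector_derivative 2 * ?K * M * exp (- (2 * t))) (at t)" for t
    unfolding \<phi>_def has_real_derivative_iff_has_vector_derivative[symmetric]
    by (auto intro!: derivative_eq_intros)
  \<comment> \<open>The crude value 2 instead of sqrt 2 is deliberate: 2 exp(-2 t) integrates to 1 -
    exp(-2 s), so the final bound is M without any constant.\<close>
  have \<omega>: "norm ?\<omega> \<le> 2"
    using cmod_le[of ?\<omega>] \<sigma> by simp
  have "norm (h s - h 0) \<le> \<phi> s - \<phi> 0"
  proof (rule differentiable_bound_general)
    show "0 < s" using s False by simp
    show "continuous_on {0..s} \<phi>" unfolding \<phi>_def by (intro continuous_intros)
    show "continuous_on {0..s} h"
      by (rule continuous_at_imp_continuous_on) (use h' has_vector_derivative_continuous in force)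
    show "\<And>t. 0 < t \<Longrightarrow> t < s \<Longrightarrow> (h has_vector_derivative
       (exp (2 * of_real \<sigma> * \<i> * (z + of_real t * ?\<omega>)) * f (z + of_real t * ?\<omega>)) * ?\<omega>) (at t)"
      using h' by simp
    show "\<And>t. (\<phi> has_vector_derivative 2 * ?K * M * exp (- (2 * t))) (at t)" by (rule \<phi>')
    fix t assume t: "0 < t" "t < s"
    have "norm (exp (2 * of_real \<sigma> * \<i> * (z + of_real t * ?\<omega>)) * f (z + of_real t * ?\<omega>) * ?\<omega>)
        \<le> (?K * exp (- (2 * t))) * M * 2"
      unfolding norm_mult norm_exp_ray[OF \<sigma>]
      using M[of t] t \<omega> order_trans[OF norm_ge_zero M[of t]]
      by (intro mult_mono) auto
    then show "norm (exp (2 * of_real \<sigma> * \<i> * (z + of_real t * ?\<omega>)) * f (z + of_real t * ?\<omega>) * ?\<omega>)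
        \<le> 2 * ?K * M * exp (- (2 * t))" by (simp add: mult_ac)
  qed
  then show ?thesis by (simp add: h_def \<phi>_def algebra_simps)
qed auto

text \<open>After multiplication by the integrating factor, the contribution of m at the far end of
  the ray decays exponentially as soon as m is bounded. Hence the a priori bound B disappears in the
  limit and only the size of f along this one ray remains. Applied to differences of solutions, this
  yields the contraction.\<close>

lemma linear_equation_bound:
  assumes m: "\<And>z. z \<in> wedge A \<Longrightarrow>
                DERIV m z :> - 2 * of_real \<sigma> * \<i> * m z - f z"
    and \<sigma>: "\<bar>\<sigma>\<bar> = 1" and B: "\<And>z. z \<in> wedge A \<Longrightarrow> norm (m z) \<le> B"
    and z: "z \<in> wedge A"
    and M: "\<And>s. 0 \<le> s \<Longrightarrow> norm (f (z + of_real s * Complex 1 \<sigma>)) \<le> M"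
  shows "norm (m z) \<le> M"
proof -
  let ?e = "\<lambda>z. exp (2 * of_real \<sigma> * \<i> * z)"
  define F where "F = (\<lambda>z. - (?e z * m z))"
  have F: "DERIV F z :> ?e z * f z" if "z \<in> wedge A" for z
    unfolding F_def by (auto intro!: derivative_eq_intros m[OF that] simp: algebra_simps)
  have "norm (m z) \<le> M + exp (- (2 * s)) * (B - M)" if s: "0 \<le> s" for s
  proof -
    let ?y = "z + of_real s * Complex 1 \<sigma>"
    have "norm (F z) \<le> norm (F ?y) + norm (F ?y - F z)"
      using norm_triangle_ineq4[of "F ?y" "F ?y - F z"] by simp
    also have "\<dots> \<le> norm (?e z) * exp (- (2 * s)) * B + norm (?e z) * M * (1 - exp (- (2 * s)))"
    proof (rule add_mono)
      show "norm (F ?y) \<le> norm (?e z) * exp (- (2 * s)) * B"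
        unfolding F_def norm_minus_cancel norm_mult norm_exp_ray[OF \<sigma>]
        using B[OF wedge_ray(1)[OF z s \<sigma>]] by (simp add: mult_left_mono)
    qed (rule primitive_ray_bound[OF F z \<sigma> s M])
    also have "\<dots> = norm (?e z) * (M + exp (- (2 * s)) * (B - M))" by (simp add: algebra_simps)
    finally have "norm (?e z) * norm (m z) \<le> \<dots>" by (simp add: F_def norm_mult)
    then show ?thesis by simp
  qed
  moreover have "((\<lambda>s. M + exp (- (2 * s)) * (B - M)) \<longlongrightarrow> M + 0 * (B - M)) at_top"
    by (intro tendsto_intros filterlim_compose[OF exp_at_bot]) real_asymp
  ultimately show ?thesis
    by (intro tendsto_lowerbound[of "\<lambda>s. M + exp (- (2 * s)) * (B - M)" M at_top])
       (auto simp: eventually_at_top_linorder)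
qed

text \<open>The solution is exp(-2 \<sigma> i z) times the integral of exp(2 \<sigma> i v) f(v) from
  z to infinity along the ray. It is written as l - F z with a primitive F, so that holomorphy is
  immediate; the work is to show that F has the same limit l along all rays.\<close>

lemma linear_equation_solution:
  assumes f: "f holomorphic_on wedge A" and \<sigma>: "\<bar>\<sigma>\<bar> = 1"
    and M: "\<And>z. z \<in> wedge A \<Longrightarrow> norm (f z) \<le> M"
  obtains m where
    "\<And>z. z \<in> wedge A \<Longrightarrow> DERIV m z :> - 2 * of_real \<sigma> * \<i> * m z - f z"
    "\<And>z. z \<in> wedge A \<Longrightarrow> norm (m z) \<le> M"
proof -
  let ?e = "\<lambda>z. exp (2 * of_real \<sigma> * \<i> * z)" and ?\<omega> = "Complex 1 \<sigma>"
  have "(\<lambda>z. ?e z * f z) holomorphic_on wedge A"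
    by (intro holomorphic_intros f)
  from holomorphic_convex_primitive'[OF convex_wedge open_wedge this]
  obtain F where F0: "\<And>z. z \<in> wedge A \<Longrightarrow> (F has_field_derivative ?e z * f z) (at z within wedge A)"
    by blast
  have F: "DERIV F z :> ?e z * f z" if "z \<in> wedge A" for z
    using F0[OF that] at_within_open[OF that open_wedge] by simp
  define x where "x = complex_of_real (\<bar>A\<bar> + 1)"
  have x: "x \<in> wedge A" by (auto simp: x_def wedge_def)
  define y where "y = (\<lambda>z n. z + of_real (real n) * ?\<omega>)"
  have y: "y z n \<in> wedge A" if "z \<in> wedge A" for z n
    unfolding y_def by (rule wedge_ray(1)[OF that _ \<sigma>]) simp
  have M0: "0 \<le> M" using M[OF x] norm_ge_zero order_trans by blast
  have exp0: "(\<lambda>n. K * exp (- (2 * real n))) \<longlonglongrightarrow> 0" for K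
    by real_asymp
  have step: "norm (F (y x n) - F (y x k)) \<le> norm (?e x) * M * exp (- (2 * real k))" if "k \<le> n" for k n
  proof -
    have "norm (F (y x k + of_real (real (n - k)) * ?\<omega>) - F (y x k))
       \<le> norm (?e (y x k)) * M * (1 - exp (- (2 * real (n - k))))"
      by (rule primitive_ray_bound[OF F y[OF x] \<sigma>])
         (auto intro!: M wedge_ray y x \<sigma>)
    also have "\<dots> \<le> norm (?e (y x k)) * M * 1"
      using M0 by (intro mult_left_mono) auto
    also have "\<dots> = norm (?e x) * M * exp (- (2 * real k))"
      unfolding y_def norm_exp_ray[OF \<sigma>] by (simp add: mult_ac)
    also have "y x k + of_real (real (n - k)) * ?\<omega> = y x n"
      using that by (simp add: y_def algebra_simps of_nat_diff)
    finally show ?thesis .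
  qed
  have "Cauchy (\<lambda>n. F (y x n))"
  proof (rule CauchyI')
    fix e :: real assume "e > 0"
    then obtain k where k: "\<And>n. n \<ge> k \<Longrightarrow> norm (?e x) * M * exp (- (2 * real n)) < e"
      using order_tendstoD(2)[OF exp0] by (force simp: eventually_sequentially)
    have "\<forall>m\<ge>k. \<forall>n>m. norm (F (y x m) - F (y x n)) < e"
      using le_less_trans[OF step k] by (auto simp: norm_minus_commute)
    then show "\<exists>k. \<forall>m\<ge>k. \<forall>n>m. dist (F (y x m)) (F (y x n)) < e" by (auto simp: dist_norm)
  qed
  then obtain l where l: "(\<lambda>n. F (y x n)) \<longlonglongrightarrow> l"
    using Cauchy_convergent convergent_def by blast
  \<comment> \<open>The segment between the nth points of two rays has the fixed length |z - x|, and
    the integrand on it is of the order exp(-2 n).\<close>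
  have lim: "(\<lambda>n. F (y z n)) \<longlonglongrightarrow> l" if z: "z \<in> wedge A" for z
  proof -
    define K where "K = (norm (?e z) + norm (?e x)) * M * norm (z - x)"
    have "norm (F (y z n) - F (y x n)) \<le> K * exp (- (2 * real n))" for n
    proof -
      have "norm (F (y z n) - F (y x n))
         \<le> ((norm (?e z) + norm (?e x)) * exp (- (2 * real n)) * M) * norm (y z n - y x n)"
      proof (rule field_differentiable_bound)
        show "convex (closed_segment (y z n) (y x n))" by simp
        have sub: "closed_segment (y z n) (y x n) \<subseteq> wedge A"
          by (intro closed_segment_subset y z x convex_wedge)
        show "(F has_field_derivative ?e v * f v) (at v within closed_segment (y z n) (y x n))"
          if "v \<in> closed_segment (y z n) (y x n)" for v
          using F sub that by (blast intro: has_field_derivative_at_within)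
        fix v assume v: "v \<in> closed_segment (y z n) (y x n)"
        then obtain u where u: "0 \<le> u" "u \<le> 1" "v = (1 - u) *\<^sub>R y z n + u *\<^sub>R y x n"
          by (auto simp: in_segment)
        \<comment> \<open>The modulus is the exponential of a real affine function, so on a segment
          it is largest at an endpoint.\<close>
        have "norm (?e v) \<le> max (norm (?e (y z n))) (norm (?e (y x n)))"
        proof -
          have "Re (2 * of_real \<sigma> * \<i> * v)
              = (1 - u) * Re (2 * of_real \<sigma> * \<i> * y z n) + u * Re (2 * of_real \<sigma> * \<i> * y x n)"
            by (simp add: u(3) algebra_simps)
          also have "\<dots> \<le> max (Re (2 * of_real \<sigma> * \<i> * y z n)) (Re (2 * of_real \<sigma> * \<i> * y x n))"
            using u by (intro convex_bound_le) auto
          finally show ?thesis unfolding norm_exp_eq_Re by (simp add: max_def split: if_splits)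
        qed
        also have "\<dots> \<le> norm (?e (y z n)) + norm (?e (y x n))" by simp
        also have "\<dots> = (norm (?e z) + norm (?e x)) * exp (- (2 * real n))"
          unfolding y_def norm_exp_ray[OF \<sigma>] by (simp add: algebra_simps)
        finally show "norm (?e v * f v) \<le> (norm (?e z) + norm (?e x)) * exp (- (2 * real n)) * M"
          unfolding norm_mult using M[of v] v sub by (intro mult_mono) auto
      qed auto
      also have "y z n - y x n = z - x" by (simp add: y_def)
      finally show ?thesis by (simp add: K_def mult_ac)
    qed
    then have "(\<lambda>n. F (y z n) - F (y x n)) \<longlonglongrightarrow> 0"
      by (rule Lim_null_comparison[OF always_eventually[OF allI] exp0])
    from tendsto_add[OF this l] show ?thesis by simp
  qed
  define m where "m = (\<lambda>z. exp (- (2 * of_real \<sigma> * \<i> * z)) * (l - F z))"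
  show ?thesis
  proof
    fix z assume z: "z \<in> wedge A"
    show "DERIV m z :> - 2 * of_real \<sigma> * \<i> * m z - f z"
      unfolding m_def
      by (auto intro!: derivative_eq_intros F[OF z] simp: algebra_simps exp_minus)
    have "norm (F (y z n) - F z) \<le> norm (?e z) * M" for n
    proof -
      have "norm (F (y z n) - F z) \<le> norm (?e z) * M * (1 - exp (- (2 * real n)))"
        unfolding y_def by (rule primitive_ray_bound[OF F z \<sigma>]) (auto intro!: M wedge_ray z \<sigma>)
      also have "\<dots> \<le> norm (?e z) * M * 1"
        using M0 by (intro mult_left_mono) auto
      finally show ?thesis by simp
    qed
    then have "norm (l - F z) \<le> norm (?e z) * M"
      by (intro tendsto_upperbound[OF tendsto_norm[OF tendsto_diff[OF lim[OF z] tendsto_const]]]) auto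
    then have "norm (exp (- (2 * of_real \<sigma> * \<i> * z))) * norm (l - F z)
        \<le> norm (exp (- (2 * of_real \<sigma> * \<i> * z))) * (norm (?e z) * M)"
      by (rule mult_left_mono) auto
    also have "\<dots> = M" by (simp add: exp_minus norm_inverse norm_divide field_simps)
    finally show "norm (m z) \<le> M" by (simp add: m_def norm_mult)
  qed
qed

section \<open>A Riccati equation and growth estimates in the wedge\<close>

text \<open>
  The function \<open>\<rho>\<close> has to be decreasing because the solution at \<open>z\<close> depends on \<open>W\<close> along the whole
  ray from \<open>z\<close> in the direction \<open>1 + \<sigma> i\<close>.
\<close>

lemma riccati_solution:
  assumes W: "W holomorphic_on wedge A" and \<sigma>: "\<bar>\<sigma>\<bar> = 1"
    and W_le: "\<And>z. z \<in> wedge A \<Longrightarrow> norm (W z) \<le> \<rho> (norm z)"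
    and small: "\<And>z. z \<in> wedge A \<Longrightarrow> \<rho> (norm z) \<le> 1 / 8"
    and anti: "\<And>x y. A < x \<Longrightarrow> x \<le> y \<Longrightarrow> \<rho> y \<le> \<rho> x"
  obtains n where
    "\<And>z. z \<in> wedge A \<Longrightarrow>
       DERIV n z :> - 2 * of_real \<sigma> * \<i> * n z - (W z + (n z)\<^sup>2)"
    "\<And>z. z \<in> wedge A \<Longrightarrow> norm (n z) \<le> 2 * \<rho> (norm z)"
proof -
  define good where
    "good n \<longleftrightarrow> n holomorphic_on wedge A \<and> (\<forall>z\<in>wedge A. norm (n z) \<le> 2 * \<rho> (norm z))" for n :: "complex \<Rightarrow> complex"
  define sol where
    "sol n m \<longleftrightarrow> (\<forall>z\<in>wedge A.
       DERIV m z :> - 2 * of_real \<sigma> * \<i> * m z - (W z + (n z)\<^sup>2))" for n m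
  have \<rho>0: "0 \<le> \<rho> (norm z)" if "z \<in> wedge A" for z
    using W_le[OF that] norm_ge_zero order_trans by blast
  \<comment> \<open>With |n| \<le> 2 \<rho> and \<rho> \<le> 1/8, |n|^2 is at most 2 \<rho> / 4,
    hence at most \<rho>. This makes the set of functions with |n| \<le> 2 \<rho> invariant under
    the iteration.\<close>
  have sq: "norm (W v + (n v)\<^sup>2) \<le> 2 * \<rho> (norm v)" if "good n" "v \<in> wedge A" for n v
  proof -
    have n: "norm (n v) \<le> 2 * \<rho> (norm v)" using that by (auto simp: good_def)
    have "norm (n v) * norm (n v) \<le> (2 * \<rho> (norm v)) * (2 * (1 / 8))"
      using n small[OF that(2)] \<rho>0[OF that(2)] by (intro mult_mono) auto
    then have "norm ((n v)\<^sup>2) \<le> \<rho> (norm v)"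
      using \<rho>0[OF that(2)] by (simp add: norm_mult power2_eq_square)
    then show ?thesis using norm_triangle_ineq[of "W v" "(n v)\<^sup>2"] W_le[OF that(2)] by linarith
  qed
  have ray: "norm (W v + (n v)\<^sup>2) \<le> 2 * \<rho> (norm z)"
    if "good n" "z \<in> wedge A" "0 \<le> s" "v = z + of_real s * Complex 1 \<sigma>" for n z s v
    using sq[OF that(1), of v] wedge_ray[OF that(2,3) \<sigma>] anti[of "norm z" "norm v"]
      wedge_norm(4)[OF that(2)] that(4) by auto
  have step: "\<exists>m. good m \<and> sol n m" if n: "good n" for n
  proof -
    have hol: "(\<lambda>z. W z + (n z)\<^sup>2) holomorphic_on wedge A"
      using n by (auto simp: good_def intro!: holomorphic_intros W)
    have bd: "norm (W z + (n z)\<^sup>2) \<le> 1 / 4" if "z \<in> wedge A" for z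
      using sq[OF n that] small[OF that] by simp
    obtain m where m: "\<And>z. z \<in> wedge A \<Longrightarrow>
        DERIV m z :> - 2 * of_real \<sigma> * \<i> * m z - (W z + (n z)\<^sup>2)"
      "\<And>z. z \<in> wedge A \<Longrightarrow> norm (m z) \<le> 1 / 4"
      by (rule linear_equation_solution[OF hol \<sigma> bd]) blast+
    \<comment> \<open>The construction of m gives only the uniform bound 1/4. That bound suffices as
      the a priori bound of the ray estimate, which sharpens it to the pointwise one.\<close>
    have "norm (m z) \<le> 2 * \<rho> (norm z)" if z: "z \<in> wedge A" for z
      by (rule linear_equation_bound[OF m(1) \<sigma> m(2) z]) (auto intro: ray[OF n z])
    moreover have "m holomorphic_on wedge A"
      using m(1) by (auto simp: holomorphic_on_open[OF open_wedge])
    ultimately show ?thesis using m(1) by (auto simp: good_def sol_def)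
  qed
  define T where "T n = (SOME m. good m \<and> sol n m)" for n
  have T: "good (T n) \<and> sol n (T n)" if "good n" for n
    unfolding T_def using step[OF that] by (rule someI_ex)
  define s where "s j = (T ^^ j) (\<lambda>_. 0)" for j
  have good0: "good (\<lambda>_. 0)" using \<rho>0 by (auto simp: good_def)
  have good: "good (s j)" for j
    by (induction j) (auto simp: s_def good0 T)
  have sol: "sol (s j) (s (Suc j))" for j
    using T[OF good[of j]] by (simp add: s_def)
  have le: "norm (s j z) \<le> 1 / 4" if "z \<in> wedge A" for j z
    using good[of j] small[OF that] that by (auto simp: good_def dest!: bspec)
  \<comment> \<open>A difference of iterates solves the linear equation whose right-hand side is the
    difference of two squares. Its factor \<open>s (Suc j) + s j\<close> is at most 1/4 + 1/4, which
    is the contraction constant.\<close>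
  have diff: "norm (s (Suc j) z - s j z) \<le> (1 / 2) ^ j" if "z \<in> wedge A" for j z
    using that
  proof (induction j arbitrary: z)
    case 0
    then show ?case using le[OF 0, of "Suc 0"] by (simp add: s_def)
  next
    case (Suc j)
    show ?case
    proof (rule linear_equation_bound[where m = "\<lambda>z. s (Suc (Suc j)) z - s (Suc j) z"
          and f = "\<lambda>z. (s (Suc j) z)\<^sup>2 - (s j z)\<^sup>2" and B = "1 / 2", OF _ \<sigma> _ Suc.prems])
      fix v assume v: "v \<in> wedge A"
      show "DERIV (\<lambda>z. s (Suc (Suc j)) z - s (Suc j) z) v :> - 2 * of_real \<sigma> * \<i> * (s (Suc (Suc j)) v - s (Suc j) v) - ((s (Suc j) v)\<^sup>2 - (s j v)\<^sup>2)"
        using sol[of j] sol[of "Suc j"] v unfolding sol_def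
        by (auto intro!: derivative_eq_intros simp: algebra_simps)
      show "norm (s (Suc (Suc j)) v - s (Suc j) v) \<le> 1 / 2"
        using norm_triangle_ineq4[of "s (Suc (Suc j)) v" "s (Suc j) v"] le[OF v, of "Suc j"] le[OF v, of "Suc (Suc j)"]
        by linarith
    next
      fix u :: real assume u: "0 \<le> u"
      let ?v = "z + of_real u * Complex 1 \<sigma>"
      have v: "?v \<in> wedge A" by (rule wedge_ray(1)[OF Suc.prems u \<sigma>])
      have "norm ((s (Suc j) ?v)\<^sup>2 - (s j ?v)\<^sup>2) = norm (s (Suc j) ?v + s j ?v) * norm (s (Suc j) ?v - s j ?v)"
        by (simp add: norm_mult[symmetric] power2_eq_square algebra_simps)
      also have "\<dots> \<le> (1 / 2) * (1 / 2) ^ j"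
        using norm_triangle_ineq[of "s (Suc j) ?v" "s j ?v"] le[OF v, of "Suc j"] le[OF v, of j] Suc.IH[OF v]
        by (intro mult_mono) auto
      finally show "norm ((s (Suc j) ?v)\<^sup>2 - (s j ?v)\<^sup>2) \<le> (1 / 2) ^ Suc j" by simp
    qed
  qed
  define g where "g z = (\<Sum>j. s (Suc j) z - s j z)" for z
  have "uniform_limit (wedge A) (\<lambda>k z. \<Sum>j<k. s (Suc j) z - s j z) g sequentially"
    unfolding g_def by (rule Weierstrass_m_test[OF diff]) (auto intro: summable_geometric)
  then have ul: "uniform_limit (wedge A) s g sequentially"
    using sum_lessThan_telescope[of "\<lambda>j. s j z" for z] by (simp add: s_def[of 0])
  have ul': "uniform_limit (wedge A) (\<lambda>k. s (Suc k)) g sequentially"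
    by (rule filterlim_compose[OF ul filterlim_Suc])
  have "\<exists>g'. \<forall>z\<in>wedge A. DERIV g z :> g' z \<and>
      (\<lambda>k. - 2 * of_real \<sigma> * \<i> * s (Suc k) z - (W z + (s k z)\<^sup>2)) \<longlonglongrightarrow> g' z"
  proof (rule has_complex_derivative_uniform_sequence[OF open_wedge])
    show "DERIV (s (Suc k)) z :> - 2 * of_real \<sigma> * \<i> * s (Suc k) z - (W z + (s k z)\<^sup>2)"
      if "z \<in> wedge A" for k z
      using sol[of k] that by (auto simp: sol_def)
    show "\<exists>d>0. cball z d \<subseteq> wedge A \<and> uniform_limit (cball z d) (\<lambda>k. s (Suc k)) g sequentially"
      if "z \<in> wedge A" for z
      using open_wedge that uniform_limit_on_subset[OF ul'] by (metis open_contains_cball)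
  qed
  then obtain g' where g': "\<And>z. z \<in> wedge A \<Longrightarrow> DERIV g z :> g' z"
    "\<And>z. z \<in> wedge A \<Longrightarrow> (\<lambda>k. - 2 * of_real \<sigma> * \<i> * s (Suc k) z - (W z + (s k z)\<^sup>2)) \<longlonglongrightarrow> g' z"
    by blast
  show ?thesis
  proof
    fix z assume z: "z \<in> wedge A"
    have lim: "(\<lambda>k. s k z) \<longlonglongrightarrow> g z" by (rule tendsto_uniform_limitI[OF ul z])
    have "(\<lambda>k. - 2 * of_real \<sigma> * \<i> * s (Suc k) z - (W z + (s k z)\<^sup>2))
        \<longlonglongrightarrow> - 2 * of_real \<sigma> * \<i> * g z - (W z + (g z)\<^sup>2)"
      by (intro tendsto_intros lim LIMSEQ_Suc[OF lim])
    from LIMSEQ_unique[OF g'(2)[OF z] this]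
    show "DERIV g z :> - 2 * of_real \<sigma> * \<i> * g z - (W z + (g z)\<^sup>2)"
      using g'(1)[OF z] by simp
    show "norm (g z) \<le> 2 * \<rho> (norm z)"
      using good z by (intro tendsto_upperbound[OF tendsto_norm[OF lim]]) (auto simp: good_def)
  qed
qed

section \<open>Limits at infinity inside the wedge and growth of functions with small
  derivative\<close>

definition wedge_at_top :: "complex filter" where
  "wedge_at_top = inf at_infinity (principal (wedge 0))"

text \<open>The factor 2 comes from |z| \<le> 2 Re z in every wedge. It is the reason for the radii
  of the form \<open>2 * \<bar>A\<bar>\<close> below.\<close>

lemma norm_gt_imp_wedge:
  assumes "z \<in> wedge B" "2 * \<bar>A\<bar> < norm z"
  shows "z \<in> wedge A"
  using wedge_norm(2)[OF assms(1)] assms by (auto simp: wedge_def)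

lemma wedge_0_scale:
  assumes "z \<in> wedge 0" "0 < c"
  shows "of_real c * z \<in> wedge 0"
  using assms by (simp add: wedge_def abs_mult)

lemma eventually_wedge_at_top:
  "eventually P wedge_at_top \<longleftrightarrow> (\<exists>A. \<forall>z\<in>wedge A. P z)"
proof
  assume "eventually P wedge_at_top"
  then obtain b where b: "\<And>z. b \<le> norm z \<Longrightarrow> z \<in> wedge 0 \<Longrightarrow> P z"
    by (auto simp: wedge_at_top_def eventually_inf_principal eventually_at_infinity)
  have "P z" if "z \<in> wedge \<bar>b\<bar>" for z
    using that wedge_norm(4)[OF that] wedge_mono[of 0 "\<bar>b\<bar>"] by (intro b) auto
  then show "\<exists>A. \<forall>z\<in>wedge A. P z" by blast
next
  assume "\<exists>A. \<forall>z\<in>wedge A. P z"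
  then obtain A where A: "\<forall>z\<in>wedge A. P z" by blast
  have "P z" if "z \<in> wedge 0" "2 * \<bar>A\<bar> + 1 \<le> norm z" for z
    using A norm_gt_imp_wedge[OF that(1), of A] that(2) by simp
  then show "eventually P wedge_at_top"
    by (auto simp: wedge_at_top_def eventually_inf_principal eventually_at_infinity)
qed

lemma eventually_wedge_at_topI: "(\<And>z. z \<in> wedge A \<Longrightarrow> P z) \<Longrightarrow> eventually P wedge_at_top"
  using eventually_wedge_at_top by blast

lemma wedge_Lipschitz:
  assumes "\<And>z. z \<in> wedge A \<Longrightarrow> DERIV f z :> f' z"
    and "\<And>z. z \<in> wedge A \<Longrightarrow> norm (f' z) \<le> K"
    and "x \<in> wedge A" "y \<in> wedge A"
  shows "norm (f x - f y) \<le> K * norm (x - y)"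
  using assms
  by (intro field_differentiable_bound[OF convex_wedge]) (auto intro: has_field_derivative_at_within)

lemma sublinear_if_deriv_tendsto_0:
  assumes f: "\<And>z. z \<in> wedge A \<Longrightarrow> DERIV f z :> f' z"
    and f': "(f' \<longlongrightarrow> 0) wedge_at_top"
  shows "((\<lambda>z. f z / z) \<longlongrightarrow> 0) wedge_at_top"
proof (rule tendstoI)
  fix e :: real assume e: "e > 0"
  have "eventually (\<lambda>z. norm (f' z) < e / 4) wedge_at_top"
    using tendstoD[OF f', of "e / 4"] e by simp
  then obtain B where B: "\<And>z. z \<in> wedge B \<Longrightarrow> norm (f' z) < e / 4"
    unfolding eventually_wedge_at_top by blast
  define C where "C = max A B"
  define x where "x = complex_of_real (\<bar>C\<bar> + 1)"
  have x: "x \<in> wedge C" by (auto simp: x_def wedge_def)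
  define K where "K = norm (f x) + e / 4 * norm x"
  have "dist (f z / z) 0 < e" if z: "z \<in> wedge (max C (4 * K / e))" for z
  proof -
    have zC: "z \<in> wedge C" using z by (auto simp: wedge_def)
    have "norm (f z - f x) \<le> e / 4 * norm (z - x)"
    proof (rule wedge_Lipschitz[where f' = f' and A = C])
      show "DERIV f v :> f' v" if "v \<in> wedge C" for v
        using that by (intro f) (auto simp: C_def wedge_def)
      show "norm (f' v) \<le> e / 4" if "v \<in> wedge C" for v
        using that by (intro less_imp_le B) (auto simp: C_def wedge_def)
    qed (use x zC in auto)
    also have "\<dots> \<le> e / 4 * (norm z + norm x)"
      using e by (intro mult_left_mono norm_triangle_ineq4) auto
    finally have "norm (f z) \<le> e / 4 * norm z + K"
      using norm_triangle_ineq2[of "f z" "f x"] by (simp add: K_def algebra_simps)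
    moreover have "4 * K / e < norm z" using wedge_norm(4)[OF z] by simp
    then have "K < e / 4 * norm z" using e by (simp add: field_simps)
    moreover have "0 < e * norm z" using e wedge_norm(5)[OF z] by simp
    ultimately have "norm (f z) < e * norm z" by simp
    then show ?thesis using wedge_norm(5)[OF z] by (simp add: norm_divide field_simps)
  qed
  then show "eventually (\<lambda>z. dist (f z / z) 0 < e) wedge_at_top"
    by (rule eventually_wedge_at_topI)
qed

text \<open>Integrate along the radius through z from modulus 2 |A| + 1 outwards; radial points
  beyond 2 |A| remain in \<open>wedge A\<close>, and there the bound on f' is a function of the
  modulus alone. The remaining displacement at modulus 2 |A| + 1 has length at most twice this
  radius, so a Lipschitz constant K handles it.\<close>

lemma radial_bound:
  assumes f: "\<And>z. z \<in> wedge A \<Longrightarrow> DERIV f z :> f' z"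
    and f': "\<And>z. z \<in> wedge A \<Longrightarrow> norm (f' z) \<le> \<rho> (norm z)"
    and K: "\<And>z. z \<in> wedge A \<Longrightarrow> norm (f' z) \<le> K"
    and P: "\<And>s. 2 * \<bar>A\<bar> < s \<Longrightarrow> (P has_real_derivative \<rho> s) (at s)"
  obtains C where "\<And>z. z \<in> wedge 0 \<Longrightarrow> 2 * \<bar>A\<bar> + 1 \<le> norm z \<Longrightarrow> norm (f z) \<le> C + P (norm z)"
proof -
  define s where "s = 2 * \<bar>A\<bar> + 1"
  have s: "0 < s" "complex_of_real s \<in> wedge A" by (auto simp: s_def wedge_def)
  have K0: "0 \<le> K" using K[OF s(2)] norm_ge_zero order_trans by blast
  define C where "C = norm (f s) + K * (2 * s) - P s"
  have "norm (f z) \<le> C + P (norm z)" if z: "z \<in> wedge 0" "s \<le> norm z" for z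
  proof -
    define u where "u = sgn z"
    have z0: "z \<noteq> 0" using z s by auto
    have u: "norm u = 1" "z = of_real (norm z) * u"
      using z0 norm_sgn[of z] by (auto simp: u_def sgn_eq simp del: norm_sgn)
    have in_wedge: "of_real t * u \<in> wedge A" if "2 * \<bar>A\<bar> < t" for t
    proof (rule norm_gt_imp_wedge[of _ 0])
      have "of_real t * u = of_real (t / norm z) * z" using z0 by (simp add: u_def sgn_eq)
      moreover have "0 < t / norm z" using that z0 by simp
      ultimately show "of_real t * u \<in> wedge 0" using wedge_0_scale[OF z(1)] by metis
      show "2 * \<bar>A\<bar> < norm (of_real t * u)" using that u by (simp add: norm_mult)
    qed
    have "norm (f (of_real (norm z) * u) - f (of_real s * u)) \<le> P (norm z) - P s"
    proof (cases "s = norm z")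
      case False
      show ?thesis
      proof (rule differentiable_bound_general[where f = "\<lambda>t. f (of_real t * u)" and \<phi> = P])
        show "s < norm z" using z False by simp
        have "(P has_real_derivative \<rho> t) (at t)" if "s \<le> t" for t
          using that by (intro P) (auto simp: s_def)
        then show "continuous_on {s..norm z} P"
          by (intro DERIV_continuous_on) (auto intro: has_field_derivative_at_within)
        have D: "((\<lambda>t. f (of_real t * u)) has_vector_derivative f' (of_real t * u) * u) (at t)" if "s \<le> t" for t
        proof -
          have "DERIV (\<lambda>t. f (t * u)) (of_real t) :> f' (of_real t * u) * u"
            by (rule DERIV_chain2[where f = f and g = "\<lambda>t. t * u", OF f[OF in_wedge]])
               (use that in \<open>auto intro!: derivative_eq_intros simp: s_def\<close>)
          then show ?thesis by (rule has_vector_derivative_real_field)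
        qed
        then show "continuous_on {s..norm z} (\<lambda>t. f (of_real t * u))"
          by (intro continuous_at_imp_continuous_on ballI) (use has_vector_derivative_continuous in force)
        fix t assume t: "s < t" "t < norm z"
        show "((\<lambda>t. f (of_real t * u)) has_vector_derivative f' (of_real t * u) * u) (at t)"
          using D t by simp
        show "(P has_vector_derivative \<rho> t) (at t)"
          using P[of t] t by (simp add: s_def has_real_derivative_iff_has_vector_derivative)
        show "norm (f' (of_real t * u) * u) \<le> \<rho> t"
          using f'[OF in_wedge[of t]] t s(1) u(1) by (simp add: norm_mult s_def)
      qed
    qed auto
    moreover have "norm (f (of_real s * u) - f (of_real s)) \<le> K * norm (of_real s * u - of_real s)"
      using in_wedge[of s] s by (intro wedge_Lipschitz[OF f K]) (auto simp: s_def)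
    moreover have "K * norm (of_real s * u - of_real s) \<le> K * (2 * s)"
    proof (rule mult_left_mono[OF _ K0])
      show "norm (of_real s * u - of_real s) \<le> 2 * s"
        using norm_triangle_ineq4[of "of_real s * u" "of_real s"] s(1) u(1) by (simp add: norm_mult)
    qed
    moreover have "norm (f z) \<le> norm (f z - f (of_real s * u)) + norm (f (of_real s * u) - f (of_real s)) + norm (f (of_real s))"
      using norm_triangle_ineq[of "f z - f (of_real s * u)" "f (of_real s * u)"]
        norm_triangle_ineq[of "f (of_real s * u) - f (of_real s)" "f (of_real s)"] by simp
    ultimately show ?thesis unfolding u(2)[symmetric] C_def by linarith
  qed
  then show ?thesis by (intro that) (simp add: s_def)
qed

section \<open>Zeros of perturbations of the identity\<close>

text \<open>Below n1 there may be gaps, so those finitely many integers are listed first in any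
  order. From then on the indices follow consecutive integers, which is what the alternating sign
  and the growth of the nth zero require.\<close>

lemma enumerate_cofinal_ints:
  fixes M :: "int set"
  assumes "\<And>n. n \<in> M \<Longrightarrow> l \<le> n" and "\<And>n. n1 \<le> n \<Longrightarrow> n \<in> M"
  obtains e :: "nat \<Rightarrow> int" and m where "bij_betw e UNIV M"
    "eventually (\<lambda>i. e i = int i + m) sequentially"
proof -
  define F where "F = M \<inter> {..<n1}"
  have F: "finite F"
    by (rule finite_subset[of _ "{l..n1}"]) (use assms(1) in \<open>auto simp: F_def\<close>)
  then obtain h where h: "bij_betw h {..<card F} F"
    using ex_bij_betw_nat_finite by (metis lessThan_atLeast0)
  define e where "e i = (if i \<in> {..<card F} then h i else n1 + int (i - card F))" for i
  have "bij_betw (\<lambda>i. n1 + int (i - card F)) {card F..} {n1..}"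
    by (rule bij_betwI[where g = "\<lambda>n. card F + nat (n - n1)"]) auto
  then have "bij_betw e ({..<card F} \<union> {card F..}) (F \<union> {n1..})"
    unfolding e_def using h by (intro bij_betw_disjoint_Un) (auto simp: F_def cong: bij_betw_cong)
  moreover have "{..<card F} \<union> {card F..} = UNIV" "F \<union> {n1..} = M"
    using assms(2) by (auto simp: F_def)
  ultimately have "bij_betw e UNIV M" by simp
  moreover have "eventually (\<lambda>i. e i = int i + (n1 - int (card F))) sequentially"
    by (rule eventually_sequentiallyI[of "card F"]) (auto simp: e_def of_nat_diff)
  ultimately show ?thesis using that by blast
qed

text \<open>E is Lipschitz with constant 1/4, so z + E z is injective. A solution for large n is a
  fixed point of \<kappa> + \<pi> n - E z, which maps the disc of radius \<pi> n / 4 about \<pi> n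
  into itself, so that Brouwer's theorem applies.\<close>

lemma wedge_zeros:
  fixes E :: "complex \<Rightarrow> complex" and \<kappa> :: complex
  assumes E: "\<And>z. z \<in> wedge A \<Longrightarrow> DERIV E z :> E' z"
    and E': "\<And>z. z \<in> wedge A \<Longrightarrow> norm (E' z) \<le> 1 / 4"
    and sub: "((\<lambda>z. E z / z) \<longlongrightarrow> 0) wedge_at_top"
  obtains R0 where "\<And>R. R0 \<le> R \<Longrightarrow>
     \<exists>t m. bij_betw t (UNIV :: nat set) {z \<in> wedge 0. R < norm z \<and> (\<exists>n. z + E z = \<kappa> + of_real pi * of_int n)} \<and>
       eventually (\<lambda>n. t n + E (t n) = \<kappa> + of_real pi * of_int (int n + m)) sequentially"
proof -
  \<comment> \<open>The threshold is dictated by the disc below: on it |z| \<le> 5 x / 4 and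
    |\<kappa>| \<le> x / 6, and 1/6 + (5/4)/16 < 1/4.\<close>
  have "eventually (\<lambda>z. norm (E z / z) < 1 / 16) wedge_at_top"
    using tendstoD[OF sub, of "1 / 16"] by simp
  then obtain B where B: "\<And>z. z \<in> wedge B \<Longrightarrow> norm (E z / z) < 1 / 16"
    unfolding eventually_wedge_at_top by blast
  have small: "norm (E z) \<le> norm z / 16" if "z \<in> wedge B" for z
    using B[OF that] wedge_norm(5)[OF that] by (simp add: norm_divide field_simps)
  define R0 where "R0 = 2 * \<bar>A\<bar> + 2 * \<bar>B\<bar> + 1"
  show ?thesis
  proof
    fix R assume R: "R0 \<le> R"
    define \<Omega> where "\<Omega> = {z \<in> wedge 0. R < norm z}"
    have \<Omega>: "z \<in> wedge A" "z \<in> wedge B" if "z \<in> \<Omega>" for z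
      using that R norm_gt_imp_wedge[of z 0] by (auto simp: \<Omega>_def R0_def)
    define M where "M = {n. \<exists>z\<in>\<Omega>. z + E z = \<kappa> + of_real pi * of_int n}"
    have inj: "z = z'" if "z + E z = z' + E z'" "z \<in> \<Omega>" "z' \<in> \<Omega>" for z z'
    proof -
      have "norm (z - z') = norm (E z - E z')" using that(1)
        by (metis add_diff_cancel_left' add_diff_eq diff_add_eq norm_minus_commute)
      also have "\<dots> \<le> 1 / 4 * norm (z - z')"
        by (rule wedge_Lipschitz[OF E E' \<Omega>(1)[OF that(2)] \<Omega>(1)[OF that(3)]])
      finally show ?thesis by simp
    qed
    have lower: "\<lfloor>- Re \<kappa> / pi\<rfloor> \<le> n" if nM: "n \<in> M" for n
    proof -
      obtain z where z: "z \<in> \<Omega>" "z + E z = \<kappa> + of_real pi * of_int n"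
        using nM by (auto simp: M_def)
      have "norm (E z) \<le> norm z / 16" "norm z \<le> 2 * Re z" "0 < Re z"
        using small[OF \<Omega>(2)[OF z(1)]] wedge_norm[OF \<Omega>(1)[OF z(1)]] by auto
      moreover have "\<bar>Re (E z)\<bar> \<le> norm (E z)" by (rule abs_Re_le_cmod)
      moreover have "Re z + Re (E z) = Re \<kappa> + pi * of_int n"
        using arg_cong[OF z(2), of Re] by simp
      ultimately have "0 < Re \<kappa> + pi * of_int n" by linarith
      then have "- Re \<kappa> / pi < of_int n" by (simp add: field_simps)
      then show ?thesis by linarith
    qed
    \<comment> \<open>As \<pi> > 3, the centre x = \<pi> n then exceeds 6 |\<kappa>| + 3 R, which
      yields both |\<kappa>| \<le> x / 6 and R < x / 2.\<close>
    define n1 where "n1 = \<lceil>2 * norm \<kappa> + R + 1\<rceil>"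
    have R0: "0 < R" "2 * \<bar>A\<bar> < R" "2 * \<bar>B\<bar> < R" using R by (auto simp: R0_def)
    have ex: "n \<in> M" if n: "n1 \<le> n" for n
    proof -
      have n': "2 * norm \<kappa> + R + 1 \<le> real_of_int n" using n unfolding n1_def by linarith
      define x where "x = pi * of_int n"
      have "3 * real_of_int n \<le> x" unfolding x_def using pi_gt3 n' R0 norm_ge_zero[of \<kappa>]
        by (intro mult_right_mono) linarith+
      then have x: "6 * norm \<kappa> + 3 * R + 3 \<le> x" using n' by linarith
      then have x0: "0 < x" using R0 norm_ge_zero[of \<kappa>] by linarith
      have ball: "z \<in> \<Omega>" "norm z \<le> 2 * x" if "z \<in> cball (of_real x) (x / 4)" for z
      proof -
        have d: "norm (z - of_real x) \<le> x / 4" using that by (simp add: dist_norm norm_minus_commute)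
        have "\<bar>Re z - x\<bar> \<le> x / 4" "\<bar>Im z\<bar> \<le> x / 4"
          using abs_Re_le_cmod[of "z - of_real x"] abs_Im_le_cmod[of "z - of_real x"] d by auto
        then have "\<bar>Im z\<bar> < Re z" "0 < Re z" "x / 2 < Re z" using x0 by linarith+
        moreover have "Re z \<le> norm z" by (rule complex_Re_le_cmod)
        moreover have "R < x / 2" using x R0 norm_ge_zero[of \<kappa>] by linarith
        ultimately show "z \<in> \<Omega>" by (auto simp: \<Omega>_def wedge_def)
        show "norm z \<le> 2 * x"
          using d x0 norm_triangle_ineq[of "z - of_real x" "of_real x"] by simp
      qed
      obtain z where z: "z \<in> cball (of_real x) (x / 4)" "\<kappa> + of_real x - E z = z"
      proof (rule brouwer_ball[of "x / 4" "of_real x" "\<lambda>z. \<kappa> + of_real x - E z"])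
        show "0 < x / 4" using x0 by simp
        have "continuous_on (cball (of_real x) (x / 4)) E"
          by (intro continuous_at_imp_continuous_on ballI DERIV_isCont[OF E] \<Omega>(1) ball)
        then show "continuous_on (cball (of_real x) (x / 4)) (\<lambda>z. \<kappa> + of_real x - E z)"
          by (intro continuous_intros)
        show "(\<lambda>z. \<kappa> + of_real x - E z) \<in> cball (of_real x) (x / 4) \<rightarrow> cball (of_real x) (x / 4)"
        proof
          fix z assume z: "z \<in> cball (complex_of_real x) (x / 4)"
          have "norm \<kappa> \<le> x / 6" using x R0 by linarith
          moreover have "norm (E z) \<le> (5 / 4 * x) / 16"
            using small[OF \<Omega>(2)[OF ball(1)[OF z]]] z x0
              norm_triangle_ineq[of "z - of_real x" "of_real x"] by (simp add: dist_norm norm_minus_commute)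
          ultimately have "norm (\<kappa> - E z) \<le> x / 4"
            using norm_triangle_ineq4[of \<kappa> "E z"] x0 by linarith
          then show "\<kappa> + of_real x - E z \<in> cball (of_real x) (x / 4)"
            by (simp add: dist_norm norm_minus_commute algebra_simps)
        qed
      qed
      have "z + E z = \<kappa> + of_real pi * of_int n" using z(2) by (simp add: x_def algebra_simps)
      then show "n \<in> M" unfolding M_def using ball(1)[OF z(1)] by blast
    qed
    obtain e m where e: "bij_betw e (UNIV :: nat set) M"
      "eventually (\<lambda>i. e i = int i + m) sequentially"
      using enumerate_cofinal_ints[OF lower ex] by blast
    define \<zeta> where "\<zeta> n = (SOME z. z \<in> \<Omega> \<and> z + E z = \<kappa> + of_real pi * of_int n)" for n
    have \<zeta>: "\<zeta> n \<in> \<Omega> \<and> \<zeta> n + E (\<zeta> n) = \<kappa> + of_real pi * of_int n" if "n \<in> M" for n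
      unfolding \<zeta>_def by (rule someI_ex) (use that in \<open>auto simp: M_def\<close>)
    have "bij_betw \<zeta> M {z \<in> \<Omega>. \<exists>n. z + E z = \<kappa> + of_real pi * of_int n}"
    proof (rule bij_betw_imageI)
      show "inj_on \<zeta> M"
      proof (rule inj_onI)
        fix n n' assume "n \<in> M" "n' \<in> M" "\<zeta> n = \<zeta> n'"
        then have "of_real pi * of_int n = (of_real pi * of_int n' :: complex)"
          using \<zeta> by (metis add_left_cancel)
        then show "n = n'" by simp
      qed
      show "\<zeta> ` M = {z \<in> \<Omega>. \<exists>n. z + E z = \<kappa> + of_real pi * of_int n}"
      proof (intro equalityI subsetI)
        fix z assume "z \<in> {z \<in> \<Omega>. \<exists>n. z + E z = \<kappa> + of_real pi * of_int n}"
        then obtain n where z: "z \<in> \<Omega>" "z + E z = \<kappa> + of_real pi * of_int n" by blast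
        then have "n \<in> M" by (auto simp: M_def)
        moreover have "\<zeta> n = z" by (rule inj) (use \<zeta>[OF \<open>n \<in> M\<close>] z in simp_all)
        ultimately show "z \<in> \<zeta> ` M" by blast
      qed (use \<zeta> in auto)
    qed
    from bij_betw_trans[OF e(1) this]
    have "bij_betw (\<zeta> \<circ> e) UNIV {z \<in> wedge 0. R < norm z \<and> (\<exists>n. z + E z = \<kappa> + of_real pi * of_int n)}"
      by (simp add: \<Omega>_def)
    moreover have "eventually (\<lambda>n. (\<zeta> \<circ> e) n + E ((\<zeta> \<circ> e) n) = \<kappa> + of_real pi * of_int (int n + m)) sequentially"
      using e(2)
    proof eventually_elim
      case (elim i)
      have "e i \<in> M" using e(1) by (auto simp: bij_betw_def)
      then show ?case using \<zeta>[of "e i"] elim by simp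
    qed
    ultimately show "\<exists>t m. bij_betw t (UNIV :: nat set) {z \<in> wedge 0. R < norm z \<and> (\<exists>n. z + E z = \<kappa> + of_real pi * of_int n)} \<and>
       eventually (\<lambda>n. t n + E (t n) = \<kappa> + of_real pi * of_int (int n + m)) sequentially"
      by blast
  qed
qed

lemma filterlim_wedge_at_top:
  fixes t :: "nat \<Rightarrow> complex"
  assumes t: "\<And>n. t n \<in> wedge 0" and t': "filterlim (\<lambda>n. norm (t n)) at_top sequentially"
  shows "filterlim t wedge_at_top sequentially"
  unfolding wedge_at_top_def filterlim_inf filterlim_principal
  using t filterlim_norm_at_top_imp_at_infinity[OF t'] by simp

text \<open>The crude bound E = O(z) first forces |t n| to infinity. Only then is E (t n) / t n =
  o(1) available, and dividing the equation by n and by 1 + o(1) gives the limit.\<close>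

lemma wedge_zeros_asymptotics:
  fixes E :: "complex \<Rightarrow> complex" and t :: "nat \<Rightarrow> complex"
  assumes sub: "((\<lambda>z. E z / z) \<longlongrightarrow> 0) wedge_at_top"
    and B: "\<And>z. z \<in> wedge 0 \<Longrightarrow> R < norm z \<Longrightarrow> norm (E z) \<le> K * norm z"
    and t: "\<And>n. t n \<in> wedge 0" "\<And>n. R < norm (t n)"
    and eq: "eventually (\<lambda>n. t n + E (t n) = \<kappa> + of_real pi * of_int (int n + m)) sequentially"
  shows "filterlim t wedge_at_top sequentially"
    and "(\<lambda>n. t n / of_nat n) \<longlonglongrightarrow> of_real pi"
proof -
  have K: "norm (t n + E (t n)) \<le> (1 + \<bar>K\<bar>) * norm (t n)" for n
  proof -
    have "norm (t n + E (t n)) \<le> norm (t n) + K * norm (t n)"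
      using norm_triangle_ineq[of "t n" "E (t n)"] B[OF t(1)[of n] t(2)[of n]] by linarith
    also have "\<dots> \<le> norm (t n) + \<bar>K\<bar> * norm (t n)"
      by (intro add_left_mono mult_right_mono) auto
    finally show ?thesis by (simp add: algebra_simps)
  qed
  have "filterlim (\<lambda>n. (pi * (real n + m) - norm \<kappa>) / (1 + \<bar>K\<bar>)) at_top sequentially"
    by real_asymp
  moreover have "eventually (\<lambda>n. (pi * (real n + m) - norm \<kappa>) / (1 + \<bar>K\<bar>) \<le> norm (t n)) sequentially"
    using eq
  proof eventually_elim
    case (elim n)
    have "pi * (real n + m) \<le> norm (of_real pi * of_int (int n + m) :: complex)"
      unfolding norm_mult by (simp add: norm_of_int del: of_int_add)
    also have "\<dots> \<le> norm (\<kappa> + of_real pi * of_int (int n + m)) + norm \<kappa>"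
      using norm_triangle_ineq4[of "\<kappa> + of_real pi * of_int (int n + m)" \<kappa>] by simp
    finally show ?case using K[of n] elim by (simp add: field_simps)
  qed
  ultimately show lim: "filterlim t wedge_at_top sequentially"
    by (intro filterlim_wedge_at_top t(1)) (rule filterlim_at_top_mono)
  have E0: "(\<lambda>n. E (t n) / t n) \<longlonglongrightarrow> 0"
    by (rule filterlim_compose[OF sub lim])
  have ne: "eventually (\<lambda>n. 1 + E (t n) / t n \<noteq> 0) sequentially"
    by (rule tendsto_imp_eventually_ne[OF tendsto_add[OF tendsto_const E0]]) simp
  have "(\<lambda>n. (\<kappa> + of_real pi * of_int (int n + m)) / of_nat n) \<longlonglongrightarrow> of_real pi"
  proof -
    have "(\<lambda>n. (\<kappa> + of_real pi * of_int m) * of_real (1 / real n) + of_real pi) \<longlonglongrightarrow> (\<kappa> + of_real pi * of_int m) * of_real 0 + of_real pi"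
      by (intro tendsto_intros)
    moreover have "eventually (\<lambda>n. (\<kappa> + of_real pi * of_int m) * of_real (1 / real n) + of_real pi
        = (\<kappa> + of_real pi * of_int (int n + m)) / of_nat n) sequentially"
      using eventually_gt_at_top[of 0] by eventually_elim (simp add: field_simps)
    ultimately show ?thesis
      using Lim_transform_eventually by fastforce
  qed
  moreover have "(\<lambda>n. 1 + E (t n) / t n) \<longlonglongrightarrow> 1 + 0" by (intro tendsto_intros E0)
  ultimately have "(\<lambda>n. (\<kappa> + of_real pi * of_int (int n + m)) / of_nat n / (1 + E (t n) / t n)) \<longlonglongrightarrow> of_real pi / (1 + 0)"
    by (rule tendsto_divide) simp
  moreover have "eventually (\<lambda>n. (\<kappa> + of_real pi * of_int (int n + m)) / of_nat n / (1 + E (t n) / t n) = t n / of_nat n) sequentially"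
    using eq ne
  proof eventually_elim
    case (elim n)
    have "t n \<noteq> 0" using wedge_norm(5)[OF t(1)] .
    then have "\<kappa> + of_real pi * of_int (int n + m) = t n * (1 + E (t n) / t n)"
      using elim(1) by (simp add: field_simps)
    then show ?case using elim(2) by simp
  qed
  ultimately show "(\<lambda>n. t n / of_nat n) \<longlonglongrightarrow> of_real pi"
    using Lim_transform_eventually by fastforce
qed

section \<open>Pairs of solutions with oscillating exponents\<close>

lemma zero_deriv_wedge_imp_const:
  assumes "\<And>z. z \<in> wedge A \<Longrightarrow> DERIV f z :> 0"
  obtains c where "\<And>z. z \<in> wedge A \<Longrightarrow> f z = c"
proof -
  have "\<exists>c. \<forall>z\<in>wedge A. f z = c"
    by (rule has_field_derivative_zero_constant[OF convex_wedge])
       (auto intro: has_field_derivative_at_within assms)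
  then show ?thesis using that by blast
qed

text \<open>
  The functions \<open>exp (U \<sigma>)\<close>, \<open>\<sigma> = \<plusminus> 1\<close>, solve \<open>G'' - a G' + (1 + V) G = 0\<close>, and \<open>u \<sigma>\<close> are their
  logarithmic derivatives.
\<close>

locale riccati_pair =
  fixes A :: real and a V :: "complex \<Rightarrow> complex" and n U :: "real \<Rightarrow> complex \<Rightarrow> complex"
    and u :: "real \<Rightarrow> complex \<Rightarrow> complex"
  defines "u \<sigma> z \<equiv> of_real \<sigma> * \<i> + a z / 2 + n \<sigma> z"
  assumes U_deriv: "\<bar>\<sigma>\<bar> = 1 \<Longrightarrow> z \<in> wedge A \<Longrightarrow> DERIV (U \<sigma>) z :> u \<sigma> z"
    and u_deriv: "\<bar>\<sigma>\<bar> = 1 \<Longrightarrow> z \<in> wedge A \<Longrightarrow>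
          DERIV (u \<sigma>) z :> a z * u \<sigma> z - (1 + V z) - (u \<sigma> z)\<^sup>2"
    and n_small: "\<bar>\<sigma>\<bar> = 1 \<Longrightarrow> z \<in> wedge A \<Longrightarrow> norm (n \<sigma> z) \<le> 1 / 4"
    and n_lim: "\<bar>\<sigma>\<bar> = 1 \<Longrightarrow> (n \<sigma> \<longlongrightarrow> 0) wedge_at_top"
begin

text \<open>Up to sign, the Wronskian of the two exponentials divided by their product.\<close>

definition \<Delta> :: "complex \<Rightarrow> complex" where "\<Delta> z = u 1 z - u (- 1) z"

definition E :: "complex \<Rightarrow> complex" where "E z = (U 1 z - U (- 1) z) / (2 * \<i>) - z"

lemma \<Delta>_eq: "\<Delta> z = 2 * \<i> * (1 + (n 1 z - n (- 1) z) / (2 * \<i>))"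
  by (simp add: \<Delta>_def u_def field_simps)

lemma n_diff_small:
  assumes "z \<in> wedge A"
  shows "norm ((n 1 z - n (- 1) z) / (2 * \<i>)) \<le> 1 / 4"
  using norm_triangle_ineq4[of "n 1 z" "n (- 1) z"] n_small[of 1, OF _ assms] n_small[of "- 1", OF _ assms]
  by (simp add: norm_divide norm_mult)

lemma Re_\<Delta>_pos:
  assumes "z \<in> wedge A"
  shows "0 < Re (\<Delta> z / (2 * \<i>))"
proof -
  have "\<Delta> z / (2 * \<i>) = 1 + (n 1 z - n (- 1) z) / (2 * \<i>)" by (simp add: \<Delta>_eq)
  then show ?thesis
    using n_diff_small[OF assms] abs_Re_le_cmod[of "(n 1 z - n (- 1) z) / (2 * \<i>)"] by simp
qed

lemma \<Delta>_nonzero: "z \<in> wedge A \<Longrightarrow> \<Delta> z \<noteq> 0"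
  using Re_\<Delta>_pos[of z] by auto

lemma \<Delta>_deriv:
  assumes "z \<in> wedge A"
  shows "DERIV \<Delta> z :> \<Delta> z * (a z - u 1 z - u (- 1) z)"
  unfolding \<Delta>_def
  by (auto intro!: derivative_eq_intros u_deriv assms simp: algebra_simps power2_eq_square)

lemma \<Delta>_lim: "(\<Delta> \<longlongrightarrow> 2 * \<i>) wedge_at_top"
proof -
  have "((\<lambda>z. 2 * \<i> * (1 + (n 1 z - n (- 1) z) / (2 * \<i>))) \<longlongrightarrow> 2 * \<i> * (1 + (0 - 0) / (2 * \<i>))) wedge_at_top"
    by (intro tendsto_intros n_lim) auto
  then show ?thesis unfolding \<Delta>_eq[symmetric] by simp
qed

lemma E_deriv:
  assumes "z \<in> wedge A"
  shows "DERIV E z :> (n 1 z - n (- 1) z) / (2 * \<i>)"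
  unfolding E_def
  by (auto intro!: derivative_eq_intros U_deriv assms simp: u_def field_simps)

lemma E_sublinear: "((\<lambda>z. E z / z) \<longlongrightarrow> 0) wedge_at_top"
proof (rule sublinear_if_deriv_tendsto_0[OF E_deriv])
  have "((\<lambda>z. (n 1 z - n (- 1) z) / (2 * \<i>)) \<longlongrightarrow> (0 - 0) / (2 * \<i>)) wedge_at_top"
    by (intro tendsto_intros n_lim) auto
  then show "((\<lambda>z. (n 1 z - n (- 1) z) / (2 * \<i>)) \<longlongrightarrow> 0) wedge_at_top" by simp
qed

lemma solution_decomposition:
  assumes G: "\<And>z. z \<in> wedge A \<Longrightarrow> DERIV G z :> G' z"
    and G': "\<And>z. z \<in> wedge A \<Longrightarrow> DERIV G' z :> a z * G' z - (1 + V z) * G z"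
  obtains l m where "\<And>z. z \<in> wedge A \<Longrightarrow> G z = l * exp (U 1 z) + m * exp (U (- 1) z)"
    "\<And>z. z \<in> wedge A \<Longrightarrow> G' z = l * u 1 z * exp (U 1 z) + m * u (- 1) z * exp (U (- 1) z)"
proof -
  \<comment> \<open>variation of constants: the candidate coefficient of \<open>exp (U \<sigma>)\<close> has zero derivative\<close>
  have coeff: "\<exists>c. \<forall>z\<in>wedge A. G' z - u (- \<sigma>) z * G z = c * \<Delta> z * exp (U \<sigma> z)" if \<sigma>: "\<bar>\<sigma>\<bar> = 1" for \<sigma>
  proof -
    define c where "c z = (G' z - u (- \<sigma>) z * G z) / \<Delta> z * exp (- U \<sigma> z)" for z
    have \<sigma>': "\<bar>- \<sigma>\<bar> = 1" "\<sigma> = 1 \<or> \<sigma> = - 1" using \<sigma> by auto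
    have "DERIV c z :> 0" if z: "z \<in> wedge A" for z
      unfolding c_def
      by (rule derivative_eq_intros G[OF z] G'[OF z] u_deriv[OF \<sigma>' (1) z] \<Delta>_deriv[OF z] U_deriv[OF \<sigma> z] refl \<Delta>_nonzero[OF z])+
         (use \<sigma>'(2) \<Delta>_nonzero[OF z] in \<open>auto simp: field_simps power2_eq_square\<close>)
    then obtain l where "\<And>z. z \<in> wedge A \<Longrightarrow> c z = l"
      by (rule zero_deriv_wedge_imp_const) blast+
    then have "\<forall>z\<in>wedge A. G' z - u (- \<sigma>) z * G z = l * \<Delta> z * exp (U \<sigma> z)"
      by (auto simp: c_def exp_minus field_simps \<Delta>_nonzero)
    then show ?thesis by blast
  qed
  obtain l where l: "\<And>z. z \<in> wedge A \<Longrightarrow> G' z - u (- 1) z * G z = l * \<Delta> z * exp (U 1 z)"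
    using coeff[of 1] by auto
  \<comment> \<open>Exchanging the two solutions turns \<Delta> into its negative, so the
    coefficient of the second exponential is - m.\<close>
  obtain m where m: "\<And>z. z \<in> wedge A \<Longrightarrow> G' z - u 1 z * G z = m * \<Delta> z * exp (U (- 1) z)"
    using coeff[of "- 1"] by auto
  have eq: "G z = l * exp (U 1 z) + (- m) * exp (U (- 1) z)" if z: "z \<in> wedge A" for z
  proof -
    have "\<Delta> z * G z = (G' z - u (- 1) z * G z) - (G' z - u 1 z * G z)"
      by (simp add: \<Delta>_def algebra_simps)
    also have "\<dots> = \<Delta> z * (l * exp (U 1 z) + (- m) * exp (U (- 1) z))"
      unfolding l[OF z] m[OF z] by (simp add: algebra_simps)
    finally show ?thesis using \<Delta>_nonzero[OF z] by simp
  qed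
  moreover have "G' z = l * u 1 z * exp (U 1 z) + (- m) * u (- 1) z * exp (U (- 1) z)" if z: "z \<in> wedge A" for z
  proof -
    have "G' z = l * \<Delta> z * exp (U 1 z) + u (- 1) z * G z" using l[OF z] by (simp add: algebra_simps)
    then show ?thesis by (simp add: eq[OF z] \<Delta>_def algebra_simps)
  qed
  ultimately show ?thesis using that by blast
qed

text \<open>
  Since \<open>\<Delta>'/\<Delta> = a - u 1 - u (-1)\<close>, the product of the two solutions is explicit up to a constant;
  taking logarithms fixes the branch of its square root.
\<close>

lemma geometric_mean_asymptotics:
  assumes \<Lambda>: "\<And>z. z \<in> wedge A \<Longrightarrow> DERIV \<Lambda> z :> \<Lambda>' z"
    and a: "\<And>z. z \<in> wedge A \<Longrightarrow> a z = 2 * \<mu> / z + \<Lambda>' z"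
    and A: "0 \<le> A" and \<Lambda>_lim: "(\<Lambda> \<longlongrightarrow> 0) wedge_at_top"
  obtains c where "c \<noteq> 0"
    "((\<lambda>z. exp ((U 1 z + U (- 1) z) / 2) / exp (\<mu> * Ln z)) \<longlongrightarrow> c) wedge_at_top"
proof -
  \<comment> \<open>Half of Abel's identity for the Wronskian, in logarithmic form. The principal
    logarithm of \<Delta> / (2 i) is differentiable because that quotient stays within 1/4 of
    1.\<close>
  define f where "f z = (U 1 z + U (- 1) z) / 2 - \<mu> * Ln z - \<Lambda> z / 2 + Ln (\<Delta> z / (2 * \<i>)) / 2" for z
  have "DERIV f z :> 0" if z: "z \<in> wedge A" for z
  proof -
    have Ln: "DERIV Ln z :> inverse z"
      using wedge_norm(3)[OF z] by (intro has_field_derivative_Ln) (auto simp: complex_nonpos_Reals_iff)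
    have "DERIV (\<lambda>z. Ln (\<Delta> z / (2 * \<i>))) z :> inverse (\<Delta> z / (2 * \<i>)) * (\<Delta> z * (a z - u 1 z - u (- 1) z) / (2 * \<i>))"
    proof (rule DERIV_chain2[OF has_field_derivative_Ln])
      show "\<Delta> z / (2 * \<i>) \<notin> \<real>\<^sub>\<le>\<^sub>0" using Re_\<Delta>_pos[OF z] by (auto simp: complex_nonpos_Reals_iff)
    qed (rule DERIV_cdivide[OF \<Delta>_deriv[OF z]])
    moreover have "inverse (\<Delta> z / (2 * \<i>)) * (\<Delta> z * (a z - u 1 z - u (- 1) z) / (2 * \<i>)) = a z - u 1 z - u (- 1) z"
      using \<Delta>_nonzero[OF z] by (simp add: field_simps)
    ultimately have Ln\<Delta>: "DERIV (\<lambda>z. Ln (\<Delta> z / (2 * \<i>))) z :> a z - u 1 z - u (- 1) z"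
      by (simp only:)
    have U: "DERIV (U 1) z :> u 1 z" "DERIV (U (- 1)) z :> u (- 1) z"
      by (intro U_deriv z; simp)+
    have "DERIV f z :> (u 1 z + u (- 1) z) / 2 - \<mu> * inverse z - \<Lambda>' z / 2
        + (a z - u 1 z - u (- 1) z) / 2"
      unfolding f_def
      by (intro DERIV_add DERIV_diff DERIV_cdivide DERIV_cmult U Ln Ln\<Delta> \<Lambda> z)
    moreover have "(u 1 z + u (- 1) z) / 2 - \<mu> * inverse z - \<Lambda>' z / 2 + (a z - u 1 z - u (- 1) z) / 2 = 0"
      by (simp add: a[OF z] field_simps)
    ultimately show ?thesis by (simp only:)
  qed
  then obtain C where C: "\<And>z. z \<in> wedge A \<Longrightarrow> f z = C"
    by (rule zero_deriv_wedge_imp_const) blast+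
  have "((\<lambda>z. C + \<Lambda> z / 2 - Ln (\<Delta> z / (2 * \<i>)) / 2) \<longlongrightarrow> C + 0 / 2 - Ln (2 * \<i> / (2 * \<i>)) / 2) wedge_at_top"
    by (intro tendsto_intros \<Lambda>_lim \<Delta>_lim) auto
  then have "((\<lambda>z. exp (C + \<Lambda> z / 2 - Ln (\<Delta> z / (2 * \<i>)) / 2)) \<longlongrightarrow> exp C) wedge_at_top"
    using tendsto_exp by force
  moreover have "eventually (\<lambda>z. exp (C + \<Lambda> z / 2 - Ln (\<Delta> z / (2 * \<i>)) / 2)
      = exp ((U 1 z + U (- 1) z) / 2) / exp (\<mu> * Ln z)) wedge_at_top"
  proof (rule eventually_wedge_at_topI)
    fix z assume z: "z \<in> wedge A"
    have "C + \<Lambda> z / 2 - Ln (\<Delta> z / (2 * \<i>)) / 2 = (U 1 z + U (- 1) z) / 2 - \<mu> * Ln z"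
      unfolding C[OF z, symmetric] f_def by simp
    then show "exp (C + \<Lambda> z / 2 - Ln (\<Delta> z / (2 * \<i>)) / 2) = exp ((U 1 z + U (- 1) z) / 2) / exp (\<mu> * Ln z)"
      by (simp only: exp_diff)
  qed
  ultimately have "((\<lambda>z. exp ((U 1 z + U (- 1) z) / 2) / exp (\<mu> * Ln z)) \<longlongrightarrow> exp C) wedge_at_top"
    by (rule Lim_transform_eventually)
  then show ?thesis using that[of "exp C"] by simp
qed

end

lemma riccati_pair_exists:
  assumes a: "\<And>z. z \<in> wedge A \<Longrightarrow> DERIV a z :> a' z"
    and hol: "a' holomorphic_on wedge A" "V holomorphic_on wedge A"
    and W: "\<And>z. z \<in> wedge A \<Longrightarrow> norm (V z + a' z / 2 - (a z)\<^sup>2 / 4) \<le> \<rho> (norm z)"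
    and anti: "\<And>x y. A < x \<Longrightarrow> x \<le> y \<Longrightarrow> \<rho> y \<le> \<rho> x"
    and lim: "(\<rho> \<longlongrightarrow> 0) at_top"
  obtains B n U where "A \<le> B" "riccati_pair B a V n U"
    "\<And>\<sigma> z. \<bar>\<sigma>\<bar> = 1 \<Longrightarrow> z \<in> wedge B \<Longrightarrow> norm (n \<sigma> z) \<le> 2 * \<rho> (norm z)"
proof -
  obtain B0 where B0: "\<And>s. B0 \<le> s \<Longrightarrow> \<rho> s < 1 / 8"
    using order_tendstoD(2)[OF lim, of "1 / 8"] by (auto simp: eventually_at_top_linorder)
  define B where "B = max A B0"
  have sub: "wedge B \<subseteq> wedge A" by (rule wedge_mono) (simp add: B_def)
  define W where "W z = V z + a' z / 2 - (a z)\<^sup>2 / 4" for z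
  have a_hol: "a holomorphic_on wedge A"
    using a by (auto simp: holomorphic_on_open[OF open_wedge])
  have W_hol: "W holomorphic_on wedge B"
    unfolding W_def by (intro holomorphic_on_subset[OF _ sub] holomorphic_intros hol a_hol) auto
  have small: "\<rho> (norm z) \<le> 1 / 8" if "z \<in> wedge B" for z
    using B0[of "norm z"] wedge_norm(4)[OF that] by (simp add: B_def)
  have ex: "\<exists>n U. \<forall>z\<in>wedge B.
      DERIV n z :> - 2 * of_real \<sigma> * \<i> * n z - (W z + (n z)\<^sup>2) \<and>
      norm (n z) \<le> 2 * \<rho> (norm z) \<and>
      DERIV U z :> of_real \<sigma> * \<i> + a z / 2 + n z" if \<sigma>: "\<bar>\<sigma>\<bar> = 1" for \<sigma>
  proof -
    obtain n where n: "\<And>z. z \<in> wedge B \<Longrightarrow>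
        DERIV n z :> - 2 * of_real \<sigma> * \<i> * n z - (W z + (n z)\<^sup>2)"
      "\<And>z. z \<in> wedge B \<Longrightarrow> norm (n z) \<le> 2 * \<rho> (norm z)"
    proof (rule riccati_solution[where \<rho> = \<rho>, OF W_hol \<sigma> _ small])
      show "norm (W z) \<le> \<rho> (norm z)" if "z \<in> wedge B" for z
        unfolding W_def using W that sub by blast
      show "\<rho> y \<le> \<rho> x" if "B < x" "x \<le> y" for x y
        using that by (intro anti) (auto simp: B_def)
    qed blast+
    have n_hol: "n holomorphic_on wedge B"
      using n(1) by (auto simp: holomorphic_on_open[OF open_wedge])
    have "(\<lambda>z. of_real \<sigma> * \<i> + a z / 2 + n z) holomorphic_on wedge B"
      by (intro holomorphic_intros n_hol holomorphic_on_subset[OF a_hol sub]) auto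
    from holomorphic_convex_primitive'[OF convex_wedge open_wedge this]
    obtain U where U: "\<And>z. z \<in> wedge B \<Longrightarrow>
        (U has_field_derivative of_real \<sigma> * \<i> + a z / 2 + n z) (at z within wedge B)"
      by blast
    have "DERIV U z :> of_real \<sigma> * \<i> + a z / 2 + n z" if "z \<in> wedge B" for z
      using U[OF that] at_within_open[OF that open_wedge] by simp
    then show ?thesis using n by blast
  qed
  define good where "good \<sigma> n U \<longleftrightarrow> (\<forall>z\<in>wedge B.
      DERIV n z :> - 2 * of_real \<sigma> * \<i> * n z - (W z + (n z)\<^sup>2) \<and>
      norm (n z) \<le> 2 * \<rho> (norm z) \<and>
      DERIV U z :> of_real \<sigma> * \<i> + a z / 2 + n z)" for \<sigma> n U
  have "\<forall>\<sigma>. \<exists>n U. \<bar>\<sigma>\<bar> = 1 \<longrightarrow> good \<sigma> n U"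
    using ex unfolding good_def[symmetric] by blast
  then obtain n U where nU: "\<And>\<sigma>. \<bar>\<sigma>\<bar> = 1 \<Longrightarrow> good \<sigma> (n \<sigma>) (U \<sigma>)" by metis
  have n: "DERIV (n \<sigma>) z :> - 2 * of_real \<sigma> * \<i> * n \<sigma> z - (W z + (n \<sigma> z)\<^sup>2)"
      "norm (n \<sigma> z) \<le> 2 * \<rho> (norm z)"
      "DERIV (U \<sigma>) z :> of_real \<sigma> * \<i> + a z / 2 + n \<sigma> z"
    if "\<bar>\<sigma>\<bar> = 1" "z \<in> wedge B" for \<sigma> z
    using nU[OF that(1)] that(2) by (auto simp: good_def)
  have "riccati_pair B a V n U"
  proof
    fix \<sigma> :: real assume \<sigma>: "\<bar>\<sigma>\<bar> = 1"
    have "\<sigma> * \<sigma> = 1" using \<sigma> by (auto simp: abs_if split: if_splits)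
    then have \<sigma>2: "complex_of_real \<sigma> * complex_of_real \<sigma> = 1" by (metis of_real_1 of_real_mult)
    show "(n \<sigma> \<longlongrightarrow> 0) wedge_at_top"
    proof (rule Lim_null_comparison)
      show "eventually (\<lambda>z. norm (n \<sigma> z) \<le> 2 * \<rho> (norm z)) wedge_at_top"
        by (rule eventually_wedge_at_topI[of B]) (rule n(2)[OF \<sigma>])
      have "filterlim norm at_top wedge_at_top"
        unfolding wedge_at_top_def
        by (rule filterlim_mono[OF filterlim_norm_at_top]) auto
      then have "((\<lambda>z. \<rho> (norm z)) \<longlongrightarrow> 0) wedge_at_top"
        by (rule filterlim_compose[OF lim])
      from tendsto_mult_right_zero[OF this]
      show "((\<lambda>z. 2 * \<rho> (norm z)) \<longlongrightarrow> 0) wedge_at_top" by simp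
    qed
    fix z assume z: "z \<in> wedge B"
    show "DERIV (U \<sigma>) z :> of_real \<sigma> * \<i> + a z / 2 + n \<sigma> z"
      by (rule n(3)[OF \<sigma> z])
    show "norm (n \<sigma> z) \<le> 1 / 4" using n(2)[OF \<sigma> z] small[OF z] by simp
    have "DERIV (\<lambda>z. of_real \<sigma> * \<i> + a z / 2 + n \<sigma> z) z :> a' z / 2 + (- 2 * of_real \<sigma> * \<i> * n \<sigma> z - (W z + (n \<sigma> z)\<^sup>2))"
      using sub z by (auto intro!: derivative_eq_intros a n(1)[OF \<sigma> z])
    moreover have "a' z / 2 + (- 2 * of_real \<sigma> * \<i> * n \<sigma> z - (W z + (n \<sigma> z)\<^sup>2))
        = a z * (of_real \<sigma> * \<i> + a z / 2 + n \<sigma> z) - (1 + V z) - (of_real \<sigma> * \<i> + a z / 2 + n \<sigma> z)\<^sup>2"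
      using \<sigma>2 by (simp add: W_def field_simps power2_eq_square)
    ultimately show "DERIV (\<lambda>z. of_real \<sigma> * \<i> + a z / 2 + n \<sigma> z) z :> a z * (of_real \<sigma> * \<i> + a z / 2 + n \<sigma> z) - (1 + V z) - (of_real \<sigma> * \<i> + a z / 2 + n \<sigma> z)\<^sup>2"
      by simp
  qed
  then show ?thesis using that[of B n U] n(2) by (simp add: B_def)
qed

section \<open>The chart straightening a Stokes sector\<close>

lemma wedge_0_iff: "z \<in> wedge 0 \<longleftrightarrow> z \<noteq> 0 \<and> \<bar>Arg z\<bar> < pi / 4"
proof (cases "0 < Re z")
  case True
  have "\<bar>Arg z\<bar> = arctan \<bar>Im z / Re z\<bar>" by (simp add: arg_conv_arctan[OF True] abs_arctan)
  then have "\<bar>Arg z\<bar> < pi / 4 \<longleftrightarrow> \<bar>Im z / Re z\<bar> < 1" by (metis arctan_less_iff arctan_one)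
  also have "\<dots> \<longleftrightarrow> \<bar>Im z\<bar> < Re z" using True by (simp add: abs_divide)
  finally show ?thesis using True by (auto simp: wedge_def)
next
  case False
  have "Re z = norm z * cos (Arg z)" using rcis_cmod_Arg[of z] by (metis Re_rcis)
  then have "0 < Re z" if "z \<noteq> 0" "\<bar>Arg z\<bar> < pi / 4"
    using that cos_gt_zero_pi[of "Arg z"] by (simp add: abs_less_iff)
  then show ?thesis using False by (auto simp: wedge_def)
qed

text \<open>Existence of an argument in an interval means membership in the image of a strip under
  exp, so the open mapping theorem applies without any choice of a branch of the argument.\<close>

lemma open_sector: "open (sector N \<beta> d k r \<delta>)"
proof -
  define I where "I = {s. stokes_angle N \<beta> (k - 1) + \<delta> < Im s \<and> Im s < stokes_angle N \<beta> (k + 1) - \<delta>}"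
  have "open (exp ` I)"
  proof (rule open_mapping_thm[of exp UNIV])
    show "open I" unfolding I_def by (intro open_Collect_conj open_Collect_less continuous_intros)
    have "exp 0 \<noteq> exp (of_real pi * \<i>)" by simp
    then show "\<not> exp constant_on (UNIV :: complex set)" unfolding constant_on_def by (metis UNIV_I)
  qed (auto intro: holomorphic_on_exp)
  then have "open ({z. r < norm (z - d)} \<inter> (\<lambda>z. z - d) -` (exp ` I))"
    by (intro open_Int open_vimage open_Collect_less continuous_intros)
  also have "{z. r < norm (z - d)} \<inter> (\<lambda>z. z - d) -` (exp ` I) = sector N \<beta> d k r \<delta>"
  proof -
    have "w \<in> exp ` I \<longleftrightarrow> (\<exists>\<phi>. is_arg_of \<phi> w \<and> stokes_angle N \<beta> (k - 1) + \<delta> < \<phi> \<and>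
             \<phi> < stokes_angle N \<beta> (k + 1) - \<delta>)" for w
    proof
      assume "w \<in> exp ` I"
      then obtain s where s: "s \<in> I" "w = exp s" by blast
      have "is_arg_of (Im s) w" unfolding s(2) is_arg_of_def norm_exp_eq_Re by (simp add: exp_eq_polar)
      then show "\<exists>\<phi>. is_arg_of \<phi> w \<and> stokes_angle N \<beta> (k - 1) + \<delta> < \<phi> \<and>
             \<phi> < stokes_angle N \<beta> (k + 1) - \<delta>" using s(1) by (auto simp: I_def)
    next
      assume "\<exists>\<phi>. is_arg_of \<phi> w \<and> stokes_angle N \<beta> (k - 1) + \<delta> < \<phi> \<and>
             \<phi> < stokes_angle N \<beta> (k + 1) - \<delta>"
      then obtain \<phi> where \<phi>: "is_arg_of \<phi> w" "Complex (ln (norm w)) \<phi> \<in> I" by (auto simp: I_def)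
      have "w = exp (Complex (ln (norm w)) \<phi>)"
        using \<phi>(1) by (simp add: is_arg_of_def exp_eq_polar)
      then show "w \<in> exp ` I" using \<phi>(2) by blast
    qed
    then show ?thesis by (auto simp: sector_def)
  qed
  finally show ?thesis .
qed

lemma sector_antimono: "r \<le> r' \<Longrightarrow> \<delta> \<le> \<delta>' \<Longrightarrow> sector N \<beta> d k r' \<delta>' \<subseteq> sector N \<beta> d k r \<delta>"
  unfolding sector_def by force

lemma wedge_Ln_deriv: "\<zeta> \<in> wedge 0 \<Longrightarrow> DERIV Ln \<zeta> :> 1 / \<zeta>"
  using wedge_norm(3)[of \<zeta> 0] has_field_derivative_Ln[of \<zeta>]
  by (auto simp: complex_nonpos_Reals_iff inverse_eq_divide)

text \<open>\<kappa> is the positive solution of \<alpha>^2 |b| \<kappa>^(N+2) = 1, that is, the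
  distance |z - d| of the point with \<zeta> = 1. The branch L lives on the full sector between the
  two neighbouring Stokes rays.\<close>

locale stokes_chart =
  fixes N :: nat and b d :: complex and \<beta> :: real and k :: int and L :: "complex \<Rightarrow> complex"
    and \<alpha> \<theta> \<kappa> :: real
  defines "\<alpha> \<equiv> 2 / (real N + 2)" and "\<theta> \<equiv> stokes_angle N \<beta> k"
    and "\<kappa> \<equiv> (1 / (\<alpha> * sqrt (cmod b))) powr \<alpha>"
  assumes arg_b: "is_arg_of \<beta> b" and L: "log_branch d (sector N \<beta> d k 0 0) L"
begin

lemma \<alpha>_bounds: "0 < \<alpha>" "\<alpha> \<le> 1" and \<alpha>_N: "\<alpha> * (real N + 2) = 2"
  by (auto simp: \<alpha>_def field_simps)

lemma b_nonzero: "b \<noteq> 0"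
  using arg_b by (simp add: is_arg_of_def)

lemma \<kappa>_pos: "0 < \<kappa>"
  using \<alpha>_bounds b_nonzero by (simp add: \<kappa>_def)

text \<open>Neighbouring Stokes rays are 2 \<pi> / (N + 2) apart and the wedge occupies \<alpha>
  \<pi> / 4 = \<pi> / (2 (N + 2)) on either side; this is the difference.\<close>

definition \<delta> :: real where "\<delta> = 3 * pi / (2 * (real N + 2))"

definition G :: "real \<Rightarrow> complex set" where "G R = sector N \<beta> d k (\<kappa> * R powr \<alpha>) \<delta>"

text \<open>The value of the given branch at the point with \<zeta> = 1. Building the chart on L
  itself makes every power of z - d explicit in \<zeta>, whichever branch was given.\<close>

definition \<eta> :: complex where "\<eta> = L (d + of_real \<kappa> * cis \<theta>)"

definition w :: "complex \<Rightarrow> complex" where "w \<zeta> = exp (\<eta> + of_real \<alpha> * Ln \<zeta>)"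

definition w_inv :: "complex \<Rightarrow> complex" where "w_inv z = exp ((L z - \<eta>) / of_real \<alpha>)"

lemma sector_width: "stokes_angle N \<beta> (k - 1) + \<delta> = \<theta> - \<alpha> * (pi / 4)"
  "stokes_angle N \<beta> (k + 1) - \<delta> = \<theta> + \<alpha> * (pi / 4)"
  by (auto simp: stokes_angle_def \<delta>_def \<theta>_def \<alpha>_def field_simps)

lemma open_G: "open (G R)"
  unfolding G_def by (rule open_sector)

lemma G_subset: "G R \<subseteq> sector N \<beta> d k 0 0"
  unfolding G_def by (rule sector_antimono) (use \<kappa>_pos in \<open>auto simp: \<delta>_def\<close>)

lemma exp_L: "z \<in> sector N \<beta> d k 0 0 \<Longrightarrow> exp (L z) = z - d"
  using L by (auto simp: log_branch_def)

lemma L_deriv: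
  assumes "z \<in> sector N \<beta> d k 0 0"
  shows "DERIV L z :> 1 / (z - d)"
proof -
  have "L holomorphic_on sector N \<beta> d k 0 0" using L by (simp add: log_branch_def)
  then obtain D where D: "DERIV L z :> D"
    using assms open_sector holomorphic_on_open by blast
  have "DERIV (\<lambda>z. exp (L z)) z :> exp (L z) * D"
    by (auto intro!: derivative_eq_intros D)
  then have "DERIV (\<lambda>z. z - d) z :> exp (L z) * D"
    by (rule has_field_derivative_transform_within_open[OF _ open_sector assms]) (simp add: exp_L)
  moreover have "DERIV (\<lambda>z. z - d) z :> 1"
    by (auto intro!: derivative_eq_intros)
  ultimately have "exp (L z) * D = 1" using DERIV_unique by blast
  then have "(z - d) * D = 1" using exp_L[OF assms] by simp
  then have "D = 1 / (z - d)" by (metis nonzero_mult_div_cancel_left mult_zero_left zero_neq_one)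
  then show ?thesis using D by simp
qed

lemma polar_in_G:
  assumes \<zeta>: "\<zeta> \<in> wedge 0" "R < norm \<zeta>" and R: "0 \<le> R"
  shows "d + of_real \<kappa> * cis \<theta> * exp (of_real \<alpha> * Ln \<zeta>) \<in> G R"
    and "is_arg_of (\<theta> + \<alpha> * Arg \<zeta>) (of_real \<kappa> * cis \<theta> * exp (of_real \<alpha> * Ln \<zeta>))"
    and "norm (of_real \<kappa> * cis \<theta> * exp (of_real \<alpha> * Ln \<zeta>)) = \<kappa> * norm \<zeta> powr \<alpha>"
proof -
  let ?w = "of_real \<kappa> * cis \<theta> * exp (of_real \<alpha> * Ln \<zeta>)"
  have \<zeta>0: "\<zeta> \<noteq> 0" and Arg: "\<bar>Arg \<zeta>\<bar> < pi / 4" using \<zeta> by (auto simp: wedge_0_iff)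
  have "exp (of_real \<alpha> * Ln \<zeta>) = of_real (norm \<zeta> powr \<alpha>) * cis (\<alpha> * Arg \<zeta>)"
    using \<zeta>0 by (simp add: Ln_Arg[OF \<zeta>0] exp_eq_polar powr_def)
  then have w: "?w = of_real (\<kappa> * norm \<zeta> powr \<alpha>) * cis (\<theta> + \<alpha> * Arg \<zeta>)"
    by (simp add: cis_mult[symmetric])
  have pos: "0 < \<kappa> * norm \<zeta> powr \<alpha>" using \<kappa>_pos \<zeta>0 by simp
  show norm: "norm ?w = \<kappa> * norm \<zeta> powr \<alpha>" using \<kappa>_pos by (simp add: w norm_mult)
  show arg: "is_arg_of (\<theta> + \<alpha> * Arg \<zeta>) ?w"
    unfolding is_arg_of_def norm using w pos by auto
  have "\<kappa> * R powr \<alpha> < norm ?w"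
    unfolding norm using \<kappa>_pos \<zeta> R \<alpha>_bounds by (intro mult_strict_left_mono powr_less_mono2) auto
  moreover have "\<bar>\<alpha> * Arg \<zeta>\<bar> < \<alpha> * (pi / 4)"
    using Arg \<alpha>_bounds by (simp add: abs_mult)
  then have "\<theta> - \<alpha> * (pi / 4) < \<theta> + \<alpha> * Arg \<zeta>" "\<theta> + \<alpha> * Arg \<zeta> < \<theta> + \<alpha> * (pi / 4)" by linarith+
  ultimately show "d + ?w \<in> G R"
    using arg by (auto simp: G_def sector_def sector_width)
qed

text \<open>Both L along the chart and \<alpha> Ln \<zeta> have derivative \<alpha> / \<zeta>. Their
  difference is constant on the convex wedge, and \<zeta> = 1 identifies the constant as
  \<eta>.\<close>

lemma L_polar:
  assumes "\<zeta> \<in> wedge 0"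
  shows "L (d + of_real \<kappa> * cis \<theta> * exp (of_real \<alpha> * Ln \<zeta>)) = \<eta> + of_real \<alpha> * Ln \<zeta>"
proof -
  let ?v = "\<lambda>\<zeta>. of_real \<kappa> * cis \<theta> * exp (of_real \<alpha> * Ln \<zeta>)"
  have D: "DERIV (\<lambda>\<zeta>. L (d + ?v \<zeta>) - of_real \<alpha> * Ln \<zeta>) \<zeta> :> 0"
    if \<zeta>: "\<zeta> \<in> wedge 0" for \<zeta>
  proof -
    note Ln = wedge_Ln_deriv[OF \<zeta>]
    have v: "DERIV ?v \<zeta> :> ?v \<zeta> * (of_real \<alpha> * (1 / \<zeta>))"
      using DERIV_cmult[OF DERIV_chain2[OF DERIV_exp DERIV_cmult[OF Ln, of "of_real \<alpha>"]], of "of_real \<kappa> * cis \<theta>"]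
      by (simp add: mult.assoc)
    have mem: "d + ?v \<zeta> \<in> sector N \<beta> d k 0 0"
      using polar_in_G(1)[OF \<zeta>, of 0] wedge_norm(4)[OF \<zeta>] G_subset by auto
    have "DERIV (\<lambda>\<zeta>. d + ?v \<zeta>) \<zeta> :> ?v \<zeta> * (of_real \<alpha> * (1 / \<zeta>))"
      using DERIV_add[OF DERIV_const[of d] v] by simp
    from DERIV_chain2[where f = L, OF L_deriv[OF mem] this]
    have "DERIV (\<lambda>\<zeta>. L (d + ?v \<zeta>)) \<zeta> :> of_real \<alpha> * (1 / \<zeta>)"
      using \<kappa>_pos by simp
    from DERIV_diff[OF this DERIV_cmult[OF Ln, of "of_real \<alpha>"]] show ?thesis by simp
  qed
  obtain c where c: "\<And>\<zeta>. \<zeta> \<in> wedge 0 \<Longrightarrow> L (d + ?v \<zeta>) - of_real \<alpha> * Ln \<zeta> = c"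
  proof -
    have "\<exists>c. \<forall>\<zeta>\<in>wedge 0. L (d + ?v \<zeta>) - of_real \<alpha> * Ln \<zeta> = c"
      by (rule has_field_derivative_zero_constant[OF convex_wedge])
         (auto intro: has_field_derivative_at_within D)
    then show ?thesis using that by blast
  qed
  have "1 \<in> wedge 0" by (simp add: wedge_def)
  from c[OF this] have "c = \<eta>" by (simp add: \<eta>_def)
  then show ?thesis using c[OF assms] by (simp add: algebra_simps)
qed

lemma exp_\<eta>: "exp \<eta> = of_real \<kappa> * cis \<theta>"
proof -
  have "d + of_real \<kappa> * cis \<theta> \<in> G 0"
    using polar_in_G(1)[of 1 0] by (simp add: wedge_def)
  then show ?thesis using exp_L G_subset by (fastforce simp: \<eta>_def)
qed

lemma w_polar: "w \<zeta> = of_real \<kappa> * cis \<theta> * exp (of_real \<alpha> * Ln \<zeta>)"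
  by (simp add: w_def exp_add exp_\<eta>)

lemmas w_in_G = polar_in_G(1)[folded w_polar]
  and L_w = L_polar[folded w_polar]

lemma w_arg: "\<zeta> \<in> wedge 0 \<Longrightarrow> is_arg_of (\<theta> + \<alpha> * Arg \<zeta>) (w \<zeta>)"
  and norm_w: "\<zeta> \<in> wedge 0 \<Longrightarrow> norm (w \<zeta>) = \<kappa> * norm \<zeta> powr \<alpha>"
  using polar_in_G(2,3)[of \<zeta> 0] wedge_norm(4)[of \<zeta> 0] by (simp_all add: w_polar)

lemma w_nonzero [simp]: "w \<zeta> \<noteq> 0"
  by (simp add: w_def)

lemma w_inv_w: "\<zeta> \<in> wedge 0 \<Longrightarrow> w_inv (d + w \<zeta>) = \<zeta>"
  using \<alpha>_bounds wedge_norm(5)[of \<zeta> 0] by (simp add: w_inv_def L_w)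

lemma G_eq_image:
  assumes R: "0 \<le> R"
  shows "G R = (\<lambda>\<zeta>. d + w \<zeta>) ` {\<zeta> \<in> wedge 0. R < norm \<zeta>}"
proof (intro equalityI subsetI)
  fix z assume z: "z \<in> G R"
  then obtain \<phi> where r: "\<kappa> * R powr \<alpha> < norm (z - d)" and \<phi>: "is_arg_of \<phi> (z - d)"
    "\<theta> - \<alpha> * (pi / 4) < \<phi>" "\<phi> < \<theta> + \<alpha> * (pi / 4)"
    by (auto simp: G_def sector_def sector_width)
  have zd: "z - d \<noteq> 0" using \<phi>(1) by (simp add: is_arg_of_def)
  define r where "r = (norm (z - d) / \<kappa>) powr (1 / \<alpha>)"
  define \<zeta> where "\<zeta> = rcis r ((\<phi> - \<theta>) / \<alpha>)"
  have r0: "0 < r" using zd \<kappa>_pos by (simp add: r_def)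
  have arg: "\<bar>(\<phi> - \<theta>) / \<alpha>\<bar> < pi / 4" using \<phi> \<alpha>_bounds by (simp add: abs_if field_simps)
  have norm_\<zeta>: "norm \<zeta> = r" using r0 by (simp add: \<zeta>_def)
  have Arg_\<zeta>: "Arg \<zeta> = (\<phi> - \<theta>) / \<alpha>"
  proof -
    have "- pi < (\<phi> - \<theta>) / \<alpha>" "(\<phi> - \<theta>) / \<alpha> \<le> pi" using arg pi_gt_zero by linarith+
    then show ?thesis unfolding \<zeta>_def by (intro Arg_rcis r0) simp
  qed
  have \<zeta>0: "\<zeta> \<noteq> 0" using norm_\<zeta> r0 by auto
  then have \<zeta>: "\<zeta> \<in> wedge 0" using arg Arg_\<zeta> by (simp add: wedge_0_iff)
  have r\<alpha>: "\<kappa> * r powr \<alpha> = norm (z - d)"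
    using \<alpha>_bounds \<kappa>_pos zd by (simp add: r_def powr_powr)
  have "w \<zeta> = of_real (norm (w \<zeta>)) * cis (\<theta> + \<alpha> * Arg \<zeta>)"
    using w_arg[OF \<zeta>] by (simp add: is_arg_of_def)
  also have "\<dots> = of_real (norm (z - d)) * cis \<phi>"
    using \<alpha>_bounds by (simp add: norm_w[OF \<zeta>] norm_\<zeta> r\<alpha> Arg_\<zeta>)
  also have "\<dots> = z - d" using \<phi>(1) by (simp add: is_arg_of_def)
  finally have "z = d + w \<zeta>" by simp
  moreover have "R < norm \<zeta>"
  proof (rule ccontr)
    assume "\<not> R < norm \<zeta>"
    then have "r powr \<alpha> \<le> R powr \<alpha>" using r0 \<alpha>_bounds norm_\<zeta> by (intro powr_mono2) auto
    then have "\<kappa> * r powr \<alpha> \<le> \<kappa> * R powr \<alpha>" using \<kappa>_pos by simp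
    then show False using r r\<alpha> by simp
  qed
  ultimately show "z \<in> (\<lambda>\<zeta>. d + w \<zeta>) ` {\<zeta> \<in> wedge 0. R < norm \<zeta>}" using \<zeta> by blast
qed (use w_in_G R in auto)

lemma inj_on_w: "inj_on (\<lambda>\<zeta>. d + w \<zeta>) (wedge 0)"
  by (rule inj_on_inverseI[of _ w_inv]) (rule w_inv_w)

lemma w_inv_in:
  assumes "0 \<le> R" "z \<in> G R"
  shows "w_inv z \<in> wedge 0" "R < norm (w_inv z)" "d + w (w_inv z) = z"
  using assms by (auto simp: G_eq_image w_inv_w)

lemma w_deriv:
  assumes "\<zeta> \<in> wedge 0"
  shows "DERIV w \<zeta> :> of_real \<alpha> * w \<zeta> / \<zeta>"
  unfolding w_def
  by (rule derivative_eq_intros wedge_Ln_deriv[OF assms] refl)+ simp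

lemma w_inv_deriv:
  assumes "z \<in> G R"
  shows "DERIV w_inv z :> w_inv z / (of_real \<alpha> * (z - d))"
proof -
  have z: "z \<in> sector N \<beta> d k 0 0" using assms G_subset by blast
  show ?thesis unfolding w_inv_def
    using DERIV_chain2[OF DERIV_exp DERIV_cdivide[OF DERIV_diff[OF L_deriv[OF z] DERIV_const]], of \<eta> "of_real \<alpha>"]
    by (simp add: mult.commute)
qed

lemma \<kappa>_power: "\<alpha>\<^sup>2 * norm b * \<kappa> ^ (N + 2) = 1"
proof -
  have "\<kappa> ^ (N + 2) = \<kappa> powr real (N + 2)"
    by (rule powr_realpow[OF \<kappa>_pos, symmetric])
  also have "\<dots> = (1 / (\<alpha> * sqrt (cmod b))) powr (\<alpha> * real (N + 2))"
    by (simp only: \<kappa>_def powr_powr)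
  also have "\<alpha> * real (N + 2) = 2" using \<alpha>_N by (simp add: add.commute)
  also have "(1 / (\<alpha> * sqrt (cmod b))) powr 2 = (1 / (\<alpha> * sqrt (cmod b)))\<^sup>2"
    using \<alpha>_bounds b_nonzero by simp
  also have "\<dots> = 1 / (\<alpha>\<^sup>2 * cmod b)" by (simp add: power_divide power_mult_distrib)
  finally show ?thesis using \<alpha>_bounds b_nonzero by simp
qed

text \<open>The moduli match by the choice of \<kappa>. The arguments match because \<beta> + (N +
  2) \<theta> = 2 \<pi> k, which is what makes the ray a Stokes ray.\<close>

lemma b_exp_\<eta>: "of_real (\<alpha>\<^sup>2) * b * exp \<eta> ^ (N + 2) = 1"
proof -
  have "b = of_real (norm b) * cis \<beta>" using arg_b by (simp add: is_arg_of_def)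
  then have "of_real (\<alpha>\<^sup>2) * b * exp \<eta> ^ (N + 2)
      = of_real (\<alpha>\<^sup>2 * norm b * \<kappa> ^ (N + 2)) * (cis \<beta> * cis \<theta> ^ (N + 2))"
    unfolding exp_\<eta> by (simp add: power_mult_distrib mult_ac del: power_Suc)
  also have "cis \<beta> * cis \<theta> ^ (N + 2) = cis (2 * pi * of_int k)"
  proof -
    have "\<beta> + real (N + 2) * \<theta> = 2 * pi * of_int k"
      by (simp add: \<theta>_def stokes_angle_def field_simps)
    moreover have "cis \<theta> ^ (N + 2) = cis (real (N + 2) * \<theta>)" by (rule Complex.DeMoivre)
    ultimately show ?thesis by (simp only: cis_mult)
  qed
  also have "\<dots> = 1" by (simp add: cis_multiple_2pi)
  finally show ?thesis by (simp only: \<kappa>_power of_real_1 mult_1)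
qed

lemma b_w_power:
  assumes "\<zeta> \<in> wedge 0"
  shows "of_real (\<alpha>\<^sup>2) * b * w \<zeta> ^ (N + 2) = \<zeta>\<^sup>2"
proof -
  have "w \<zeta> ^ (N + 2) = exp \<eta> ^ (N + 2) * exp (of_real (\<alpha> * (real N + 2)) * Ln \<zeta>)"
  proof -
    have "w \<zeta> ^ (N + 2) = exp (of_nat (N + 2) * (\<eta> + of_real \<alpha> * Ln \<zeta>))"
      by (simp only: w_def exp_of_nat_mult)
    also have "of_nat (N + 2) * (\<eta> + of_real \<alpha> * Ln \<zeta>)
        = of_nat (N + 2) * \<eta> + of_real (\<alpha> * (real N + 2)) * Ln \<zeta>"
      by (simp add: algebra_simps)
    finally show ?thesis by (simp only: exp_add exp_of_nat_mult)
  qed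
  also have "exp (of_real (\<alpha> * (real N + 2)) * Ln \<zeta>) = \<zeta>\<^sup>2"
    using wedge_norm(5)[OF assms] by (simp add: \<alpha>_N exp_double)
  finally have "of_real (\<alpha>\<^sup>2) * b * w \<zeta> ^ (N + 2) = (of_real (\<alpha>\<^sup>2) * b * exp \<eta> ^ (N + 2)) * \<zeta>\<^sup>2"
    by (simp only: mult.assoc)
  then show ?thesis by (simp only: b_exp_\<eta> mult_1)
qed

lemma filterlim_w_inv:
  assumes R: "0 \<le> R"
  shows "filterlim w_inv wedge_at_top (inf at_infinity (principal (G R)))"
  unfolding filterlim_def le_filter_def eventually_filtermap
proof (intro allI impI)
  fix P assume "eventually P wedge_at_top"
  then obtain A where A: "\<And>\<zeta>. \<zeta> \<in> wedge A \<Longrightarrow> P \<zeta>" unfolding eventually_wedge_at_top by blast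
  have "P (w_inv z)" if z: "z \<in> G R" "\<kappa> * (2 * \<bar>A\<bar>) powr \<alpha> + norm d + 1 \<le> norm z" for z
  proof (rule A, rule norm_gt_imp_wedge)
    show \<zeta>: "w_inv z \<in> wedge 0" by (rule w_inv_in(1)[OF R z(1)])
    have "\<kappa> * (2 * \<bar>A\<bar>) powr \<alpha> < norm (z - d)" using z(2) norm_triangle_ineq2[of z d] by linarith
    also have "z - d = w (w_inv z)" using w_inv_in(3)[OF R z(1)] by (simp add: algebra_simps)
    also have "norm (w (w_inv z)) = \<kappa> * norm (w_inv z) powr \<alpha>" by (rule norm_w[OF \<zeta>])
    finally have "(2 * \<bar>A\<bar>) powr \<alpha> < norm (w_inv z) powr \<alpha>" using \<kappa>_pos by simp
    then show "2 * \<bar>A\<bar> < norm (w_inv z)"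
      using \<alpha>_bounds by (metis less_eq_real_def norm_ge_zero not_less powr_mono2)
  qed
  then show "eventually (\<lambda>z. P (w_inv z)) (inf at_infinity (principal (G R)))"
    unfolding eventually_inf_principal eventually_at_infinity by blast
qed

lemma filterlim_norm_w: "filterlim (\<lambda>\<zeta>. norm (w \<zeta>)) at_top wedge_at_top"
proof -
  have "filterlim norm at_top wedge_at_top"
    unfolding wedge_at_top_def
    by (rule filterlim_mono[OF filterlim_norm_at_top]) auto
  moreover have "filterlim (\<lambda>s. \<kappa> * s powr \<alpha>) at_top at_top"
    using \<kappa>_pos \<alpha>_bounds(1) by real_asymp
  ultimately have lim: "filterlim (\<lambda>\<zeta>. \<kappa> * norm \<zeta> powr \<alpha>) at_top wedge_at_top"
    by (rule filterlim_compose[rotated])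
  have "eventually (\<lambda>\<zeta>. \<kappa> * norm \<zeta> powr \<alpha> = norm (w \<zeta>)) wedge_at_top"
    by (rule eventually_wedge_at_topI[of 0]) (simp add: norm_w)
  from filterlim_cong[OF refl refl this] lim show ?thesis by simp
qed

end

section \<open>The coefficients near infinity\<close>

text \<open>The second coefficient moves by a multiple of d; the choice of d for N \<ge> 1 uses this
  freedom. A bound on the degree, instead of its exact value, lets the induction pass to the tail of
  a \<open>pCons\<close>.\<close>

lemma coeff_pcompose_shift:
  fixes T :: "complex poly"
  shows "degree T \<le> Suc m \<Longrightarrow> coeff (pcompose T [:d, 1:]) (Suc m) = coeff T (Suc m) \<and>
    coeff (pcompose T [:d, 1:]) m = coeff T m + of_nat (Suc m) * d * coeff T (Suc m)"
proof (induction m arbitrary: T)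
  case 0
  obtain x T' where T: "T = pCons x T'" by (cases T)
  then have "degree T' = 0" using 0 by (simp split: if_splits)
  then obtain y where "T' = [:y:]" by (rule degree_eq_zeroE)
  then show ?case by (simp add: T pcompose_pCons)
next
  case (Suc m)
  obtain x T' where T: "T = pCons x T'" by (cases T)
  then have "degree T' \<le> Suc m" using Suc.prems by (simp split: if_splits)
  moreover from this have "coeff (pcompose T' [:d, 1:]) (Suc (Suc m)) = 0" "coeff T' (Suc (Suc m)) = 0"
    by (auto intro!: coeff_eq_0 simp: degree_pcompose)
  ultimately show ?case
    using Suc.IH[of T'] by (simp add: T pcompose_pCons algebra_simps)
qed

text \<open>
  With \<open>v = z - d\<close> and \<open>x = 1 / v\<close>, \<open>v\<close> to the power \<open>degree T\<close> times \<open>rev_shift d T\<close> at \<open>x\<close> is \<open>T\<close> at \<open>z\<close>.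
  So expansions at infinity become expansions of polynomials at \<open>x = 0\<close>.
\<close>

definition rev_shift :: "complex \<Rightarrow> complex poly \<Rightarrow> complex poly" where
  "rev_shift d T = reflect_poly (pcompose T [:d, 1:])"

lemma poly_rev_shift:
  assumes "v \<noteq> 0"
  shows "poly T (d + v) = v ^ degree T * poly (rev_shift d T) (1 / v)"
  using assms
  by (simp add: rev_shift_def poly_reflect_poly_nz degree_pcompose poly_pcompose field_simps)

lemma poly_rev_shift_0: "poly (rev_shift d T) 0 = lead_coeff T"
  by (simp add: rev_shift_def lead_coeff_comp)

lemma poly_pderiv_rev_shift_0:
  "poly (pderiv (rev_shift d T)) 0 =
     (if degree T = 0 then 0 else coeff T (degree T - 1) + of_nat (degree T) * d * lead_coeff T)"
proof -
  have "poly (pderiv (rev_shift d T)) 0 = coeff (rev_shift d T) 1"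
    by (simp add: poly_0_coeff_0 coeff_pderiv)
  also have "\<dots> = (if degree T = 0 then 0 else coeff (pcompose T [:d, 1:]) (degree T - 1))"
    by (auto simp: rev_shift_def coeff_reflect_poly degree_pcompose)
  also have "\<dots> = (if degree T = 0 then 0 else coeff T (degree T - 1) + of_nat (degree T) * d * lead_coeff T)"
    using coeff_pcompose_shift[of T "degree T - 1" d] by auto
  finally show ?thesis .
qed

text \<open>Differentiating \<open>poly_rev_shift\<close> in v and comparing derivatives. The
  additional factor v avoids the exponent degree T - 1, which is truncated for constants.\<close>

lemma poly_pderiv_rev_shift:
  assumes v: "v \<noteq> 0"
  shows "v * poly (pderiv T) (d + v) = v ^ degree T *
    (of_nat (degree T) * poly (rev_shift d T) (1 / v) - poly (pderiv (rev_shift d T)) (1 / v) / v)"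
proof -
  let ?F = "rev_shift d T" and ?n = "degree T"
  have D: "DERIV (\<lambda>v. v ^ ?n * poly ?F (1 / v)) v :> of_nat ?n * v ^ (?n - 1) * poly ?F (1 / v) + (poly (pderiv ?F) (1 / v) * (- 1 / v\<^sup>2)) * v ^ ?n"
  proof (rule DERIV_mult)
    show "DERIV (\<lambda>v. v ^ ?n) v :> of_nat ?n * v ^ (?n - 1)"
      by (auto intro!: derivative_eq_intros)
    show "DERIV (\<lambda>v. poly ?F (1 / v)) v :> poly (pderiv ?F) (1 / v) * (- 1 / v\<^sup>2)"
      by (rule DERIV_chain2[OF poly_DERIV])
         (use v in \<open>auto intro!: derivative_eq_intros simp: power2_eq_square\<close>)
  qed
  have "DERIV (\<lambda>v. poly T (d + v)) v :> of_nat ?n * v ^ (?n - 1) * poly ?F (1 / v) + (poly (pderiv ?F) (1 / v) * (- 1 / v\<^sup>2)) * v ^ ?n"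
    by (rule has_field_derivative_transform_within_open[OF D, of "- {0}"]) (use v poly_rev_shift in auto)
  moreover have "DERIV (\<lambda>v. poly T (d + v)) v :> poly (pderiv T) (d + v) * 1"
    by (rule DERIV_chain2[OF poly_DERIV]) (auto intro!: derivative_eq_intros)
  ultimately have eq: "poly (pderiv T) (d + v)
     = of_nat ?n * v ^ (?n - 1) * poly ?F (1 / v) + (poly (pderiv ?F) (1 / v) * (- 1 / v\<^sup>2)) * v ^ ?n"
    using DERIV_unique by fastforce
  have 1: "of_nat ?n * v ^ (?n - 1) * v = of_nat ?n * v ^ ?n"
    by (cases ?n) auto
  have 2: "v * (poly (pderiv ?F) (1 / v) * (- 1 / v\<^sup>2)) = - (poly (pderiv ?F) (1 / v) / v)"
    using v by (simp add: power2_eq_square)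
  have "v * (x * f + y * w) = (x * v) * f + (v * y) * w" for x y f w
    by (simp add: algebra_simps)
  then show ?thesis unfolding eq 1[symmetric] 2 by (simp only: 1 2) (simp add: algebra_simps)
qed

lemma holomorphic_local_bounds:
  assumes f: "f holomorphic_on ball 0 r" and r: "0 < r"
  obtains \<epsilon> C where "0 < \<epsilon>" "0 \<le> C" "\<epsilon> \<le> r"
    "\<And>x. norm x < \<epsilon> \<Longrightarrow> norm (f x) \<le> C \<and> norm (deriv f x) \<le> C \<and>
       norm (f x - f 0 - deriv f 0 * x) \<le> C * (norm x)\<^sup>2"
proof -
  have sub: "cball 0 (r / 2) \<subseteq> ball (0 :: complex) r" using r by auto
  have f1: "deriv f holomorphic_on ball 0 r" by (intro holomorphic_deriv f) auto
  have f2: "deriv (deriv f) holomorphic_on ball 0 r" by (intro holomorphic_deriv f1) auto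
  have bd: "\<exists>C. \<forall>x. norm x \<le> r / 2 \<longrightarrow> norm (h x) \<le> C" if "h holomorphic_on ball 0 r" for h :: "complex \<Rightarrow> complex"
  proof -
    have "compact (h ` cball 0 (r / 2))"
      by (intro compact_continuous_image continuous_on_subset[OF holomorphic_on_imp_continuous_on[OF that] sub]) auto
    then obtain C where "\<forall>x\<in>cball 0 (r / 2). norm (h x) \<le> C"
      by (auto dest!: compact_imp_bounded simp: bounded_iff)
    then have "\<forall>x. norm x \<le> r / 2 \<longrightarrow> norm (h x) \<le> C" by (metis mem_cball_0)
    then show ?thesis by blast
  qed
  obtain C0 where C0: "\<And>x. norm x \<le> r / 2 \<Longrightarrow> norm (f x) \<le> C0" using bd[OF f] by blast
  obtain C1 where C1: "\<And>x. norm x \<le> r / 2 \<Longrightarrow> norm (deriv f x) \<le> C1" using bd[OF f1] by blast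
  obtain C2 where C2: "\<And>x. norm x \<le> r / 2 \<Longrightarrow> norm (deriv (deriv f) x) \<le> C2" using bd[OF f2] by blast
  show ?thesis
  proof
    show "0 < r / 2" "r / 2 \<le> r" using r by auto
    show "0 \<le> \<bar>C0\<bar> + \<bar>C1\<bar> + \<bar>C2\<bar>" by simp
    fix x :: complex assume x: "norm x < r / 2"
    have D: "(h has_field_derivative deriv h y) (at y within cball 0 (r / 2))"
      if "h holomorphic_on ball 0 r" "y \<in> cball 0 (r / 2)" for h y
      using holomorphic_derivI[OF that(1) open_ball, of y] that(2) sub has_field_derivative_at_within by blast
    have "norm ((deriv ^^ 0) f x - (\<Sum>i\<le>1. (deriv ^^ i) f 0 * (x - 0) ^ i / fact i)) \<le> C2 * norm (x - 0) ^ Suc 1 / fact 1"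
    proof (rule complex_Taylor[where S = "cball 0 (r / 2)"])
      show "((deriv ^^ i) f has_field_derivative (deriv ^^ Suc i) f y) (at y within cball 0 (r / 2))"
        if "y \<in> cball 0 (r / 2)" "i \<le> 1" for y i
        using that D[OF f] D[OF f1] by (auto simp: le_Suc_eq)
      show "norm ((deriv ^^ Suc 1) f y) \<le> C2" if "y \<in> cball 0 (r / 2)" for y
        using C2[of y] that by simp
    qed (use x r in auto)
    then have "norm (f x - f 0 - deriv f 0 * x) \<le> C2 * (norm x)\<^sup>2"
      by (simp add: power2_eq_square algebra_simps)
    also have "\<dots> \<le> (\<bar>C0\<bar> + \<bar>C1\<bar> + \<bar>C2\<bar>) * (norm x)\<^sup>2"
      by (intro mult_right_mono) auto
    finally show "norm (f x) \<le> \<bar>C0\<bar> + \<bar>C1\<bar> + \<bar>C2\<bar> \<and> norm (deriv f x) \<le> \<bar>C0\<bar> + \<bar>C1\<bar> + \<bar>C2\<bar> \<and>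
       norm (f x - f 0 - deriv f 0 * x) \<le> (\<bar>C0\<bar> + \<bar>C1\<bar> + \<bar>C2\<bar>) * (norm x)\<^sup>2"
      using C0[of x] C1[of x] x by auto
  qed
qed

section \<open>The coefficients of the equation as functions of x = 1 / (z - d)\<close>

locale stokes_problem = stokes_chart +
  fixes P Q S :: "complex poly" and p q :: nat and a c D sb :: complex
    and pz Dc :: "nat \<Rightarrow> complex"
  assumes degP: "degree P = p" and monicP: "lead_coeff P = 1"
    and a: "a = (if p = 0 then 0 else coeff P (p - 1))"
    and degQ: "degree Q = q" and b: "b = lead_coeff Q"
    and c: "c = (if q = 0 then 0 else coeff Q (q - 1))"
    and pq: "p \<le> q" and N: "N = q - p"
    and degS: "degree S = N"
    and partial_fractions:
      "\<And>z. poly P z \<noteq> 0 \<Longrightarrow> poly Q z / poly P z = poly S z + (\<Sum>j<p. Dc j / (z - pz j))"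
    and d: "d = (if N \<ge> 1 then (a * b - c) / (b * of_nat N) else 0)"
    and sb: "sb = of_real (sqrt (cmod b)) * cis (\<beta> / 2)"
    and D: "D = (\<Sum>j<p. Dc j) / sb"
begin

abbreviation "FP \<equiv> poly (rev_shift d P)"

text \<open>At x = 1 / v this is v P'(d + v) / P(d + v), which extends holomorphically to x =
  0.\<close>

definition BP :: "complex \<Rightarrow> complex" where
  "BP x = of_nat p - x * poly (pderiv (rev_shift d P)) x / FP x"

text \<open>At x = 1 / v this is Q / (b v^N P) - 1 at the point d + v: the relative deviation of the
  quotient from its leading term.\<close>

definition VQ :: "complex \<Rightarrow> complex" where
  "VQ x = poly (rev_shift d Q) x / (b * FP x) - 1"

text \<open>Up to the factor |sb|, the size of the linear coefficient of \<open>VQ\<close> at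
  0.\<close>

definition e0 :: real where "e0 = (if N = 0 then cmod D else 0)"

lemma FP_0: "FP 0 = 1"
  using monicP by (simp add: poly_rev_shift_0)

lemma P_eq: "v \<noteq> 0 \<Longrightarrow> poly P (d + v) = v ^ p * FP (1 / v)"
  using poly_rev_shift[of v P d] by (simp add: degP)

lemma Re_FP_pos_near_0: obtains r where "0 < r" "\<And>x. norm x < r \<Longrightarrow> 0 < Re (FP x)"
proof -
  have "open {x. 0 < Re (FP x)}" by (intro open_Collect_less continuous_intros)
  moreover have "0 \<in> {x. 0 < Re (FP x)}" using FP_0 by simp
  ultimately obtain r where "0 < r" "ball 0 r \<subseteq> {x. 0 < Re (FP x)}" by (rule openE)
  then show ?thesis by (intro that[of r]) auto
qed

lemma VQ_deriv_0: "DERIV VQ 0 :> poly (pderiv (rev_shift d Q)) 0 / b - poly (pderiv (rev_shift d P)) 0"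
proof -
  have "DERIV VQ 0 :> (poly (pderiv (rev_shift d Q)) 0 * (b * FP 0)
      - poly (rev_shift d Q) 0 * (b * poly (pderiv (rev_shift d P)) 0)) / ((b * FP 0) * (b * FP 0)) - 0"
    unfolding VQ_def
    by (intro DERIV_diff DERIV_divide DERIV_cmult poly_DERIV DERIV_const)
       (use FP_0 b_nonzero in auto)
  moreover have "poly (rev_shift d Q) 0 = b" by (simp add: poly_rev_shift_0 b)
  moreover have "(x * (b * 1) - b * (b * y)) / ((b * 1) * (b * 1)) - 0 = x / b - y" for x y
    using b_nonzero by (simp add: field_simps)
  ultimately show ?thesis by (simp only: FP_0)
qed

lemma VQ_0: "VQ 0 = 0"
  unfolding VQ_def FP_0 using b_nonzero by (simp add: poly_rev_shift_0 b[symmetric])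

lemma sb_square: "sb\<^sup>2 = b"
proof -
  have "sb\<^sup>2 = of_real (norm b) * cis \<beta>"
    by (simp add: sb power_mult_distrib Complex.DeMoivre del: of_real_power flip: of_real_power)
  then show ?thesis using arg_b by (simp add: is_arg_of_def)
qed

lemma sb_nonzero: "sb \<noteq> 0"
  using sb_square b_nonzero by auto

text \<open>For N = 0 no shift can remove the linear term, and d = 0. The partial fractions show its
  coefficient directly: \<open>Dc j / (z - pz j)\<close> contributes \<open>Dc j\<close> to the
  coefficient of x = 1 / z.\<close>

lemma VQ_deriv_0_N0:
  assumes N0: "N = 0"
  shows "DERIV VQ 0 :> D * sb / b"
proof -
  define s where "s = coeff S 0"
  have S: "poly S z = s" for z
    using degS N0 by (auto simp: s_def elim!: degree_eq_zeroE)
  have pq': "p = q" and d0: "d = 0" using pq N N0 d by auto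
  define h where "h x = s / b - 1 + (\<Sum>j<p. Dc j * x / (1 - pz j * x)) / b" for x
  have h': "DERIV h 0 :> (\<Sum>j<p. Dc j) / b"
  proof -
    have "DERIV (\<lambda>x. Dc j * x / (1 - pz j * x)) 0 :> Dc j" for j
      by (auto intro!: derivative_eq_intros)
    then have "DERIV h 0 :> 0 + (\<Sum>j<p. Dc j) / b"
      unfolding h_def by (intro DERIV_add DERIV_const DERIV_cdivide DERIV_sum)
    then show ?thesis by simp
  qed
  obtain r where r': "0 < r" "\<And>x. norm x < r \<Longrightarrow> 0 < Re (FP x)" using Re_FP_pos_near_0 by blast
  then have r: "0 < r" "\<And>x. norm x < r \<Longrightarrow> FP x \<noteq> 0" by force+
  have eq: "VQ x = h x" if x: "x \<noteq> 0" "norm x < r" for x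
  proof -
    have nz: "FP x \<noteq> 0" using r x by simp
    have "poly P (d + 1 / x) \<noteq> 0" using P_eq[of "1 / x"] x nz by simp
    then have "poly Q (1 / x) / poly P (1 / x) = s + (\<Sum>j<p. Dc j / (1 / x - pz j))"
      using partial_fractions[of "1 / x"] by (simp add: S d0)
    moreover have "poly Q (1 / x) / poly P (1 / x) = poly (rev_shift d Q) x / FP x"
      using poly_rev_shift[of "1 / x" Q d] P_eq[of "1 / x"] x(1) by (simp add: d0 degQ pq')
    moreover have "Dc j / (1 / x - pz j) = Dc j * x / (1 - pz j * x)" for j
    proof -
      have "1 / x - pz j = (1 - pz j * x) / x" using x(1) by (simp add: field_simps)
      then show ?thesis by simp
    qed
    ultimately have "poly (rev_shift d Q) x / FP x = s + (\<Sum>j<p. Dc j * x / (1 - pz j * x))" by simp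
    then have "poly (rev_shift d Q) x / FP x / b = (s + (\<Sum>j<p. Dc j * x / (1 - pz j * x))) / b" by simp
    then show ?thesis by (simp add: VQ_def h_def add_divide_distrib mult.commute)
  qed
  have ev: "eventually (\<lambda>x. VQ x = h x) (at 0)"
    unfolding eventually_at using eq r(1) by (auto simp: dist_norm)
  \<comment> \<open>The partial fractions speak only of finite z, that is x \<noteq> 0; the value at
    x = 0 follows by continuity.\<close>
  have "VQ 0 = h 0"
  proof (rule tendsto_unique[OF at_neq_bot])
    show "(h \<longlongrightarrow> h 0) (at 0)" using DERIV_isCont[OF h'] by (simp add: isCont_def)
    have "(VQ \<longlongrightarrow> VQ 0) (at 0)" using DERIV_isCont[OF VQ_deriv_0] by (simp add: isCont_def)
    then show "(h \<longlongrightarrow> VQ 0) (at 0)" by (rule Lim_transform_eventually[OF _ ev])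
  qed
  then have "DERIV VQ 0 :> (\<Sum>j<p. Dc j) / b"
    using eq r(1) by (intro has_field_derivative_transform_within_open[OF h' open_ball[of 0 r]])
      (auto simp: dist_norm, metis)
  then show ?thesis using sb_nonzero by (simp add: D)
qed

text \<open>For N \<ge> 1 the linear coefficient is (c + q d b) / b - (a + p d) = c / b - a + N d,
  and d is defined to make this vanish.\<close>

lemma norm_VQ_deriv_0: "norm (deriv VQ 0) \<le> e0 / norm sb"
proof (cases "N = 0")
  case True
  have "deriv VQ 0 = D * sb / b" using VQ_deriv_0_N0[OF True] by (rule DERIV_imp_deriv)
  also have "\<dots> = D / sb" using sb_nonzero sb_square[symmetric] by (simp add: power2_eq_square)
  finally have "norm (deriv VQ 0) = norm D / norm sb" by (simp add: norm_divide)
  moreover have "e0 = norm D" unfolding e0_def using True by simp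
  ultimately show ?thesis by simp
next
  case False
  then have "N \<ge> 1" "q \<noteq> 0" using N by auto
  have bd: "b * of_nat N * d = a * b - c"
    using d \<open>N \<ge> 1\<close> b_nonzero by simp
  have "poly (pderiv (rev_shift d P)) 0 = a + of_nat p * d"
    using monicP by (simp add: poly_pderiv_rev_shift_0 degP a)
  moreover have "poly (pderiv (rev_shift d Q)) 0 = c + of_nat q * d * b"
    using \<open>q \<noteq> 0\<close> by (simp add: poly_pderiv_rev_shift_0 degQ c b)
  moreover have "of_nat q = of_nat p + (of_nat N :: complex)"
    using pq N by (metis of_nat_add le_add_diff_inverse)
  ultimately have "poly (pderiv (rev_shift d Q)) 0 / b - poly (pderiv (rev_shift d P)) 0 = 0"
    using bd b_nonzero by (simp add: field_simps)
  then have "deriv VQ 0 = 0" using VQ_deriv_0 by (simp add: DERIV_imp_deriv)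
  then show ?thesis using False by (simp add: e0_def)
qed

lemma coefficient_bounds:
  obtains \<epsilon> C where "0 < \<epsilon>" "0 \<le> C" "\<And>x. norm x < \<epsilon> \<Longrightarrow> 0 < Re (FP x)"
    "BP holomorphic_on ball 0 \<epsilon>" "VQ holomorphic_on ball 0 \<epsilon>"
    "\<And>x. norm x < \<epsilon> \<Longrightarrow> norm (BP x) \<le> C" "\<And>x. norm x < \<epsilon> \<Longrightarrow> norm (deriv BP x) \<le> C"
    "\<And>x. norm x < \<epsilon> \<Longrightarrow> norm (VQ x) \<le> C * (e0 * norm x + (norm x)\<^sup>2)"
proof -
  obtain r where r': "0 < r" "\<And>x. norm x < r \<Longrightarrow> 0 < Re (FP x)" using Re_FP_pos_near_0 by blast
  then have r: "0 < r" "\<And>x. norm x < r \<Longrightarrow> FP x \<noteq> 0" by force+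
  have B: "BP holomorphic_on ball 0 r"
    unfolding BP_def using r(2) by (intro holomorphic_intros) auto
  have V: "VQ holomorphic_on ball 0 r"
    unfolding VQ_def using r(2) b_nonzero by (intro holomorphic_intros) auto
  obtain \<epsilon>1 C1 where 1: "0 < \<epsilon>1" "0 \<le> C1" "\<epsilon>1 \<le> r" "\<And>x. norm x < \<epsilon>1 \<Longrightarrow> norm (BP x) \<le> C1 \<and> norm (deriv BP x) \<le> C1 \<and>
       norm (BP x - BP 0 - deriv BP 0 * x) \<le> C1 * (norm x)\<^sup>2"
    by (rule holomorphic_local_bounds[OF B r(1)]) blast
  obtain \<epsilon>2 C2 where 2: "0 < \<epsilon>2" "0 \<le> C2" "\<epsilon>2 \<le> r" "\<And>x. norm x < \<epsilon>2 \<Longrightarrow> norm (VQ x) \<le> C2 \<and> norm (deriv VQ x) \<le> C2 \<and>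
       norm (VQ x - VQ 0 - deriv VQ 0 * x) \<le> C2 * (norm x)\<^sup>2"
    by (rule holomorphic_local_bounds[OF V r(1)]) blast
  have e0: "0 \<le> e0" by (simp add: e0_def)
  define C where "C = C1 + C2 + 1 / norm sb"
  show ?thesis
  proof
    show "0 < min \<epsilon>1 \<epsilon>2" "0 \<le> C" using 1 2 by (auto simp: C_def)
    show "BP holomorphic_on ball 0 (min \<epsilon>1 \<epsilon>2)" "VQ holomorphic_on ball 0 (min \<epsilon>1 \<epsilon>2)"
      using 1 2 by (auto intro: holomorphic_on_subset[OF B] holomorphic_on_subset[OF V])
    fix x :: complex assume x: "norm x < min \<epsilon>1 \<epsilon>2"
    show "0 < Re (FP x)" using r'(2) x 1(3) by simp
    show "norm (BP x) \<le> C" "norm (deriv BP x) \<le> C"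
      using 1(4)[of x] x 2(2) by (auto simp: C_def intro: order_trans[of _ C1])
    have "norm (VQ x) \<le> norm (deriv VQ 0 * x) + C2 * (norm x)\<^sup>2"
      using 2(4)[of x] x norm_triangle_ineq[of "deriv VQ 0 * x" "VQ x - deriv VQ 0 * x"]
      by (auto simp: VQ_0)
    also have "\<dots> \<le> 1 / norm sb * (e0 * norm x) + C2 * (norm x)\<^sup>2"
      using mult_right_mono[OF norm_VQ_deriv_0 norm_ge_zero[of x]] by (simp add: norm_mult)
    also have "\<dots> \<le> C * (e0 * norm x) + C * (norm x)\<^sup>2"
      using 1 2 e0 by (intro add_mono mult_right_mono) (auto simp: C_def)
    finally show "norm (VQ x) \<le> C * (e0 * norm x + (norm x)\<^sup>2)" by (simp add: algebra_simps)
  qed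
qed

end

section \<open>Transfer of the equation between the sector and the wedge\<close>

context stokes_problem
begin

definition \<psi> :: "complex \<Rightarrow> complex" where "\<psi> \<zeta> = of_real \<alpha> * w \<zeta> / \<zeta>"

definition acoef :: "complex \<Rightarrow> complex" where
  "acoef \<zeta> = (of_real \<alpha> - 1 + of_real \<alpha> * BP (1 / w \<zeta>)) / \<zeta>"

definition Vcoef :: "complex \<Rightarrow> complex" where
  "Vcoef \<zeta> = VQ (1 / w \<zeta>)"

lemma \<psi>_nonzero: "\<zeta> \<in> wedge 0 \<Longrightarrow> \<psi> \<zeta> \<noteq> 0"
  using \<alpha>_bounds wedge_norm(5)[of \<zeta> 0] by (simp add: \<psi>_def)

lemma w_deriv': "\<zeta> \<in> wedge 0 \<Longrightarrow> DERIV w \<zeta> :> \<psi> \<zeta>"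
  using w_deriv by (simp add: \<psi>_def)

lemma \<psi>_deriv:
  assumes "\<zeta> \<in> wedge 0"
  shows "DERIV \<psi> \<zeta> :> \<psi> \<zeta> * ((of_real \<alpha> - 1) / \<zeta>)"
  unfolding \<psi>_def
  using DERIV_divide[OF DERIV_cmult[OF w_deriv[OF assms], of "of_real \<alpha>"] DERIV_ident wedge_norm(5)[OF assms]]
    wedge_norm(5)[OF assms]
  by (simp add: field_simps)

lemma inverse_w_deriv:
  assumes "\<zeta> \<in> wedge 0"
  shows "DERIV (\<lambda>\<zeta>. 1 / w \<zeta>) \<zeta> :> - of_real \<alpha> * (1 / w \<zeta>) / \<zeta>"
  using DERIV_divide[OF DERIV_const[of 1] w_deriv[OF assms] w_nonzero] by (simp add: mult.commute)

text \<open>Substituting z = d + w \<zeta> adds the logarithmic derivative (\<alpha> - 1) / \<zeta>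
  of dz/d\<zeta> = \<psi> to the transformed P'/P; this identifies \<open>acoef\<close> as the
  coefficient of the first derivative.\<close>

lemma acoef_eq:
  assumes \<zeta>: "\<zeta> \<in> wedge 0" and F: "FP (1 / w \<zeta>) \<noteq> 0"
  shows "acoef \<zeta> = (of_real \<alpha> - 1) / \<zeta> + \<psi> \<zeta> * (poly (pderiv P) (d + w \<zeta>) / poly P (d + w \<zeta>))"
proof -
  let ?F' = "poly (pderiv (rev_shift d P)) (1 / w \<zeta>)"
  have "w \<zeta> * poly (pderiv P) (d + w \<zeta>) = w \<zeta> ^ p * (of_nat p * FP (1 / w \<zeta>) - ?F' / w \<zeta>)"
    using poly_pderiv_rev_shift[OF w_nonzero, of \<zeta> P d] by (simp add: degP)
  then have "w \<zeta> * poly (pderiv P) (d + w \<zeta>) / poly P (d + w \<zeta>)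
      = (of_nat p * FP (1 / w \<zeta>) - ?F' / w \<zeta>) / FP (1 / w \<zeta>)"
    by (simp add: P_eq)
  also have "\<dots> = BP (1 / w \<zeta>)" using F by (simp add: BP_def field_simps)
  finally have "\<psi> \<zeta> * (poly (pderiv P) (d + w \<zeta>) / poly P (d + w \<zeta>)) = of_real \<alpha> * BP (1 / w \<zeta>) / \<zeta>"
    by (simp add: \<psi>_def flip: times_divide_eq_right)
  then show ?thesis by (simp add: acoef_def add_divide_distrib)
qed

text \<open>The defining relation of the chart says \<psi>^2 b w^N = 1, so the leading term of Q/P
  becomes the constant 1 and only \<open>VQ\<close> remains.\<close>

lemma Vcoef_eq:
  assumes \<zeta>: "\<zeta> \<in> wedge 0" and F: "FP (1 / w \<zeta>) \<noteq> 0"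
  shows "1 + Vcoef \<zeta> = (\<psi> \<zeta>)\<^sup>2 * (poly Q (d + w \<zeta>) / poly P (d + w \<zeta>))"
proof -
  have "q = N + p" using pq N by simp
  then have "poly Q (d + w \<zeta>) / poly P (d + w \<zeta>) = w \<zeta> ^ N * (poly (rev_shift d Q) (1 / w \<zeta>) / FP (1 / w \<zeta>))"
    using poly_rev_shift[OF w_nonzero, of Q d \<zeta>] by (simp add: degQ P_eq power_add)
  moreover have "(\<psi> \<zeta>)\<^sup>2 * w \<zeta> ^ N * b = 1"
  proof -
    have "of_real (\<alpha>\<^sup>2) * b * (w \<zeta> ^ 2 * w \<zeta> ^ N) = \<zeta>\<^sup>2"
      using b_w_power[OF \<zeta>] by (simp add: power2_eq_square mult_ac)
    moreover have "(\<psi> \<zeta>)\<^sup>2 * w \<zeta> ^ N * b = of_real (\<alpha>\<^sup>2) * b * (w \<zeta> ^ 2 * w \<zeta> ^ N) / \<zeta>\<^sup>2"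
      by (simp add: \<psi>_def power_divide power_mult_distrib)
    ultimately show ?thesis using wedge_norm(5)[OF \<zeta>] by simp
  qed
  then have "(\<psi> \<zeta>)\<^sup>2 * w \<zeta> ^ N = 1 / b" using b_nonzero by (simp add: field_simps)
  ultimately have "(\<psi> \<zeta>)\<^sup>2 * (poly Q (d + w \<zeta>) / poly P (d + w \<zeta>))
      = 1 / b * (poly (rev_shift d Q) (1 / w \<zeta>) / FP (1 / w \<zeta>))" by (metis mult.assoc)
  then show ?thesis by (simp add: Vcoef_def VQ_def)
qed

text \<open>Since |z - d| = \<kappa> |\<zeta>|^\<alpha>, the two terms are the linear and the
  quadratic part of \<open>VQ\<close> at 1 / (z - d).\<close>

definition \<rho> :: "real \<Rightarrow> real \<Rightarrow> real" where
  "\<rho> K s = K * (e0 * s powr (- \<alpha>) + s powr (- 2 * \<alpha>))"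

lemma e0_nonneg: "0 \<le> e0"
  by (simp add: e0_def)

lemma \<rho>_antimono: "0 \<le> K \<Longrightarrow> 0 < x \<Longrightarrow> x \<le> y \<Longrightarrow> \<rho> K y \<le> \<rho> K x"
  unfolding \<rho>_def using \<alpha>_bounds e0_nonneg
  by (intro mult_left_mono add_mono powr_mono2') auto

lemma \<rho>_lim: "(\<rho> K \<longlongrightarrow> 0) at_top"
proof -
  have "((\<lambda>s. K * (e0 * s powr (- \<alpha>) + s powr (- 2 * \<alpha>))) \<longlongrightarrow> K * (e0 * 0 + 0)) at_top"
    using \<alpha>_bounds by (intro tendsto_intros tendsto_neg_powr filterlim_ident) auto
  then show ?thesis by (simp add: \<rho>_def[abs_def])
qed

lemma coefficients_on_wedge:
  obtains A K a' where "1 \<le> A" "0 \<le> K"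
    "\<And>\<zeta>. \<zeta> \<in> wedge A \<Longrightarrow> 0 < Re (FP (1 / w \<zeta>))"
    "\<And>\<zeta>. \<zeta> \<in> wedge A \<Longrightarrow> DERIV acoef \<zeta> :> a' \<zeta>"
    "a' holomorphic_on wedge A" "Vcoef holomorphic_on wedge A"
    "\<And>\<zeta>. \<zeta> \<in> wedge A \<Longrightarrow> norm (acoef \<zeta>) \<le> K / norm \<zeta>"
    "\<And>\<zeta>. \<zeta> \<in> wedge A \<Longrightarrow> norm (Vcoef \<zeta> + a' \<zeta> / 2 - (acoef \<zeta>)\<^sup>2 / 4) \<le> \<rho> K (norm \<zeta>)"
proof -
  obtain \<epsilon> C where \<epsilon>: "0 < \<epsilon>" "0 \<le> C" and F: "\<And>x. norm x < \<epsilon> \<Longrightarrow> 0 < Re (FP x)"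
    and hol: "BP holomorphic_on ball 0 \<epsilon>" "VQ holomorphic_on ball 0 \<epsilon>"
    and B: "\<And>x. norm x < \<epsilon> \<Longrightarrow> norm (BP x) \<le> C" "\<And>x. norm x < \<epsilon> \<Longrightarrow> norm (deriv BP x) \<le> C"
    and V: "\<And>x. norm x < \<epsilon> \<Longrightarrow> norm (VQ x) \<le> C * (e0 * norm x + (norm x)\<^sup>2)"
    using coefficient_bounds by blast
  have "eventually (\<lambda>\<zeta>. max 1 (1 / \<epsilon>) < norm (w \<zeta>)) wedge_at_top"
    using filterlim_norm_w unfolding filterlim_at_top_dense by blast
  then obtain A0 where A0: "\<And>\<zeta>. \<zeta> \<in> wedge A0 \<Longrightarrow> max 1 (1 / \<epsilon>) < norm (w \<zeta>)"
    unfolding eventually_wedge_at_top by blast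
  define A where "A = max 1 A0"
  define x where "x \<zeta> = 1 / w \<zeta>" for \<zeta>
  have sub: "wedge A \<subseteq> wedge 0" "wedge A \<subseteq> wedge A0" by (auto simp: A_def wedge_def)
  have x: "norm (x \<zeta>) < \<epsilon>" "norm (x \<zeta>) < 1" if "\<zeta> \<in> wedge A" for \<zeta>
    using A0[of \<zeta>] that sub \<epsilon>(1) by (auto simp: x_def norm_divide field_simps)
  define a' where "a' \<zeta> = - acoef \<zeta> / \<zeta> - of_real (\<alpha>\<^sup>2) * deriv BP (x \<zeta>) * x \<zeta> / \<zeta>\<^sup>2" for \<zeta>
  have a': "DERIV acoef \<zeta> :> a' \<zeta>" if \<zeta>: "\<zeta> \<in> wedge A" for \<zeta>
  proof -
    have \<zeta>0: "\<zeta> \<noteq> 0" using wedge_norm(5)[OF \<zeta>] .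
    have "DERIV (\<lambda>\<zeta>. BP (x \<zeta>)) \<zeta> :> deriv BP (x \<zeta>) * (- of_real \<alpha> * x \<zeta> / \<zeta>)"
    proof (rule DERIV_chain2[where f = BP and g = x])
      show "DERIV BP (x \<zeta>) :> deriv BP (x \<zeta>)"
        using x(1)[OF \<zeta>] by (intro holomorphic_derivI[OF hol(1)]) auto
      show "DERIV x \<zeta> :> - of_real \<alpha> * x \<zeta> / \<zeta>"
        unfolding x_def by (rule inverse_w_deriv) (use \<zeta> sub in blast)
    qed
    from DERIV_divide[OF DERIV_add[OF DERIV_const[of "of_real \<alpha> - 1"] DERIV_cmult[OF this, of "of_real \<alpha>"]] DERIV_ident \<zeta>0]
    have D: "DERIV acoef \<zeta> :> ((0 + of_real \<alpha> * (deriv BP (x \<zeta>) * (- of_real \<alpha> * x \<zeta> / \<zeta>))) * \<zeta> -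
        (of_real \<alpha> - 1 + of_real \<alpha> * BP (x \<zeta>)) * 1) / (\<zeta> * \<zeta>)"
      unfolding acoef_def x_def .
    have "((0 + of_real \<alpha> * (y * (- of_real \<alpha> * x \<zeta> / \<zeta>))) * \<zeta> - z * 1) / (\<zeta> * \<zeta>)
        = - (z / \<zeta>) / \<zeta> - of_real (\<alpha>\<^sup>2) * y * x \<zeta> / \<zeta>\<^sup>2" for y z
      using \<zeta>0 by (simp add: field_simps power2_eq_square)
    from this[of "deriv BP (x \<zeta>)" "of_real \<alpha> - 1 + of_real \<alpha> * BP (x \<zeta>)"] D
    show ?thesis unfolding a'_def acoef_def[of \<zeta>] x_def by (simp only:)
  qed
  have hol_x: "x holomorphic_on wedge A"
    using inverse_w_deriv sub unfolding x_def[abs_def] by (auto simp: holomorphic_on_open[OF open_wedge])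
  have hol_a: "acoef holomorphic_on wedge A"
    using a' by (auto simp: holomorphic_on_open[OF open_wedge])
  have im: "x ` wedge A \<subseteq> ball 0 \<epsilon>" using x by auto
  have dB: "(\<lambda>\<zeta>. deriv BP (x \<zeta>)) holomorphic_on wedge A"
    using holomorphic_on_compose_gen[OF hol_x holomorphic_deriv[OF hol(1) open_ball] im] by (simp add: o_def)
  have hol_a': "a' holomorphic_on wedge A"
    unfolding a'_def using wedge_norm(5)
    by (intro holomorphic_intros hol_a hol_x dB) auto
  have hol_V: "Vcoef holomorphic_on wedge A"
    using holomorphic_on_compose_gen[OF hol_x hol(2) im] by (simp add: o_def Vcoef_def[abs_def] x_def)
  have a_le: "norm (acoef \<zeta>) \<le> (1 + C) / norm \<zeta>" if \<zeta>: "\<zeta> \<in> wedge A" for \<zeta>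
  proof -
    have "norm (of_real \<alpha> - 1 + of_real \<alpha> * BP (x \<zeta>)) \<le> norm (of_real (\<alpha> - 1) :: complex) + norm (of_real \<alpha> * BP (x \<zeta>))"
      using norm_triangle_ineq[of "of_real \<alpha> - 1"] by simp
    also have "\<dots> \<le> 1 + 1 * C"
      unfolding norm_mult norm_of_real using \<alpha>_bounds B(1)[OF x(1)[OF \<zeta>]] by (intro add_mono mult_mono) auto
    finally show ?thesis by (simp add: acoef_def x_def norm_divide divide_right_mono)
  qed
  have a'_le: "norm (a' \<zeta>) \<le> (1 + 2 * C) / (norm \<zeta>)\<^sup>2" if \<zeta>: "\<zeta> \<in> wedge A" for \<zeta>
  proof -
    have pos: "0 < norm \<zeta>" using wedge_norm(5)[OF \<zeta>] by simp
    have "norm (a' \<zeta>) \<le> norm (acoef \<zeta> / \<zeta>) + norm (of_real (\<alpha>\<^sup>2) * deriv BP (x \<zeta>) * x \<zeta> / \<zeta>\<^sup>2)"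
      unfolding a'_def using norm_triangle_ineq4[of "- acoef \<zeta> / \<zeta>"] by simp
    also have "norm (acoef \<zeta> / \<zeta>) \<le> (1 + C) / (norm \<zeta>)\<^sup>2"
      using divide_right_mono[OF a_le[OF \<zeta>], of "norm \<zeta>"] by (simp add: norm_divide power2_eq_square)
    also have "norm (of_real (\<alpha>\<^sup>2) * deriv BP (x \<zeta>) * x \<zeta> / \<zeta>\<^sup>2) \<le> 1 * C * 1 / (norm \<zeta>)\<^sup>2"
      unfolding norm_mult norm_divide norm_power norm_of_real
      using \<alpha>_bounds B(2)[OF x(1)[OF \<zeta>]] x(2)[OF \<zeta>] \<epsilon>(2)
      by (intro divide_right_mono mult_mono) (auto simp: power_le_one)
    finally show ?thesis by (simp add: add_divide_distrib[symmetric] algebra_simps)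
  qed
  have V_le: "norm (Vcoef \<zeta>) \<le> C * (e0 * (norm \<zeta> powr (- \<alpha>) / \<kappa>) + norm \<zeta> powr (- 2 * \<alpha>) / \<kappa>\<^sup>2)"
    if \<zeta>: "\<zeta> \<in> wedge A" for \<zeta>
  proof -
    have nx: "norm (x \<zeta>) = norm \<zeta> powr (- \<alpha>) / \<kappa>"
      using norm_w[of \<zeta>] \<zeta> sub by (simp add: x_def norm_divide powr_minus field_simps subset_iff)
    have "(norm (x \<zeta>))\<^sup>2 = norm \<zeta> powr (- 2 * \<alpha>) / \<kappa>\<^sup>2"
      unfolding nx power_divide power2_eq_square[of "_ powr _"] by (simp flip: powr_add)
    then show ?thesis using V[OF x(1)[OF \<zeta>]] unfolding Vcoef_def x_def[symmetric] nx by simp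
  qed
  define K where "K = C / \<kappa> + C / \<kappa>\<^sup>2 + (1 + 2 * C) + (1 + C)\<^sup>2 + (1 + C)"
  have K: "0 \<le> K" "1 + C \<le> K" "C / \<kappa> \<le> K" "C / \<kappa>\<^sup>2 + (1 + 2 * C) + (1 + C)\<^sup>2 \<le> K"
    using \<epsilon>(2) \<kappa>_pos by (auto simp: K_def)
  have W_le: "norm (Vcoef \<zeta> + a' \<zeta> / 2 - (acoef \<zeta>)\<^sup>2 / 4) \<le> \<rho> K (norm \<zeta>)" if \<zeta>: "\<zeta> \<in> wedge A" for \<zeta>
  proof -
    define s where "s = norm \<zeta>"
    have s: "1 < s" using wedge_norm(4)[OF \<zeta>] by (simp add: s_def A_def)
    \<comment> \<open>The terms a'/2 and a^2/4 are of the order |\<zeta>|^(-2); as \<alpha> \<le> 1,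
      the quadratic part of \<rho> absorbs them.\<close>
    have s2: "1 / s\<^sup>2 \<le> s powr (- 2 * \<alpha>)"
    proof -
      have "1 / s\<^sup>2 = s powr (- 2)" using s by (simp add: powr_minus powr_realpow inverse_eq_divide)
      also have "\<dots> \<le> s powr (- 2 * \<alpha>)" using s \<alpha>_bounds by (intro powr_mono) auto
      finally show ?thesis .
    qed
    have sq: "norm ((acoef \<zeta>)\<^sup>2) \<le> (1 + C)\<^sup>2 / s\<^sup>2"
      using power_mono[OF a_le[OF \<zeta>] norm_ge_zero, of 2] by (simp add: norm_power power_divide s_def)
    have "norm (Vcoef \<zeta> + a' \<zeta> / 2 - (acoef \<zeta>)\<^sup>2 / 4) \<le> norm (Vcoef \<zeta>) + norm (a' \<zeta>) / 2 + norm ((acoef \<zeta>)\<^sup>2) / 4"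
      using norm_triangle_ineq4[of "Vcoef \<zeta> + a' \<zeta> / 2" "(acoef \<zeta>)\<^sup>2 / 4"] norm_triangle_ineq[of "Vcoef \<zeta>" "a' \<zeta> / 2"]
      by (simp add: norm_divide)
    also have "\<dots> \<le> norm (Vcoef \<zeta>) + norm (a' \<zeta>) + norm ((acoef \<zeta>)\<^sup>2)"
      by (intro add_mono) auto
    also have "\<dots> \<le> C * (e0 * (s powr (- \<alpha>) / \<kappa>) + s powr (- 2 * \<alpha>) / \<kappa>\<^sup>2) + (1 + 2 * C) / s\<^sup>2 + (1 + C)\<^sup>2 / s\<^sup>2"
      using V_le[OF \<zeta>] a'_le[OF \<zeta>] sq by (intro add_mono) (auto simp: s_def)
    also have "\<dots> = (C / \<kappa>) * (e0 * s powr (- \<alpha>)) + (C / \<kappa>\<^sup>2) * s powr (- 2 * \<alpha>) + ((1 + 2 * C) + (1 + C)\<^sup>2) * (1 / s\<^sup>2)"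
      by (simp add: algebra_simps add_divide_distrib)
    also have "\<dots> \<le> (C / \<kappa>) * (e0 * s powr (- \<alpha>)) + (C / \<kappa>\<^sup>2) * s powr (- 2 * \<alpha>) + ((1 + 2 * C) + (1 + C)\<^sup>2) * s powr (- 2 * \<alpha>)"
      using s2 \<epsilon>(2) by (intro add_left_mono mult_left_mono) auto
    also have "\<dots> = (C / \<kappa>) * (e0 * s powr (- \<alpha>)) + (C / \<kappa>\<^sup>2 + (1 + 2 * C) + (1 + C)\<^sup>2) * s powr (- 2 * \<alpha>)"
      by (simp add: algebra_simps)
    also have "\<dots> \<le> K * (e0 * s powr (- \<alpha>)) + K * s powr (- 2 * \<alpha>)"
      using K e0_nonneg by (intro add_mono mult_right_mono) auto
    finally show ?thesis by (simp add: \<rho>_def s_def algebra_simps)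
  qed
  show ?thesis
  proof (rule that[of A K a'])
    show "0 < Re (FP (1 / w \<zeta>))" if "\<zeta> \<in> wedge A" for \<zeta> using F[OF x(1)[OF that]] by (simp add: x_def)
    show "norm (acoef \<zeta>) \<le> K / norm \<zeta>" if "\<zeta> \<in> wedge A" for \<zeta>
      using a_le[OF that] divide_right_mono[OF K(2), of "norm \<zeta>"] by simp
  qed (use K(1) a' hol_a' hol_V W_le in \<open>auto simp: A_def\<close>)
qed

lemma pullback:
  assumes g: "analytic_solution P Q UNIV g" and \<zeta>: "\<zeta> \<in> wedge 0" and F: "FP (1 / w \<zeta>) \<noteq> 0"
  shows "DERIV (\<lambda>\<zeta>. g (d + w \<zeta>)) \<zeta> :> deriv g (d + w \<zeta>) * \<psi> \<zeta>"
    and "DERIV (\<lambda>\<zeta>. deriv g (d + w \<zeta>) * \<psi> \<zeta>) \<zeta> :> acoef \<zeta> * (deriv g (d + w \<zeta>) * \<psi> \<zeta>) - (1 + Vcoef \<zeta>) * g (d + w \<zeta>)"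
proof -
  have hol: "g holomorphic_on UNIV" using g by (simp add: analytic_solution_def)
  have g': "DERIV g z :> deriv g z" for z
    using holomorphic_derivI[OF hol open_UNIV] by simp
  have g'': "DERIV (deriv g) z :> deriv (deriv g) z" for z
    using holomorphic_derivI[OF holomorphic_deriv[OF hol open_UNIV] open_UNIV] by simp
  have dw: "DERIV (\<lambda>\<zeta>. d + w \<zeta>) \<zeta> :> \<psi> \<zeta>"
    using DERIV_add[OF DERIV_const[of d] w_deriv'[OF \<zeta>]] by simp
  show "DERIV (\<lambda>\<zeta>. g (d + w \<zeta>)) \<zeta> :> deriv g (d + w \<zeta>) * \<psi> \<zeta>"
    by (rule DERIV_chain2[OF g' dw])
  let ?z = "d + w \<zeta>"
  have nz: "poly P ?z \<noteq> 0" using F by (simp add: P_eq)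
  have ode: "deriv (deriv g) ?z = poly (pderiv P) ?z / poly P ?z * deriv g ?z - poly Q ?z / poly P ?z * g ?z"
    using g nz by (simp add: analytic_solution_def algebra_simps)
  have "DERIV (\<lambda>\<zeta>. deriv g (d + w \<zeta>) * \<psi> \<zeta>) \<zeta> :> (deriv (deriv g) ?z * \<psi> \<zeta>) * \<psi> \<zeta> + \<psi> \<zeta> * ((of_real \<alpha> - 1) / \<zeta>) * deriv g ?z"
    by (rule DERIV_mult[OF DERIV_chain2[OF g'' dw] \<psi>_deriv[OF \<zeta>]])
  also have "(deriv (deriv g) ?z * \<psi> \<zeta>) * \<psi> \<zeta> + \<psi> \<zeta> * ((of_real \<alpha> - 1) / \<zeta>) * deriv g ?z
      = acoef \<zeta> * (deriv g ?z * \<psi> \<zeta>) - (1 + Vcoef \<zeta>) * g ?z"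
    unfolding ode acoef_eq[OF \<zeta> F] Vcoef_eq[OF \<zeta> F] by (simp add: algebra_simps power2_eq_square)
  finally show "DERIV (\<lambda>\<zeta>. deriv g (d + w \<zeta>) * \<psi> \<zeta>) \<zeta> :> acoef \<zeta> * (deriv g (d + w \<zeta>) * \<psi> \<zeta>) - (1 + Vcoef \<zeta>) * g (d + w \<zeta>)" .
qed

text \<open>The exponential has no zeros, so the second-order equation for it is equivalent to the
  Riccati equation for its logarithmic derivative u / \<psi> in z.\<close>

lemma pushforward:
  assumes U: "\<And>\<zeta>. \<zeta> \<in> wedge A \<Longrightarrow> DERIV U \<zeta> :> u \<zeta>"
    and u: "\<And>\<zeta>. \<zeta> \<in> wedge A \<Longrightarrow>
        DERIV u \<zeta> :> acoef \<zeta> * u \<zeta> - (1 + Vcoef \<zeta>) - (u \<zeta>)\<^sup>2"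
    and F: "\<And>\<zeta>. \<zeta> \<in> wedge A \<Longrightarrow> FP (1 / w \<zeta>) \<noteq> 0"
    and A: "0 \<le> A" and R: "2 * A \<le> R"
  shows "analytic_solution P Q (G R) (\<lambda>z. exp (U (w_inv z)))"
    and "\<And>z. z \<in> G R \<Longrightarrow> deriv (\<lambda>z. exp (U (w_inv z))) z = u (w_inv z) / \<psi> (w_inv z) * exp (U (w_inv z))"
proof -
  let ?f = "\<lambda>z. exp (U (w_inv z))"
  have mem: "w_inv z \<in> wedge 0" "w_inv z \<in> wedge A" "d + w (w_inv z) = z" if "z \<in> G R" for z
    using w_inv_in[of R z] that A R norm_gt_imp_wedge[of "w_inv z" 0 A] by auto
  have inv: "DERIV w_inv z :> 1 / \<psi> (w_inv z)" if "z \<in> G R" for z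
  proof -
    have "z - d = w (w_inv z)" using mem(3)[OF that] by (simp add: algebra_simps)
    then show ?thesis using w_inv_deriv[OF that] by (simp add: \<psi>_def)
  qed
  define v where "v z = u (w_inv z) / \<psi> (w_inv z)" for z
  have f': "DERIV ?f z :> v z * ?f z" if z: "z \<in> G R" for z
    using DERIV_chain2[OF DERIV_exp DERIV_chain2[OF U[OF mem(2)[OF z]] inv[OF z]]]
    by (simp add: v_def mult.commute)
  have deriv_f: "deriv ?f z = v z * ?f z" if "z \<in> G R" for z
    using f'[OF that] by (rule DERIV_imp_deriv)
  then show "\<And>z. z \<in> G R \<Longrightarrow> deriv ?f z = u (w_inv z) / \<psi> (w_inv z) * ?f z" by (simp add: v_def)
  have hol: "?f holomorphic_on G R"
    using f' by (auto simp: holomorphic_on_open[OF open_G])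
  have "deriv (deriv ?f) z - poly (pderiv P) z / poly P z * deriv ?f z + poly Q z / poly P z * ?f z = 0"
    if z: "z \<in> G R" for z
  proof -
    define \<zeta> where "\<zeta> = w_inv z"
    have \<zeta>: "\<zeta> \<in> wedge 0" "\<zeta> \<in> wedge A" "d + w \<zeta> = z" using mem[OF z] by (auto simp: \<zeta>_def)
    note nz = \<psi>_nonzero[OF \<zeta>(1)]
    define u' where "u' = acoef \<zeta> * u \<zeta> - (1 + Vcoef \<zeta>) - (u \<zeta>)\<^sup>2"
    have "DERIV (\<lambda>\<zeta>. u \<zeta> / \<psi> \<zeta>) \<zeta> :> (u' * \<psi> \<zeta> - u \<zeta> * (\<psi> \<zeta> * ((of_real \<alpha> - 1) / \<zeta>))) / (\<psi> \<zeta> * \<psi> \<zeta>)"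
      unfolding u'_def by (rule DERIV_divide[OF u[OF \<zeta>(2)] \<psi>_deriv[OF \<zeta>(1)] nz])
    then have "DERIV v z :> (u' * \<psi> \<zeta> - u \<zeta> * (\<psi> \<zeta> * ((of_real \<alpha> - 1) / \<zeta>))) / (\<psi> \<zeta> * \<psi> \<zeta>) * (1 / \<psi> \<zeta>)"
      unfolding v_def \<zeta>_def by (rule DERIV_chain2[OF _ inv[OF z]])
    moreover have "(u' * y - u \<zeta> * (y * x)) / (y * y) * (1 / y) = (u' - u \<zeta> * x) / y\<^sup>2" if "y \<noteq> 0" for x y
      using that by (simp add: field_simps power2_eq_square)
    ultimately have v': "DERIV v z :> (u' - u \<zeta> * ((of_real \<alpha> - 1) / \<zeta>)) / (\<psi> \<zeta>)\<^sup>2"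
      using nz by metis
    have "DERIV (\<lambda>z. v z * ?f z) z :> (u' - u \<zeta> * ((of_real \<alpha> - 1) / \<zeta>)) / (\<psi> \<zeta>)\<^sup>2 * ?f z + v z * ?f z * v z"
      by (rule DERIV_mult[OF v' f'[OF z]])
    then have "DERIV (deriv ?f) z :> (u' - u \<zeta> * ((of_real \<alpha> - 1) / \<zeta>)) / (\<psi> \<zeta>)\<^sup>2 * ?f z + v z * ?f z * v z"
      by (rule has_field_derivative_transform_within_open[OF _ open_G z]) (simp add: deriv_f)
    then have ff: "deriv (deriv ?f) z = (u' - u \<zeta> * ((of_real \<alpha> - 1) / \<zeta>)) / (\<psi> \<zeta>)\<^sup>2 * ?f z + v z * ?f z * v z"
      by (rule DERIV_imp_deriv)
    have "poly (pderiv P) z / poly P z = (acoef \<zeta> - (of_real \<alpha> - 1) / \<zeta>) / \<psi> \<zeta>"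
      using acoef_eq[OF \<zeta>(1) F[OF \<zeta>(2)]] nz unfolding \<zeta>(3) by simp
    moreover have "poly Q z / poly P z = (1 + Vcoef \<zeta>) / (\<psi> \<zeta>)\<^sup>2"
      using Vcoef_eq[OF \<zeta>(1) F[OF \<zeta>(2)]] nz unfolding \<zeta>(3) by simp
    moreover have "v z = u \<zeta> / \<psi> \<zeta>" by (simp add: v_def \<zeta>_def)
    \<comment> \<open>The identity also holds for y = 0, where all quotients are 0, so it can be
      used by rewriting without a side condition.\<close>
    moreover have "(a' * x - V' - x\<^sup>2 - x * c') / y\<^sup>2 * e + x / y * e * (x / y)
        - (a' - c') / y * (x / y * e) + V' / y\<^sup>2 * e = 0" for x y c' a' V' e :: complex
      by (cases "y = 0") (simp_all add: field_simps power2_eq_square)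
    ultimately show ?thesis unfolding ff deriv_f[OF z] u'_def by (simp only:)
  qed
  then show "analytic_solution P Q (G R) ?f" using hol by (simp add: analytic_solution_def)
qed

end

section \<open>Asymptotics of the fundamental pair\<close>

lemma norm_cis_diff_le: "norm (cis x - cis y) \<le> \<bar>x - y\<bar>"
proof -
  have "cis x - cis y = cis y * (cis (x - y) - 1)"
    by (simp add: algebra_simps cis_mult)
  then have "norm (cis x - cis y) = norm (cis (x - y) - 1)" by (simp add: norm_mult)
  also have "\<dots> = 2 * \<bar>sin ((x - y) / 2)\<bar>"
    unfolding cis_conv_exp by (rule dist_exp_i_1)
  also have "\<dots> \<le> 2 * \<bar>(x - y) / 2\<bar>"
    by (intro mult_left_mono abs_sin_x_le_abs_x) auto
  finally show ?thesis by simp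
qed

text \<open>From |arctan x| \<le> |x| and |z| \<le> 2 Re z. This converts bounds on Im \<zeta> at
  the zeros into bounds on the angle.\<close>

lemma abs_Arg_wedge_le:
  assumes "z \<in> wedge 0"
  shows "\<bar>Arg z\<bar> \<le> 2 * \<bar>Im z\<bar> / norm z"
proof -
  have pos: "0 < Re z" "norm z \<le> 2 * Re z" "0 < norm z"
    by (rule wedge_norm[OF assms])+
  have "\<bar>Arg z\<bar> \<le> \<bar>Im z / Re z\<bar>"
    unfolding arg_conv_arctan[OF pos(1)] by (rule abs_arctan_le)
  also have "\<dots> = 2 * \<bar>Im z\<bar> / (2 * Re z)" using pos(1) by (simp add: abs_divide)
  also have "\<dots> \<le> 2 * \<bar>Im z\<bar> / norm z"
    by (intro divide_left_mono mult_pos_pos pos) (use pos(1) in simp_all)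
  finally show ?thesis .
qed

context stokes_problem
begin

text \<open>A primitive of \<rho> / K. The exponent 2 \<alpha> equals 1 exactly for N = 2, whence
  the logarithm there; the logarithm for N = 0 integrates the term with \<open>e0\<close>, which
  vanishes for all other N.\<close>

definition pint :: "real \<Rightarrow> real" where
  "pint s = (if N = 0 then e0 * ln s - 1 / s
             else if N = 2 then ln s else s powr (1 - 2 * \<alpha>) / (1 - 2 * \<alpha>))"

lemma \<alpha>_cases: "N = 0 \<Longrightarrow> \<alpha> = 1" "N = 1 \<Longrightarrow> \<alpha> = 2 / 3" "N = 2 \<Longrightarrow> \<alpha> = 1 / 2" "3 \<le> N \<Longrightarrow> \<alpha> < 1 / 2"
  "N \<noteq> 2 \<Longrightarrow> 1 - 2 * \<alpha> \<noteq> 0"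
  by (auto simp: \<alpha>_def field_simps)

lemma pint_deriv:
  assumes s: "0 < s"
  shows "((\<lambda>s. 2 * K * pint s) has_real_derivative 2 * \<rho> K s) (at s)"
proof -
  have "(pint has_real_derivative e0 * s powr (- \<alpha>) + s powr (- 2 * \<alpha>)) (at s)"
  proof -
    consider "N = 0" | "N = 2" | "N \<noteq> 0" "N \<noteq> 2" by blast
    then show ?thesis
    proof cases
      case 1
      have "pint = (\<lambda>s. e0 * ln s - 1 / s)" unfolding pint_def using 1 by (simp only: if_True simp_thms)
      moreover have "((\<lambda>s. e0 * ln s - 1 / s) has_real_derivative e0 * s powr (- 1) + s powr (- 2)) (at s)"
        using s by (auto intro!: derivative_eq_intros simp: powr_minus powr_realpow power2_eq_square field_simps)
      ultimately show ?thesis by (simp only: \<alpha>_cases(1)[OF 1]) simp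
    next
      case 2
      have "pint = (\<lambda>s. ln s)" "e0 = 0" unfolding pint_def e0_def using 2 by auto
      then show ?thesis
        using s by (auto intro!: derivative_eq_intros simp: \<alpha>_cases(3)[OF 2] powr_minus field_simps)
    next
      case 3
      have "pint = (\<lambda>s. s powr (1 - 2 * \<alpha>) / (1 - 2 * \<alpha>))" "e0 = 0" unfolding pint_def e0_def using 3 by auto
      moreover have "((\<lambda>s. s powr (1 - 2 * \<alpha>) / (1 - 2 * \<alpha>)) has_real_derivative
          (1 - 2 * \<alpha>) * s powr (1 - 2 * \<alpha> - 1) / (1 - 2 * \<alpha>)) (at s)"
        using s by (intro DERIV_cdivide has_real_derivative_powr)
      ultimately show ?thesis using \<alpha>_cases(5)[OF 3(2)] by simp
    qed
  qed
  from DERIV_cmult[OF this, of "2 * K"] show ?thesis by (simp add: \<rho>_def mult.assoc)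
qed

text \<open>The angle of \<zeta> at a zero is bounded by a multiple of (1 + \<open>pint\<close> s) /
  s with s = |\<zeta>|; at r = \<kappa> s^\<alpha> this reproduces the four cases of the width. For
  N \<ge> 3 the power s^(-2 \<alpha>), of order r^(-2), dominates. For N = 1 \<open>pint\<close>
  tends to 0 and the constant wins: 1 / s is of order r^(-3/2). For N = 2, and for N = 0 with D
  \<noteq> 0, the logarithm stays.\<close>

lemma pint_bigo:
  shows "(\<lambda>s. 1 / s) \<in> O(\<lambda>s. loc_width N D (\<kappa> * s powr \<alpha>))"
    and "(\<lambda>s. pint s / s) \<in> O(\<lambda>s. loc_width N D (\<kappa> * s powr \<alpha>))"
    and "eventually (\<lambda>s. 0 < loc_width N D (\<kappa> * s powr \<alpha>)) at_top"
proof -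
  note \<kappa> = \<kappa>_pos
  have "(\<lambda>s. 1 / s) \<in> O(\<lambda>s. loc_width N D (\<kappa> * s powr \<alpha>)) \<and>
        (\<lambda>s. pint s / s) \<in> O(\<lambda>s. loc_width N D (\<kappa> * s powr \<alpha>)) \<and>
        eventually (\<lambda>s. 0 < loc_width N D (\<kappa> * s powr \<alpha>)) at_top"
  proof -
    \<comment> \<open>For N = 0 the dominant term is the logarithm or the constant according to
      whether D vanishes, so the two growth comparisons differ.\<close>
    consider "N = 0" "D = 0" | "N = 0" "D \<noteq> 0" | "N = 1" | "N = 2" | "3 \<le> N" by linarith
    then show ?thesis
    proof cases
      case 1
      have "pint = (\<lambda>s. - 1 / s)" "loc_width N D = (\<lambda>r. 1 / r)"
        unfolding pint_def e0_def loc_width_def using 1 by simp_all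
      then show ?thesis
        using \<kappa> by (simp only: \<alpha>_cases(1)[OF 1(1)]) (intro conjI; real_asymp)
    next
      case 2
      have D: "0 < norm D" using 2 by simp
      have "pint = (\<lambda>s. norm D * ln s - 1 / s)" "loc_width N D = (\<lambda>r. (1 + norm D * ln r) / r)"
        unfolding pint_def e0_def loc_width_def using 2 by simp_all
      then show ?thesis
        using \<kappa> D by (simp only: \<alpha>_cases(1)[OF 2(1)]) (intro conjI; real_asymp)
    next
      case 3
      have "pint = (\<lambda>s. s powr (1 - 2 * \<alpha>) / (1 - 2 * \<alpha>))" "loc_width N D = (\<lambda>r. r powr (- 3 / 2))"
        unfolding pint_def loc_width_def using 3 by auto
      then show ?thesis
        using \<kappa> by (simp only: \<alpha>_cases(2)[OF 3]) (intro conjI; real_asymp)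
    next
      case 4
      have "pint = (\<lambda>s. ln s)" "loc_width N D = (\<lambda>r. ln r / r ^ 2)"
        unfolding pint_def loc_width_def using 4 by auto
      then show ?thesis
        using \<kappa> by (simp only: \<alpha>_cases(3)[OF 4]) (intro conjI; real_asymp)
    next
      case 5
      have "pint = (\<lambda>s. s powr (1 - 2 * \<alpha>) / (1 - 2 * \<alpha>))" "loc_width N D = (\<lambda>r. 1 / r ^ 2)"
        unfolding pint_def loc_width_def using 5 by auto
      then show ?thesis
        using \<kappa> \<alpha>_bounds(1) \<alpha>_cases(4)[OF 5] by (simp only:) (intro conjI; real_asymp)
    qed
  qed
  then show "(\<lambda>s. 1 / s) \<in> O(\<lambda>s. loc_width N D (\<kappa> * s powr \<alpha>))"
    "(\<lambda>s. pint s / s) \<in> O(\<lambda>s. loc_width N D (\<kappa> * s powr \<alpha>))"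
    "eventually (\<lambda>s. 0 < loc_width N D (\<kappa> * s powr \<alpha>)) at_top" by blast+
qed

lemma loc_width_dominates:
  obtains s0 M where "0 < M"
    "\<And>s. s0 \<le> s \<Longrightarrow> 2 * (C + 2 * K * pint s) / s < M * loc_width N D (\<kappa> * s powr \<alpha>)"
proof -
  have cmult: "(\<lambda>s. k * f s) \<in> O(h)" if "f \<in> O(h)" for k and f h :: "real \<Rightarrow> real"
    using that by (cases "k = 0") simp_all
  have "(\<lambda>s. (2 * C) * (1 / s) + (4 * K) * (pint s / s)) \<in> O(\<lambda>s. loc_width N D (\<kappa> * s powr \<alpha>))"
    by (intro sum_in_bigo cmult pint_bigo(1,2))
  then obtain c where c: "0 < c" "eventually (\<lambda>s. norm ((2 * C) * (1 / s) + (4 * K) * (pint s / s))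
      \<le> c * norm (loc_width N D (\<kappa> * s powr \<alpha>))) at_top"
    by (elim landau_o.bigE)
  have "eventually (\<lambda>s. 2 * (C + 2 * K * pint s) / s < (c + 1) * loc_width N D (\<kappa> * s powr \<alpha>)) at_top"
    using c(2) pint_bigo(3)
  proof eventually_elim
    case (elim s)
    have "2 * (C + 2 * K * pint s) / s = (2 * C) * (1 / s) + (4 * K) * (pint s / s)"
      by (simp add: add_divide_distrib distrib_left)
    also have "\<dots> \<le> c * loc_width N D (\<kappa> * s powr \<alpha>)" using elim by simp
    also have "\<dots> < (c + 1) * loc_width N D (\<kappa> * s powr \<alpha>)" using elim by (simp add: distrib_right)
    finally show ?case .
  qed
  then obtain s0 where "\<And>s. s0 \<le> s \<Longrightarrow> 2 * (C + 2 * K * pint s) / s < (c + 1) * loc_width N D (\<kappa> * s powr \<alpha>)"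
    unfolding eventually_at_top_linorder by blast
  then show ?thesis using that[of "c + 1" s0] c(1) by simp
qed

text \<open>
  Replacing the branch \<open>L\<close> by \<open>L + 2 \<pi> i\<close> changes the sign of \<open>(z - d)\<close> to the power \<open>(N + 2) / 2\<close> if \<open>N\<close> is odd.
  So \<open>L\<close> and \<open>k\<close> decide which of the two solutions is \<open>gp\<close>.
\<close>

lemma obtain_sign:
  obtains \<tau> :: real where "\<bar>\<tau>\<bar> = 1"
    "\<And>\<zeta>. \<zeta> \<in> wedge 0 \<Longrightarrow> of_real \<alpha> * sb * branch_powr L ((real N + 2) / 2) (d + w \<zeta>) = of_real \<tau> * \<zeta>"
    "\<And>\<zeta>. \<zeta> \<in> wedge 0 \<Longrightarrow> sb * branch_powr L (real N / 2) (d + w \<zeta>) = of_real \<tau> / \<psi> \<zeta>"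
proof -
  \<comment> \<open>The leading exponent without its factor \<plusminus> i, taken at \<zeta> = 1;
    its square is 1 by the normalization of the chart, so it is the sign in question.\<close>
  define T where "T = of_real \<alpha> * sb * exp (of_real ((real N + 2) / 2) * \<eta>)"
  have "T\<^sup>2 = of_real (\<alpha>\<^sup>2) * b * exp \<eta> ^ (N + 2)"
  proof -
    have "exp (of_real ((real N + 2) / 2) * \<eta>) ^ 2 = exp \<eta> ^ (N + 2)"
    proof -
      have "of_nat 2 * (of_real ((real N + 2) / 2) * \<eta>) = of_nat (N + 2) * \<eta>"
        by (simp add: field_simps)
      then show ?thesis unfolding exp_of_nat_mult[symmetric] by (simp only:)
    qed
    then show ?thesis unfolding T_def power_mult_distrib sb_square by simp
  qed
  then have "T\<^sup>2 = 1" by (simp only: b_exp_\<eta>)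
  then have T: "T = 1 \<or> T = - 1" by (simp add: power2_eq_1_iff)
  define \<tau> :: real where "\<tau> = (if T = 1 then 1 else - 1)"
  have \<tau>: "\<bar>\<tau>\<bar> = 1" "of_real \<tau> = T" using T by (auto simp: \<tau>_def)
  have 1: "of_real \<alpha> * sb * branch_powr L ((real N + 2) / 2) (d + w \<zeta>) = of_real \<tau> * \<zeta>" if \<zeta>: "\<zeta> \<in> wedge 0" for \<zeta>
  proof -
    have "(real N + 2) / 2 * \<alpha> = 1" using \<alpha>_N by (simp add: field_simps)
    then have e: "of_real ((real N + 2) / 2) * (of_real \<alpha> * Ln \<zeta>) = Ln \<zeta>"
      by (metis mult.assoc mult_1 of_real_1 of_real_mult)
    show ?thesis
      unfolding branch_powr_def L_w[OF \<zeta>] distrib_left exp_add e \<tau>(2) T_def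
      using wedge_norm(5)[OF \<zeta>] by simp
  qed
  have 2: "sb * branch_powr L (real N / 2) (d + w \<zeta>) = of_real \<tau> / \<psi> \<zeta>" if \<zeta>: "\<zeta> \<in> wedge 0" for \<zeta>
  proof -
    have "branch_powr L ((real N + 2) / 2) (d + w \<zeta>) = branch_powr L (real N / 2) (d + w \<zeta>) * w \<zeta>"
      unfolding branch_powr_def L_w[OF \<zeta>] by (simp add: w_def exp_add[symmetric] field_simps)
    then have "of_real \<tau> * \<zeta> = (sb * branch_powr L (real N / 2) (d + w \<zeta>)) * (of_real \<alpha> * w \<zeta>)"
      using 1[OF \<zeta>] by (simp add: mult_ac)
    then show ?thesis
      using wedge_norm(5)[OF \<zeta>] \<alpha>_bounds by (simp add: \<psi>_def field_simps)
  qed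
  show ?thesis by (rule that[OF \<tau>(1) 1 2])
qed

lemma eventually_at_infinity_G: "(\<And>z. z \<in> G R \<Longrightarrow> P' z) \<Longrightarrow> eventually P' (inf at_infinity (principal (G R)))"
  by (simp add: eventually_inf_principal)

lemma wedge_solutions_exist:
  obtains B K n U where "1 \<le> B" "0 \<le> K" "riccati_pair B acoef Vcoef n U"
    "\<And>\<zeta>. \<zeta> \<in> wedge B \<Longrightarrow> 0 < Re (FP (1 / w \<zeta>))"
    "\<And>\<zeta>. \<zeta> \<in> wedge B \<Longrightarrow> norm (acoef \<zeta>) \<le> K / norm \<zeta>"
    "\<And>\<sigma> \<zeta>. \<bar>\<sigma>\<bar> = 1 \<Longrightarrow> \<zeta> \<in> wedge B \<Longrightarrow> norm (n \<sigma> \<zeta>) \<le> 2 * \<rho> K (norm \<zeta>)"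
proof -
  obtain A K a' where A: "1 \<le> A" "0 \<le> K"
    and F: "\<And>\<zeta>. \<zeta> \<in> wedge A \<Longrightarrow> 0 < Re (FP (1 / w \<zeta>))"
    and a': "\<And>\<zeta>. \<zeta> \<in> wedge A \<Longrightarrow> DERIV acoef \<zeta> :> a' \<zeta>"
    and hol: "a' holomorphic_on wedge A" "Vcoef holomorphic_on wedge A"
    and a_le: "\<And>\<zeta>. \<zeta> \<in> wedge A \<Longrightarrow> norm (acoef \<zeta>) \<le> K / norm \<zeta>"
    and W: "\<And>\<zeta>. \<zeta> \<in> wedge A \<Longrightarrow> norm (Vcoef \<zeta> + a' \<zeta> / 2 - (acoef \<zeta>)\<^sup>2 / 4) \<le> \<rho> K (norm \<zeta>)"
    by (rule coefficients_on_wedge) blast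
  have anti: "\<rho> K y \<le> \<rho> K x" if "A < x" "x \<le> y" for x y
    using that A by (intro \<rho>_antimono) auto
  obtain B n U where B: "A \<le> B" "riccati_pair B acoef Vcoef n U"
    "\<And>\<sigma> z. \<bar>\<sigma>\<bar> = 1 \<Longrightarrow> z \<in> wedge B \<Longrightarrow> norm (n \<sigma> z) \<le> 2 * \<rho> K (norm z)"
    by (rule riccati_pair_exists[where \<rho> = "\<rho> K", OF a' hol W anti \<rho>_lim]) blast+
  have sub: "wedge B \<subseteq> wedge A" by (rule wedge_mono[OF B(1)])
  show ?thesis
    by (rule that[of B K n U]) (use A B F a_le sub in auto)
qed

end

section \<open>The two exponential solutions in the Stokes sector\<close>

locale stokes_solutions = stokes_problem +
  fixes B K :: real and n U :: "real \<Rightarrow> complex \<Rightarrow> complex"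
  assumes B: "1 \<le> B" and K: "0 \<le> K" and rp: "riccati_pair B acoef Vcoef n U"
    and F: "\<And>\<zeta>. \<zeta> \<in> wedge B \<Longrightarrow> 0 < Re (FP (1 / w \<zeta>))"
    and a_le: "\<And>\<zeta>. \<zeta> \<in> wedge B \<Longrightarrow> norm (acoef \<zeta>) \<le> K / norm \<zeta>"
    and n_le: "\<And>\<sigma> \<zeta>. \<bar>\<sigma>\<bar> = 1 \<Longrightarrow> \<zeta> \<in> wedge B \<Longrightarrow> norm (n \<sigma> \<zeta>) \<le> 2 * \<rho> K (norm \<zeta>)"
begin

definition u :: "real \<Rightarrow> complex \<Rightarrow> complex" where
  "u \<sigma> z = of_real \<sigma> * \<i> + acoef z / 2 + n \<sigma> z"

sublocale rp: riccati_pair B acoef Vcoef n U u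
  by (fact rp, rule eq_reflection, rule u_def)

lemma FP_nonzero: "\<zeta> \<in> wedge B \<Longrightarrow> FP (1 / w \<zeta>) \<noteq> 0"
  using F by force

lemma wedge_B: "\<zeta> \<in> wedge B \<Longrightarrow> \<zeta> \<in> wedge 0"
  using B wedge_mono[of 0 B] by auto

lemma w_inv_wedge:
  assumes "2 * B \<le> R" "z \<in> G R"
  shows "w_inv z \<in> wedge 0" "w_inv z \<in> wedge B" "d + w (w_inv z) = z"
  using w_inv_in[of R z] assms B norm_gt_imp_wedge[of "w_inv z" 0 B] by auto

lemmas pushforward_exp = pushforward[OF rp.U_deriv rp.u_deriv FP_nonzero]

text \<open>e collects whatever remains of U after the prescribed power and the leading exponential
  are split off, divided by that leading exponent. The remainder has a derivative tending to 0, so e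
  = o(1), and the factor 1 + O(1/(z - d)) of the solution itself is exactly 1. For the derivative
  that factor is genuine: it is the deviation of G'/G from \<plusminus> i.\<close>

lemma solution_asymptotics_exp:
  assumes R: "2 * B \<le> R" and \<tau>: "\<bar>\<tau>\<bar> = 1"
      "\<And>\<zeta>. \<zeta> \<in> wedge 0 \<Longrightarrow> of_real \<alpha> * sb * branch_powr L ((real N + 2) / 2) (d + w \<zeta>) = of_real \<tau> * \<zeta>"
      "\<And>\<zeta>. \<zeta> \<in> wedge 0 \<Longrightarrow> sb * branch_powr L (real N / 2) (d + w \<zeta>) = of_real \<tau> / \<psi> \<zeta>"
    and \<sigma>: "\<bar>\<sigma>\<bar> = 1"
  shows "solution_asymptotics p q sb d L (G R) (of_real \<sigma>) (\<lambda>z. exp (U (\<sigma> * \<tau>) (w_inv z)))"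
proof -
  define s where "s = (3 * real p - real q) / 4"
  define \<sigma>' where "\<sigma>' = \<sigma> * \<tau>"
  have \<sigma>': "\<bar>\<sigma>'\<bar> = 1" using \<sigma> \<tau>(1) by (simp add: \<sigma>'_def abs_mult)
  then have \<sigma>'0: "\<sigma>' \<noteq> 0" by auto
  have R0: "0 \<le> R" using B R by simp
  note mem = w_inv_wedge[OF R]
  define f where "f \<zeta> = U \<sigma>' \<zeta> - of_real s * (\<eta> + of_real \<alpha> * Ln \<zeta>) - of_real \<sigma>' * \<i> * \<zeta>" for \<zeta>
  define e where "e \<zeta> = f \<zeta> / (of_real \<sigma>' * \<i> * \<zeta>)" for \<zeta>
  define h where "h \<zeta> = (acoef \<zeta> / 2 + n \<sigma>' \<zeta>) / (of_real \<sigma>' * \<i>)" for \<zeta>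
  have inv0: "((\<lambda>\<zeta>. c / \<zeta>) \<longlongrightarrow> 0) wedge_at_top" for c :: complex
    unfolding wedge_at_top_def by (rule tendsto_mono[OF inf_le1 tendsto_divide_0[OF tendsto_const filterlim_ident]])
  have a0: "(acoef \<longlongrightarrow> 0) wedge_at_top"
  proof (rule Lim_null_comparison)
    show "eventually (\<lambda>\<zeta>. norm (acoef \<zeta>) \<le> norm (of_real K / \<zeta>)) wedge_at_top"
      by (rule eventually_wedge_at_topI[of B]) (use a_le K in \<open>simp add: norm_divide\<close>)
    show "((\<lambda>\<zeta>. norm (of_real K / \<zeta>)) \<longlongrightarrow> 0) wedge_at_top"
      by (rule tendsto_norm_zero[OF inv0])
  qed
  have "((\<lambda>\<zeta>. f \<zeta> / \<zeta>) \<longlongrightarrow> 0) wedge_at_top"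
  proof (rule sublinear_if_deriv_tendsto_0)
    fix \<zeta> assume \<zeta>: "\<zeta> \<in> wedge B"
    note Ln = wedge_Ln_deriv[OF wedge_B[OF \<zeta>]]
    have "DERIV f \<zeta> :> u \<sigma>' \<zeta>
        - of_real s * (0 + of_real \<alpha> * (1 / \<zeta>)) - of_real \<sigma>' * \<i> * 1"
      unfolding f_def
      by (intro DERIV_diff DERIV_cmult DERIV_add DERIV_const DERIV_ident Ln rp.U_deriv[OF \<sigma>' \<zeta>])
    then show "DERIV f \<zeta> :> acoef \<zeta> / 2 + n \<sigma>' \<zeta> - of_real (s * \<alpha>) / \<zeta>"
      by (simp add: u_def algebra_simps)
  next
    have "((\<lambda>\<zeta>. acoef \<zeta> / 2 + n \<sigma>' \<zeta> - of_real (s * \<alpha>) / \<zeta>) \<longlongrightarrow> 0 / 2 + 0 - 0) wedge_at_top"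
      by (intro tendsto_intros a0 rp.n_lim \<sigma>' inv0) auto
    then show "((\<lambda>\<zeta>. acoef \<zeta> / 2 + n \<sigma>' \<zeta> - of_real (s * \<alpha>) / \<zeta>) \<longlongrightarrow> 0) wedge_at_top" by simp
  qed
  from tendsto_divide[OF this tendsto_const[of "of_real \<sigma>' * \<i>"]]
  have e0': "(e \<longlongrightarrow> 0) wedge_at_top" using \<sigma>'0 by (simp add: e_def[abs_def] mult.commute)
  have e_o: "(\<lambda>z. e (w_inv z)) \<in> o[inf at_infinity (principal (G R))](\<lambda>_. 1)"
    using filterlim_compose[OF e0' filterlim_w_inv[OF R0]] by (intro smalloI_tendsto) simp_all
  have h_O: "(\<lambda>z. h (w_inv z)) \<in> O[inf at_infinity (principal (G R))](\<lambda>z. 1 / (z - d))"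
  proof (rule bigoI[where c = "\<kappa> * (K / 2 + 2 * K * (e0 + 1))"], rule eventually_at_infinity_G)
    fix z assume z: "z \<in> G R"
    define \<zeta> where "\<zeta> = w_inv z"
    have \<zeta>: "\<zeta> \<in> wedge 0" "\<zeta> \<in> wedge B" "z - d = w \<zeta>"
      using mem[OF z] by (auto simp: \<zeta>_def algebra_simps)
    define t where "t = norm \<zeta>"
    have t: "1 < t" using wedge_norm(4)[OF \<zeta>(2)] B by (simp add: t_def)
    have p1: "1 / t \<le> t powr (- \<alpha>)"
      using powr_mono[of "- 1" "- \<alpha>" t] t \<alpha>_bounds by (simp add: powr_minus inverse_eq_divide)
    have p2: "t powr (- 2 * \<alpha>) \<le> t powr (- \<alpha>)"
      using t \<alpha>_bounds by (intro powr_mono) auto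
    have "norm (h \<zeta>) = norm (acoef \<zeta> / 2 + n \<sigma>' \<zeta>)" using \<sigma>' by (simp add: h_def norm_divide norm_mult)
    also have "\<dots> \<le> norm (acoef \<zeta>) / 2 + norm (n \<sigma>' \<zeta>)"
      using norm_triangle_ineq[of "acoef \<zeta> / 2" "n \<sigma>' \<zeta>"] by (simp add: norm_divide)
    also have "\<dots> \<le> K / t / 2 + 2 * \<rho> K t"
      unfolding t_def by (intro add_mono divide_right_mono a_le n_le \<sigma>' \<zeta>) auto
    also have "\<dots> = K / 2 * (1 / t) + 2 * K * (e0 * t powr (- \<alpha>) + t powr (- 2 * \<alpha>))"
      by (simp add: \<rho>_def)
    also have "\<dots> \<le> K / 2 * t powr (- \<alpha>) + 2 * K * (e0 * t powr (- \<alpha>) + t powr (- \<alpha>))"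
      using p1 p2 K e0_nonneg by (intro add_mono mult_left_mono) auto
    also have "\<dots> = \<kappa> * (K / 2 + 2 * K * (e0 + 1)) * norm (1 / (z - d))"
      unfolding \<zeta>(3) norm_divide norm_w[OF \<zeta>(1)] t_def[symmetric]
      using \<kappa>_pos t by (simp add: powr_minus field_simps)
    finally show "norm (h (w_inv z)) \<le> \<kappa> * (K / 2 + 2 * K * (e0 + 1)) * norm (1 / (z - d))"
      by (simp add: \<zeta>_def)
  qed
  have expU: "exp (U \<sigma>' (w_inv z)) = branch_powr L s z * exp_factor N sb L (of_real \<sigma>) (\<lambda>z. e (w_inv z)) z * (1 + 0)"
    if z: "z \<in> G R" for z
  proof -
    define \<zeta> where "\<zeta> = w_inv z"
    have \<zeta>: "\<zeta> \<in> wedge 0" "z = d + w \<zeta>" using mem[OF z] by (auto simp: \<zeta>_def)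
    have \<zeta>0: "\<zeta> \<noteq> 0" using wedge_norm(5)[OF \<zeta>(1)] .
    have "of_real \<sigma> * 2 * \<i> * sb / of_nat (N + 2) * branch_powr L ((real N + 2) / 2) z
        = of_real \<sigma> * \<i> * (of_real \<alpha> * sb * branch_powr L ((real N + 2) / 2) z)"
      by (simp add: \<alpha>_def field_simps)
    also have "\<dots> = of_real \<sigma>' * \<i> * \<zeta>" unfolding \<zeta>(2) \<tau>(2)[OF \<zeta>(1)] by (simp add: \<sigma>'_def)
    finally have "exp_factor N sb L (of_real \<sigma>) (\<lambda>z. e (w_inv z)) z = exp (of_real \<sigma>' * \<i> * \<zeta> * (1 + e \<zeta>))"
      by (simp add: exp_factor_def \<zeta>_def)
    also have "of_real \<sigma>' * \<i> * \<zeta> * (1 + e \<zeta>) = of_real \<sigma>' * \<i> * \<zeta> + f \<zeta>"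
      using \<sigma>'0 \<zeta>0 by (simp add: e_def distrib_left)
    also have "\<dots> = U \<sigma>' \<zeta> - of_real s * L z" unfolding \<zeta>(2) L_w[OF \<zeta>(1)] by (simp add: f_def)
    finally show ?thesis by (simp add: branch_powr_def exp_diff \<zeta>_def)
  qed
  have derivU: "deriv (\<lambda>z. exp (U \<sigma>' (w_inv z))) z = of_real \<sigma> * \<i> * sb * branch_powr L ((real p + real q) / 4) z
      * exp_factor N sb L (of_real \<sigma>) (\<lambda>z. e (w_inv z)) z * (1 + h (w_inv z))" if z: "z \<in> G R" for z
  proof -
    define \<zeta> where "\<zeta> = w_inv z"
    have \<zeta>: "\<zeta> \<in> wedge 0" "z = d + w \<zeta>" using mem[OF z] by (auto simp: \<zeta>_def)
    have "real N = real q - real p" using N pq by simp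
    \<comment> \<open>The additional power (z - d)^(N/2) comes from 1 / \<psi>, the factor that
      turns a derivative in \<zeta> into one in z.\<close>
    then have sN: "(real p + real q) / 4 = s + real N / 2" by (simp add: s_def field_simps)
    then have br: "branch_powr L ((real p + real q) / 4) z = branch_powr L s z * branch_powr L (real N / 2) z"
      by (simp only: branch_powr_def exp_add[symmetric] sN of_real_add distrib_right)
    have "deriv (\<lambda>z. exp (U \<sigma>' (w_inv z))) z = u \<sigma>' \<zeta> / \<psi> \<zeta> * exp (U \<sigma>' (w_inv z))"
      unfolding \<zeta>_def by (rule pushforward_exp(2)[OF \<sigma>' _ \<sigma>' _ _ _ R z]) (use B in auto)
    also have "u \<sigma>' \<zeta> = of_real \<sigma>' * \<i> * (1 + h \<zeta>)"
    proof -
      have "of_real \<sigma>' * \<i> * h \<zeta> = acoef \<zeta> / 2 + n \<sigma>' \<zeta>" using \<sigma>'0 by (simp add: h_def)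
      then show ?thesis by (simp only: u_def distrib_left) simp
    qed
    also have "of_real \<sigma>' * \<i> * (1 + h \<zeta>) / \<psi> \<zeta> = of_real \<sigma> * \<i> * (of_real \<tau> / \<psi> \<zeta>) * (1 + h \<zeta>)"
      by (simp add: \<sigma>'_def)
    also have "of_real \<tau> / \<psi> \<zeta> = sb * branch_powr L (real N / 2) z" unfolding \<zeta>(2) \<tau>(3)[OF \<zeta>(1)] ..
    finally show ?thesis unfolding expU[OF z] br by (simp add: \<zeta>_def mult_ac)
  qed
  show ?thesis
    unfolding solution_asymptotics_def Let_def N[symmetric] \<sigma>'_def[symmetric] s_def[symmetric]
    by (rule exI[of _ "\<lambda>z. e (w_inv z)"], rule exI[of _ "\<lambda>z. 0"], rule exI[of _ "\<lambda>z. h (w_inv z)"])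
       (intro conjI e_o h_O eventually_at_infinity_G expU derivU; simp)
qed

end

section \<open>Localization of the zeros\<close>

lemma bigo_tendsto_0:
  fixes f g :: "nat \<Rightarrow> real"
  assumes "f \<in> O(g)" "g \<longlonglongrightarrow> 0"
  shows "f \<longlonglongrightarrow> 0"
proof -
  obtain c where "eventually (\<lambda>n. norm (f n) \<le> c * norm (g n)) sequentially"
    using assms(1) by (elim landau_o.bigE)
  moreover have "(\<lambda>n. c * norm (g n)) \<longlonglongrightarrow> 0"
    by (intro tendsto_mult_right_zero tendsto_norm_zero assms(2))
  ultimately show ?thesis by (rule Lim_null_comparison)
qed

context stokes_problem
begin

text \<open>The stated constant is \<kappa> \<pi>^\<alpha>. Splitting off the positive number \<pi>
  n commutes with the principal logarithm exactly, so the quotient is exp(\<alpha> Ln(t n / (\<pi>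
  n))), whose inner argument tends to 1.\<close>

lemma w_asymptotics:
  assumes t: "\<And>n. t n \<in> wedge 0" and lim: "(\<lambda>n. t n / of_nat n) \<longlonglongrightarrow> of_real pi"
  shows "(\<lambda>n. w (t n)) \<sim>[at_top]
           (\<lambda>n. of_real ((pi ^ 2 * (real N + 2) ^ 2 / (4 * cmod b)) powr (1 / (real N + 2)))
                * cis (- \<beta> / (real N + 2)) * cis (2 * pi * of_int k / (real N + 2))
                * of_real (real n powr (2 / (real N + 2))))"
proof (rule asymp_equivI')
  let ?T = "\<lambda>n. of_real ((pi ^ 2 * (real N + 2) ^ 2 / (4 * cmod b)) powr (1 / (real N + 2)))
                * cis (- \<beta> / (real N + 2)) * cis (2 * pi * of_int k / (real N + 2))
                * of_real (real n powr (2 / (real N + 2))) :: complex"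
  have const: "(pi ^ 2 * (real N + 2) ^ 2 / (4 * cmod b)) powr (1 / (real N + 2)) = \<kappa> * pi powr \<alpha>"
  proof -
    have "pi ^ 2 * (real N + 2) ^ 2 / (4 * cmod b) = (pi / (\<alpha> * sqrt (cmod b)))\<^sup>2"
      by (simp add: \<alpha>_def power_divide power_mult_distrib)
    also have "\<dots> powr (1 / (real N + 2)) = (pi / (\<alpha> * sqrt (cmod b))) powr (2 * (1 / (real N + 2)))"
      using \<alpha>_bounds b_nonzero by (simp add: powr_powr flip: powr_numeral)
    also have "2 * (1 / (real N + 2)) = \<alpha>" by (simp add: \<alpha>_def)
    also have "(pi / (\<alpha> * sqrt (cmod b))) powr \<alpha> = \<kappa> * pi powr \<alpha>"
      using \<alpha>_bounds by (simp add: \<kappa>_def powr_divide)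
    finally show ?thesis .
  qed
  have angle: "cis (- \<beta> / (real N + 2)) * cis (2 * pi * of_int k / (real N + 2)) = cis \<theta>"
  proof -
    have "- \<beta> / (real N + 2) + 2 * pi * of_int k / (real N + 2) = \<theta>"
      unfolding \<theta>_def stokes_angle_def by (simp add: diff_divide_distrib)
    then show ?thesis by (simp only: cis_mult)
  qed
  have T: "?T n = of_real \<kappa> * cis \<theta> * of_real ((pi * real n) powr \<alpha>)" for n
  proof -
    have "(pi * real n) powr \<alpha> = pi powr \<alpha> * real n powr (2 / (real N + 2))"
      by (simp add: powr_mult \<alpha>_def)
    then show ?thesis unfolding const mult.assoc[of _ "cis (- \<beta> / (real N + 2))"] angle by simp
  qed
  have "(\<lambda>n. t n / of_nat n / of_real pi) \<longlonglongrightarrow> of_real pi / of_real pi"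
    by (intro tendsto_intros lim) simp
  then have "(\<lambda>n. t n / of_nat n / of_real pi) \<longlonglongrightarrow> 1" by simp
  then have "(\<lambda>n. exp (of_real \<alpha> * Ln (t n / of_nat n / of_real pi))) \<longlonglongrightarrow> exp (of_real \<alpha> * Ln 1)"
    by (intro tendsto_intros) auto
  then have "(\<lambda>n. exp (of_real \<alpha> * Ln (t n / of_nat n / of_real pi))) \<longlonglongrightarrow> 1" by simp
  moreover have "eventually (\<lambda>n. exp (of_real \<alpha> * Ln (t n / of_nat n / of_real pi)) = w (t n) / ?T n) sequentially"
    using eventually_gt_at_top[of 0]
  proof eventually_elim
    case (elim n)
    have pos: "0 < pi * real n" using elim by simp
    have tn: "t n \<noteq> 0" using wedge_norm(5)[OF t] .
    define y where "y = t n / of_nat n / of_real pi"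
    have ty: "t n = of_real (pi * real n) * y" "y \<noteq> 0" using elim tn by (auto simp: y_def)
    have "Ln (t n) = of_real (ln (pi * real n)) + Ln y"
      unfolding ty(1) by (simp only: Ln_times_of_real[OF pos ty(2)] Ln_of_real[OF pos])
    then have "w (t n) = of_real \<kappa> * cis \<theta> * (exp (of_real (\<alpha> * ln (pi * real n))) * exp (of_real \<alpha> * Ln y))"
      by (simp add: w_polar distrib_left exp_add)
    also have "exp (of_real (\<alpha> * ln (pi * real n))) = (of_real ((pi * real n) powr \<alpha>) :: complex)"
      unfolding exp_of_real using elim by (simp add: powr_def)
    finally show ?case unfolding T y_def[symmetric] using \<kappa>_pos elim by simp
  qed
  ultimately show "(\<lambda>n. w (t n) / ?T n) \<longlonglongrightarrow> 1"
    by (rule Lim_transform_eventually)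
qed

lemma localization:
  assumes t: "\<And>n. t n \<in> wedge 0" "\<And>n. R < norm (t n)" and R: "0 \<le> R"
    and lim: "filterlim t wedge_at_top sequentially"
    and Im: "\<And>n. s1 \<le> norm (t n) \<Longrightarrow> \<bar>Im (t n)\<bar> \<le> C + 2 * K * pint (norm (t n))"
  obtains M where "0 < M"
    "eventually (\<lambda>n. d + w (t n) \<in> loc_region N \<beta> d D k (\<kappa> * R powr \<alpha>) M \<and>
       infdist (d + w (t n)) (stokes_ray N \<beta> d k) \<le> M * (norm (w (t n)) * loc_width N D (norm (w (t n))))) sequentially"
proof -
  obtain s0 M where M: "0 < M"
    "\<And>s. s0 \<le> s \<Longrightarrow> 2 * (C + 2 * K * pint s) / s < M * loc_width N D (\<kappa> * s powr \<alpha>)"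
    by (rule loc_width_dominates) blast
  have "filterlim norm at_top wedge_at_top"
    unfolding wedge_at_top_def
    by (rule filterlim_mono[OF filterlim_norm_at_top]) auto
  from filterlim_compose[OF this lim]
  have "eventually (\<lambda>n. max s0 s1 \<le> norm (t n)) sequentially"
    unfolding filterlim_at_top by blast
  then have "eventually (\<lambda>n. d + w (t n) \<in> loc_region N \<beta> d D k (\<kappa> * R powr \<alpha>) M \<and>
       infdist (d + w (t n)) (stokes_ray N \<beta> d k) \<le> M * (norm (w (t n)) * loc_width N D (norm (w (t n))))) sequentially"
  proof eventually_elim
    case (elim n)
    define \<phi> where "\<phi> = \<theta> + \<alpha> * Arg (t n)"
    have arg: "is_arg_of \<phi> (w (t n))" unfolding \<phi>_def by (rule w_arg[OF t(1)])
    have "\<bar>\<phi> - \<theta>\<bar> = \<alpha> * \<bar>Arg (t n)\<bar>" using \<alpha>_bounds by (simp add: \<phi>_def abs_mult)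
    also have "\<dots> \<le> 1 * (2 * \<bar>Im (t n)\<bar> / norm (t n))"
      using \<alpha>_bounds abs_Arg_wedge_le[OF t(1)] by (intro mult_mono) auto
    also have "\<dots> \<le> 2 * (C + 2 * K * pint (norm (t n))) / norm (t n)"
      using Im[of n] elim by (simp add: divide_right_mono)
    also have "\<dots> < M * loc_width N D (norm (w (t n)))"
      unfolding norm_w[OF t(1)] using elim by (intro M(2)) simp
    finally have less: "\<bar>\<phi> - \<theta>\<bar> < M * loc_width N D (norm (w (t n)))" .
    have big: "\<kappa> * R powr \<alpha> < norm (w (t n))"
      unfolding norm_w[OF t(1)] using \<kappa>_pos \<alpha>_bounds R t(2)[of n]
      by (intro mult_strict_left_mono powr_less_mono2) auto
    have "d + w (t n) \<in> loc_region N \<beta> d D k (\<kappa> * R powr \<alpha>) M"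
      unfolding loc_region_def using arg less big by (auto simp: \<theta>_def)
    moreover have "infdist (d + w (t n)) (stokes_ray N \<beta> d k) \<le> M * (norm (w (t n)) * loc_width N D (norm (w (t n))))"
    proof -
      \<comment> \<open>The comparison point lies on the ray at the same distance from d, so the gap
        is a chord, bounded by radius times angle.\<close>
      define y where "y = d + of_real (norm (w (t n))) * cis \<theta>"
      have "y \<in> stokes_ray N \<beta> d k"
        unfolding stokes_ray_def is_arg_of_def by (simp add: y_def \<theta>_def norm_mult)
      then have "infdist (d + w (t n)) (stokes_ray N \<beta> d k) \<le> dist (d + w (t n)) y" by (rule infdist_le)
      also have "\<dots> = norm (w (t n) - of_real (norm (w (t n))) * cis \<theta>)" by (simp add: dist_norm y_def)
      also have "w (t n) - of_real (norm (w (t n))) * cis \<theta> = of_real (norm (w (t n))) * (cis \<phi> - cis \<theta>)"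
        using arg by (simp add: is_arg_of_def right_diff_distrib)
      also have "norm \<dots> \<le> norm (w (t n)) * \<bar>\<phi> - \<theta>\<bar>"
        by (simp add: norm_mult mult_left_mono norm_cis_diff_le)
      also have "\<dots> \<le> norm (w (t n)) * (M * loc_width N D (norm (w (t n))))"
        using less by (intro mult_left_mono) auto
      finally show ?thesis by (simp add: mult_ac)
    qed
    ultimately show ?case by blast
  qed
  then show ?thesis using that M(1) by blast
qed

text \<open>The distance is at most radius times width, expressed in |z - d|. For large z this
  modulus and |z| differ by at most a factor 2, which costs only constants; for N = 0 they coincide,
  since d = 0.\<close>

lemma distance_rates:
  fixes z :: "nat \<Rightarrow> complex"
  assumes z: "filterlim (\<lambda>n. norm (z n - d)) at_top sequentially" and M: "0 < M"
    and dist: "eventually (\<lambda>n. infdist (z n) (stokes_ray N \<beta> d k)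
       \<le> M * (norm (z n - d) * loc_width N D (norm (z n - d)))) sequentially"
  shows "N \<ge> 3 \<Longrightarrow> (\<lambda>n. infdist (z n) (stokes_ray N \<beta> d k)) \<in> O(\<lambda>n. 1 / cmod (z n))"
    and "N = 2 \<Longrightarrow> (\<lambda>n. infdist (z n) (stokes_ray N \<beta> d k)) \<in> O(\<lambda>n. ln (cmod (z n)) / cmod (z n))"
    and "N = 1 \<Longrightarrow> (\<lambda>n. infdist (z n) (stokes_ray N \<beta> d k)) \<in> O(\<lambda>n. cmod (z n) powr (- 1 / 2))"
    and "N = 0 \<Longrightarrow> (\<lambda>n. infdist (z n) (stokes_ray N \<beta> d k)) \<in> O(\<lambda>n. cmod D * ln (cmod (z n)) + 1)"
    and "N > 0 \<Longrightarrow> (\<lambda>n. infdist (z n) (stokes_ray N \<beta> d k)) \<longlonglongrightarrow> 0"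
proof -
  define x where "x n = norm (z n - d)" for n
  have x: "filterlim x at_top sequentially" using z by (simp add: x_def[abs_def])
  have big: "eventually (\<lambda>n. 2 * norm d + 4 \<le> x n) sequentially"
    using x unfolding filterlim_at_top by blast
  have sz: "x n \<le> 2 * norm (z n) \<and> norm (z n) \<le> 2 * x n \<and> 2 \<le> norm (z n) \<and> 4 \<le> x n" if "2 * norm d + 4 \<le> x n" for n
  proof -
    have "x n \<le> norm (z n) + norm d" "norm (z n) \<le> x n + norm d" "0 \<le> norm d"
      using norm_triangle_ineq4[of "z n" d] norm_triangle_ineq[of "z n - d" d] by (auto simp: x_def)
    then show ?thesis using that by linarith
  qed
  have inv: "1 / x n \<le> 2 * (1 / norm (z n))" if "2 * norm d + 4 \<le> x n" for n
  proof -
    have "1 / x n \<le> 1 / (norm (z n) / 2)"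
      using sz[OF that] by (intro divide_left_mono mult_pos_pos) linarith+
    then show ?thesis by simp
  qed
  have rate: "(\<lambda>n. infdist (z n) (stokes_ray N \<beta> d k)) \<in> O(h)"
    if h: "\<And>n. 2 * norm d + 4 \<le> x n \<Longrightarrow> x n * loc_width N D (x n) \<le> c * h n" for c and h :: "nat \<Rightarrow> real"
  proof (rule bigoI[where c = "M * \<bar>c\<bar>"])
    show "eventually (\<lambda>n. norm (infdist (z n) (stokes_ray N \<beta> d k)) \<le> M * \<bar>c\<bar> * norm (h n)) sequentially"
      using dist big
    proof eventually_elim
      case (elim n)
      have "norm (infdist (z n) (stokes_ray N \<beta> d k)) \<le> M * (x n * loc_width N D (x n))"
        using elim(1) by (simp add: infdist_nonneg x_def)
      also have "\<dots> \<le> M * (c * h n)" using M h[OF elim(2)] by (intro mult_left_mono) auto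
      also have "\<dots> \<le> M * (\<bar>c\<bar> * norm (h n))" using M by (intro mult_left_mono) (simp_all add: flip: abs_mult)
      finally show ?case by (simp add: mult.assoc)
    qed
  qed
  have zt: "filterlim (\<lambda>n. norm (z n)) at_top sequentially"
  proof (rule filterlim_at_top_mono)
    show "filterlim (\<lambda>n. x n / 2) at_top sequentially"
      using filterlim_tendsto_pos_mult_at_top[OF tendsto_const _ x, of "1 / 2"] by simp
    show "eventually (\<lambda>n. x n / 2 \<le> norm (z n)) sequentially"
      using big by eventually_elim (use sz in force)
  qed
  show r3: "(\<lambda>n. infdist (z n) (stokes_ray N \<beta> d k)) \<in> O(\<lambda>n. 1 / cmod (z n))" if "N \<ge> 3"
  proof (rule rate[of 2])
    fix n assume n: "2 * norm d + 4 \<le> x n"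
    note s = sz[OF n]
    have "x n * loc_width N D (x n) = 1 / x n" using that s by (simp add: loc_width_def power2_eq_square)
    also have "\<dots> \<le> 2 * (1 / norm (z n))" by (rule inv[OF n])
    finally show "x n * loc_width N D (x n) \<le> 2 * (1 / norm (z n))" .
  qed
  show r2: "(\<lambda>n. infdist (z n) (stokes_ray N \<beta> d k)) \<in> O(\<lambda>n. ln (cmod (z n)) / cmod (z n))" if "N = 2"
  proof (rule rate[of 4])
    fix n assume n: "2 * norm d + 4 \<le> x n"
    note s = sz[OF n]
    have "x n * loc_width N D (x n) = ln (x n) * (1 / x n)" using that s by (simp add: loc_width_def power2_eq_square)
    also have "\<dots> \<le> (2 * ln (norm (z n))) * (2 * (1 / norm (z n)))"
    proof (intro mult_mono)
      \<comment> \<open>From |z| \<ge> 2 the factor 2 is absorbed into another |z|, so the logarithm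
        at most doubles; the factor 2 lost in 1 / x makes it 4.\<close>
      have "x n \<le> 2 * norm (z n)" using s by simp
      also have "\<dots> \<le> norm (z n) * norm (z n)" using s by (intro mult_right_mono) auto
      finally have "ln (x n) \<le> ln (norm (z n) * norm (z n))" using s by (intro ln_mono) auto
      then show "ln (x n) \<le> 2 * ln (norm (z n))" using s by (auto simp: ln_mult split: if_splits)
      show "1 / x n \<le> 2 * (1 / norm (z n))" by (rule inv[OF n])
    qed (use s in auto)
    finally show "x n * loc_width N D (x n) \<le> 4 * (ln (norm (z n)) / norm (z n))" by simp
  qed
  show r1: "(\<lambda>n. infdist (z n) (stokes_ray N \<beta> d k)) \<in> O(\<lambda>n. cmod (z n) powr (- 1 / 2))" if "N = 1"
  proof (rule rate[of 2])
    fix n assume n: "2 * norm d + 4 \<le> x n"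
    note s = sz[OF n]
    have "x n * loc_width N D (x n) = x n powr 1 * x n powr (- 3 / 2)" using that s by (simp add: loc_width_def)
    also have "\<dots> = x n powr (- 1 / 2)" unfolding powr_add[symmetric] by simp
    also have "\<dots> \<le> (norm (z n) / 2) powr (- 1 / 2)" using s by (intro powr_mono2') auto
    also have "\<dots> = 2 powr (1 / 2) * norm (z n) powr (- 1 / 2)"
      using s by (simp add: powr_divide powr_minus field_simps)
    also have "\<dots> \<le> 2 powr 1 * norm (z n) powr (- 1 / 2)" by (intro mult_right_mono powr_mono) auto
    finally show "x n * loc_width N D (x n) \<le> 2 * norm (z n) powr (- 1 / 2)" by simp
  qed
  show "(\<lambda>n. infdist (z n) (stokes_ray N \<beta> d k)) \<in> O(\<lambda>n. cmod D * ln (cmod (z n)) + 1)" if "N = 0"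
  proof (rule rate[of 1])
    fix n assume n: "2 * norm d + 4 \<le> x n"
    note s = sz[OF n]
    have "d = 0" using d that by simp
    then show "x n * loc_width N D (x n) \<le> 1 * (cmod D * ln (cmod (z n)) + 1)"
      using that s by (simp add: loc_width_def x_def)
  qed
  show "(\<lambda>n. infdist (z n) (stokes_ray N \<beta> d k)) \<longlonglongrightarrow> 0" if N_pos: "N > 0"
  proof -
    have lim: "((\<lambda>n. h (norm (z n))) \<longlongrightarrow> 0) sequentially" if "(h \<longlongrightarrow> 0) at_top" for h :: "real \<Rightarrow> real"
      by (rule filterlim_compose[OF that zt])
    have "((\<lambda>s::real. 1 / s) \<longlongrightarrow> 0) at_top" "((\<lambda>s::real. ln s / s) \<longlongrightarrow> 0) at_top"
      "((\<lambda>s::real. s powr (- 1 / 2)) \<longlongrightarrow> 0) at_top" by real_asymp+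
    note lims = this[THEN lim]
    consider "N \<ge> 3" | "N = 2" | "N = 1" using N_pos by linarith
    then show ?thesis
    proof cases
      case 1 show ?thesis by (rule bigo_tendsto_0[OF r3[OF 1] lims(1)])
    next
      case 2 show ?thesis by (rule bigo_tendsto_0[OF r2[OF 2] lims(2)])
    next
      case 3 show ?thesis by (rule bigo_tendsto_0[OF r1[OF 3] lims(3)])
    qed
  qed
qed

end

section \<open>Zeros of an oscillating combination\<close>

context stokes_solutions
begin

text \<open>The coefficient a is the logarithmic derivative of \<psi> times P along the chart.
  \<psi> is of the form const \<zeta>^(\<alpha> - 1) and P is w^p times
  \<open>FP (1 / w \<zeta>)\<close>, so the powers give 2 \<mu> = \<alpha> - 1 + \<alpha> p, and the
  rest is the derivative of Ln \<open>FP (1 / w \<zeta>)\<close>, which tends to 0 since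
  \<open>FP 0 = 1\<close>.\<close>

lemma geometric_mean_on_wedge:
  obtains c0 where "c0 \<noteq> 0"
    "((\<lambda>\<zeta>. exp ((U 1 \<zeta> + U (- 1) \<zeta>) / 2) / exp (of_real ((\<alpha> - 1 + \<alpha> * real p) / 2) * Ln \<zeta>)) \<longlongrightarrow> c0) wedge_at_top"
proof -
  define F' where "F' = poly (pderiv (rev_shift d P))"
  define \<Lambda> where "\<Lambda> \<zeta> = Ln (FP (1 / w \<zeta>))" for \<zeta>
  define \<Lambda>' where "\<Lambda>' \<zeta> = inverse (FP (1 / w \<zeta>)) * (F' (1 / w \<zeta>) * (- of_real \<alpha> * (1 / w \<zeta>) / \<zeta>))" for \<zeta>
  define \<mu> :: complex where "\<mu> = of_real ((\<alpha> - 1 + \<alpha> * real p) / 2)"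
  have B0: "0 \<le> B" using B by simp
  have D: "DERIV \<Lambda> \<zeta> :> \<Lambda>' \<zeta>" if \<zeta>: "\<zeta> \<in> wedge B" for \<zeta>
  proof -
    have "DERIV (\<lambda>\<zeta>. FP (1 / w \<zeta>)) \<zeta> :> F' (1 / w \<zeta>) * (- of_real \<alpha> * (1 / w \<zeta>) / \<zeta>)"
      unfolding F'_def by (rule DERIV_chain2[OF poly_DERIV inverse_w_deriv[OF wedge_B[OF \<zeta>]]])
    moreover have "FP (1 / w \<zeta>) \<notin> \<real>\<^sub>\<le>\<^sub>0" using F[OF \<zeta>] by (auto simp: complex_nonpos_Reals_iff)
    ultimately show ?thesis unfolding \<Lambda>_def \<Lambda>'_def
      by (intro DERIV_chain2[OF has_field_derivative_Ln])
  qed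
  have a: "acoef \<zeta> = 2 * \<mu> / \<zeta> + \<Lambda>' \<zeta>" if \<zeta>: "\<zeta> \<in> wedge B" for \<zeta>
  proof -
    have \<mu>2: "2 * \<mu> = of_real \<alpha> - 1 + of_real \<alpha> * of_nat p" by (simp add: \<mu>_def)
    show ?thesis
      unfolding acoef_def BP_def \<Lambda>'_def F'_def \<mu>2 by (simp add: divide_inverse algebra_simps)
  qed
  have "filterlim (\<lambda>\<zeta>. w \<zeta>) at_infinity wedge_at_top"
    by (rule filterlim_norm_at_top_imp_at_infinity[OF filterlim_norm_w])
  then have x0: "((\<lambda>\<zeta>. 1 / w \<zeta>) \<longlongrightarrow> 0) wedge_at_top"
    by (intro tendsto_divide_0[OF tendsto_const])
  have "isCont FP 0" by simp
  from isCont_tendsto_compose[OF this x0]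
  have "((\<lambda>\<zeta>. FP (1 / w \<zeta>)) \<longlongrightarrow> 1) wedge_at_top" by (simp only: FP_0)
  from tendsto_Ln[OF this] have \<Lambda>0: "(\<Lambda> \<longlongrightarrow> 0) wedge_at_top" by (simp add: \<Lambda>_def[abs_def])
  obtain c0 where "c0 \<noteq> 0" "((\<lambda>z. exp ((U 1 z + U (- 1) z) / 2) / exp (\<mu> * Ln z)) \<longlongrightarrow> c0) wedge_at_top"
    by (rule rp.geometric_mean_asymptotics[OF D a B0 \<Lambda>0]) blast+
  then show ?thesis unfolding \<mu>_def using that by blast
qed

text \<open>At a zero the two terms of g cancel, so g' \<psi> = l exp(U 1) \<Delta>. Now exp(U 1) is
  the geometric mean of the two exponentials times the square root of their quotient. The first has
  power growth; at the zeros the second is a constant times (-1)^i.\<close>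

lemma deriv_at_zeros:
  fixes t :: "nat \<Rightarrow> complex"
  assumes l: "l \<noteq> 0"
    and G: "\<And>\<zeta>. \<zeta> \<in> wedge B \<Longrightarrow> g (d + w \<zeta>) = l * exp (U 1 \<zeta>) + m * exp (U (- 1) \<zeta>)"
    and G': "\<And>\<zeta>. \<zeta> \<in> wedge B \<Longrightarrow> deriv g (d + w \<zeta>) * \<psi> \<zeta> =
       l * u 1 \<zeta> * exp (U 1 \<zeta>) + m * u (- 1) \<zeta> * exp (U (- 1) \<zeta>)"
    and t: "\<And>i. t i \<in> wedge B" "\<And>i. g (d + w (t i)) = 0"
    and eq: "eventually (\<lambda>i. (U 1 (t i) - U (- 1) (t i)) / (2 * \<i>) = \<kappa>0 + of_real pi * of_int (int i + j)) sequentially"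
    and lim: "filterlim t wedge_at_top sequentially" "(\<lambda>i. t i / of_nat i) \<longlonglongrightarrow> of_real pi"
  shows "\<exists>ak. ak \<noteq> 0 \<and> (\<lambda>i. deriv g (d + w (t i))) \<sim>[at_top]
    (\<lambda>i. (- 1) ^ i * ak * of_real (real i powr (real (p + q) / (2 * (real N + 2)))))"
proof -
  define \<mu> where "\<mu> = (\<alpha> - 1 + \<alpha> * real p) / 2"
  define \<nu> where "\<nu> = real (p + q) / (2 * (real N + 2))"
  \<comment> \<open>The exponent \<mu> is that of the geometric mean, and 1 - \<alpha> comes from
    dividing by \<psi>.\<close>
  have \<nu>: "\<nu> = \<mu> + 1 - \<alpha>"
  proof -
    define x where "x = real N + 2"
    have x: "real (p + q) = 2 * real p + x - 2" "x \<noteq> 0" using N pq by (auto simp: x_def)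
    show ?thesis unfolding \<nu>_def \<mu>_def \<alpha>_def x_def[symmetric] x(1) using x(2) by (simp add: field_simps)
  qed
  define S where "S \<zeta> = exp ((U 1 \<zeta> + U (- 1) \<zeta>) / 2)" for \<zeta>
  obtain c0 where c0: "c0 \<noteq> 0" "((\<lambda>\<zeta>. S \<zeta> / exp (of_real \<mu> * Ln \<zeta>)) \<longlongrightarrow> c0) wedge_at_top"
    unfolding S_def \<mu>_def by (rule geometric_mean_on_wedge) blast+
  \<comment> \<open>The offset j between index and integer affects only this constant sign.\<close>
  define e where "e = l * exp (\<i> * \<kappa>0) * exp (\<i> * of_real pi * of_int j)"
  \<comment> \<open>The quotient of g'(t i) by (-1)^i and i^\<nu>, regrouped into factors that
    converge separately.\<close>
  define X where "X i = e * (S (t i) / exp (of_real \<mu> * Ln (t i))) * rp.\<Delta> (t i) * (exp (- \<eta>) / of_real \<alpha>)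
      * exp (of_real \<nu> * Ln (t i / of_nat i))" for i
  define ak where "ak = e * c0 * (2 * \<i>) * (exp (- \<eta>) / of_real \<alpha>) * exp (of_real \<nu> * Ln (of_real pi))"
  have ak: "ak \<noteq> 0" using c0(1) l \<alpha>_bounds by (simp add: ak_def e_def)
  have "\<not> pi \<le> 0" by (simp add: not_le)
  then have "X \<longlonglongrightarrow> ak"
    unfolding X_def ak_def
    by (intro tendsto_intros filterlim_compose[OF c0(2) lim(1)] filterlim_compose[OF rp.\<Delta>_lim lim(1)] lim(2))
       (auto simp: complex_nonpos_Reals_iff)
  then have "(\<lambda>i. X i / ak) \<longlonglongrightarrow> 1" using tendsto_divide[OF _ tendsto_const ak, of X ak] ak by simp
  moreover have "eventually (\<lambda>i. X i / ak = deriv g (d + w (t i)) / ((- 1) ^ i * ak * of_real (real i powr \<nu>))) sequentially"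
    using eq eventually_gt_at_top[of 0]
  proof eventually_elim
    case (elim i)
    define \<zeta> where "\<zeta> = t i"
    have \<zeta>: "\<zeta> \<in> wedge B" "\<zeta> \<in> wedge 0" "\<zeta> \<noteq> 0"
      using t(1)[of i] wedge_B wedge_norm(5)[of \<zeta> B] by (auto simp: \<zeta>_def)
    have lin: "l * x * y + m * x' * y' = l * y * (x - x')" if "m * y' = - (l * y)" for x y x' y'
    proof -
      have "m * x' * y' = x' * (m * y')" by simp
      then show ?thesis unfolding that by (simp add: algebra_simps)
    qed
    have "m * exp (U (- 1) \<zeta>) = - (l * exp (U 1 \<zeta>))"
      using G[OF \<zeta>(1)] t(2)[of i] by (simp add: \<zeta>_def eq_neg_iff_add_eq_0 add.commute)
    from lin[OF this] have "deriv g (d + w \<zeta>) * \<psi> \<zeta> = l * exp (U 1 \<zeta>) * rp.\<Delta> \<zeta>"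
      unfolding G'[OF \<zeta>(1)] rp.\<Delta>_def .
    then have g1: "deriv g (d + w \<zeta>) = l * exp (U 1 \<zeta>) * rp.\<Delta> \<zeta> * (\<zeta> / (of_real \<alpha> * w \<zeta>))"
      using \<psi>_nonzero[OF \<zeta>(2)] \<zeta>(3) \<alpha>_bounds by (simp add: \<psi>_def field_simps)
    have "U 1 \<zeta> = (U 1 \<zeta> + U (- 1) \<zeta>) / 2 + \<i> * ((U 1 \<zeta> - U (- 1) \<zeta>) / (2 * \<i>))"
      by (simp add: field_simps)
    also have "\<i> * ((U 1 \<zeta> - U (- 1) \<zeta>) / (2 * \<i>)) = \<i> * \<kappa>0 + \<i> * of_real pi * of_int j + of_nat i * (\<i> * of_real pi)"
      using elim(1) by (simp add: \<zeta>_def algebra_simps)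
    finally have "U 1 \<zeta> = (U 1 \<zeta> + U (- 1) \<zeta>) / 2
      + (\<i> * \<kappa>0 + \<i> * of_real pi * of_int j + of_nat i * (\<i> * of_real pi))" .
    from arg_cong[OF this, of exp] have "exp (U 1 \<zeta>) = S \<zeta> * (exp (\<i> * \<kappa>0) * exp (\<i> * of_real pi * of_int j) * exp (\<i> * of_real pi) ^ i)"
      by (simp only: exp_add exp_of_nat_mult S_def mult.assoc)
    then have g2: "l * exp (U 1 \<zeta>) = e * (- 1) ^ i * S \<zeta>" by (simp add: e_def mult_ac)
    have "\<zeta> / w \<zeta> = exp (Ln \<zeta>) * exp (- (\<eta> + of_real \<alpha> * Ln \<zeta>))"
      unfolding w_def exp_minus divide_inverse using \<zeta>(3) by simp
    also have "\<dots> = exp (- \<eta>) * exp (of_real (1 - \<alpha>) * Ln \<zeta>)"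
      by (simp add: exp_add[symmetric] algebra_simps)
    finally have g3: "\<zeta> / w \<zeta> = exp (- \<eta>) * exp (of_real (1 - \<alpha>) * Ln \<zeta>)" .
    have pos: "0 < real i" using elim(2) by simp
    define y where "y = \<zeta> / of_nat i"
    have y: "\<zeta> = of_real (real i) * y" "y \<noteq> 0" using elim(2) \<zeta>(3) by (auto simp: y_def)
    have "Ln \<zeta> = of_real (ln (real i)) + Ln y"
      unfolding y(1) by (simp only: Ln_times_of_real[OF pos y(2)] Ln_of_real[OF pos])
    then have "exp (of_real \<nu> * Ln \<zeta>) = exp (of_real (\<nu> * ln (real i))) * exp (of_real \<nu> * Ln y)"
      by (simp add: distrib_left exp_add)
    also have "exp (of_real (\<nu> * ln (real i))) = (of_real (real i powr \<nu>) :: complex)"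
      unfolding exp_of_real using elim(2) by (simp add: powr_def)
    finally have g4: "exp (of_real \<nu> * Ln \<zeta>) = of_real (real i powr \<nu>) * exp (of_real \<nu> * Ln y)" .
    have g5: "exp (of_real (1 - \<alpha>) * Ln \<zeta>) = exp (of_real \<nu> * Ln \<zeta>) / exp (of_real \<mu> * Ln \<zeta>)"
      unfolding exp_diff[symmetric] by (simp add: \<nu> algebra_simps)
    have "deriv g (d + w \<zeta>) = e * (- 1) ^ i * S \<zeta> * rp.\<Delta> \<zeta> * ((\<zeta> / w \<zeta>) / of_real \<alpha>)"
      unfolding g1 g2 by (simp add: mult_ac)
    also have "\<dots> = X i * ((- 1) ^ i * of_real (real i powr \<nu>))"
      unfolding g3 g5 g4 X_def \<zeta>_def[symmetric] y_def[symmetric] by (simp add: field_simps)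
    finally have "deriv g (d + w (t i)) = X i * ((- 1) ^ i * of_real (real i powr \<nu>))" by (simp add: \<zeta>_def)
    then show ?case using elim(2) ak by simp
  qed
  ultimately have "(\<lambda>i. deriv g (d + w (t i)) / ((- 1) ^ i * ak * of_real (real i powr \<nu>))) \<longlonglongrightarrow> 1"
    by (rule Lim_transform_eventually)
  then have "(\<lambda>i. deriv g (d + w (t i))) \<sim>[at_top] (\<lambda>i. (- 1) ^ i * ak * of_real (real i powr \<nu>))"
    by (rule asymp_equivI')
  then show ?thesis using ak unfolding \<nu>_def by blast
qed

definition zero_sequence :: "(complex \<Rightarrow> complex) \<Rightarrow> real \<Rightarrow> (nat \<Rightarrow> complex) \<Rightarrow> real \<Rightarrow> bool" where
  "zero_sequence g R t C \<longleftrightarrow> (\<forall>i. t i \<in> wedge 0 \<and> R < norm (t i)) \<and>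
      bij_betw (\<lambda>i. d + w (t i)) (UNIV :: nat set) {z \<in> G R. g z = 0} \<and>
      filterlim t wedge_at_top sequentially \<and> (\<lambda>i. t i / of_nat i) \<longlonglongrightarrow> of_real pi \<and>
      (\<forall>i. \<bar>Im (t i)\<bar> \<le> C + 2 * (2 * K) * pint (norm (t i))) \<and>
      (\<exists>ak. ak \<noteq> 0 \<and> (\<lambda>i. deriv g (d + w (t i))) \<sim>[at_top]
        (\<lambda>i. (- 1) ^ i * ak * of_real (real i powr (real (p + q) / (2 * (real N + 2))))))"

lemma zeros_in_wedge:
  assumes lm: "l \<noteq> 0" "m \<noteq> 0"
    and G: "\<And>\<zeta>. \<zeta> \<in> wedge B \<Longrightarrow> g (d + w \<zeta>) = l * exp (U 1 \<zeta>) + m * exp (U (- 1) \<zeta>)"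
    and G': "\<And>\<zeta>. \<zeta> \<in> wedge B \<Longrightarrow> deriv g (d + w \<zeta>) * \<psi> \<zeta> =
       l * u 1 \<zeta> * exp (U 1 \<zeta>) + m * u (- 1) \<zeta> * exp (U (- 1) \<zeta>)"
  obtains R0 where "\<And>R. R0 \<le> R \<Longrightarrow> \<exists>t C. zero_sequence g R t C"
proof -
  \<comment> \<open>A zero means exp(2 i (\<zeta> + E)) = - m / l. This exponential has period
    \<pi>, hence the multiples of \<pi> added to \<kappa>0.\<close>
  define \<kappa>0 where "\<kappa>0 = Ln (- m / l) / (2 * \<i>)"
  have E_le: "norm ((n 1 \<zeta> - n (- 1) \<zeta>) / (2 * \<i>)) \<le> 2 * \<rho> (2 * K) (norm \<zeta>)" if \<zeta>: "\<zeta> \<in> wedge B" for \<zeta>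
  proof -
    have "0 \<le> \<rho> K (norm \<zeta>)" unfolding \<rho>_def using K e0_nonneg by simp
    then show ?thesis
      using norm_triangle_ineq4[of "n 1 \<zeta>" "n (- 1) \<zeta>"] n_le[of 1, OF _ \<zeta>] n_le[of "- 1", OF _ \<zeta>]
      by (simp add: norm_divide norm_mult \<rho>_def)
  qed
  obtain R1 where R1: "\<And>R. R1 \<le> R \<Longrightarrow>
     \<exists>t j. bij_betw t (UNIV :: nat set) {z \<in> wedge 0. R < norm z \<and> (\<exists>i. z + rp.E z = \<kappa>0 + of_real pi * of_int i)} \<and>
       eventually (\<lambda>i. t i + rp.E (t i) = \<kappa>0 + of_real pi * of_int (int i + j)) sequentially"
    by (rule wedge_zeros[OF rp.E_deriv rp.n_diff_small rp.E_sublinear, where \<kappa> = \<kappa>0]) blast+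
  obtain C where C: "\<And>z. z \<in> wedge 0 \<Longrightarrow> 2 * \<bar>B\<bar> + 1 \<le> norm z \<Longrightarrow> norm (rp.E z) \<le> C + 2 * (2 * K) * pint (norm z)"
    by (rule radial_bound[OF rp.E_deriv E_le rp.n_diff_small pint_deriv]) auto
  have "eventually (\<lambda>z. norm (rp.E z / z) < 1) wedge_at_top"
    using tendstoD[OF rp.E_sublinear, of 1] by simp
  then obtain B1 where B1: "\<And>z. z \<in> wedge B1 \<Longrightarrow> norm (rp.E z / z) < 1"
    unfolding eventually_wedge_at_top by blast
  show ?thesis
  \<comment> \<open>Beyond 2 B + 1 the radial bound on E holds; beyond 2 |B1| also |E z| \<le>
    |z|.\<close>
  proof (rule that[of "max R1 (max (2 * B + 1) (2 * \<bar>B1\<bar>))"])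
    fix R assume R: "max R1 (max (2 * B + 1) (2 * \<bar>B1\<bar>)) \<le> R"
    define zs where "zs = {z \<in> wedge 0. R < norm z \<and> (\<exists>i. z + rp.E z = \<kappa>0 + of_real pi * of_int i)}"
    define \<Omega> where "\<Omega> = {z \<in> wedge 0. R < norm z}"
    have \<Omega>: "z \<in> wedge B" "z \<in> wedge B1" if "z \<in> \<Omega>" for z
      using that R B norm_gt_imp_wedge[of z 0] by (auto simp: \<Omega>_def)
    have zero_iff: "g (d + w \<zeta>) = 0 \<longleftrightarrow> (\<exists>i. \<zeta> + rp.E \<zeta> = \<kappa>0 + of_real pi * of_int i)" if \<zeta>: "\<zeta> \<in> \<Omega>" for \<zeta>
    proof -
      have "g (d + w \<zeta>) = 0 \<longleftrightarrow> exp (U 1 \<zeta>) / exp (U (- 1) \<zeta>) = - m / l"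
        using lm unfolding G[OF \<Omega>(1)[OF \<zeta>]] by (auto simp: field_simps eq_neg_iff_add_eq_0 add.commute)
      also have "exp (U 1 \<zeta>) / exp (U (- 1) \<zeta>) = exp (2 * \<i> * (\<zeta> + rp.E \<zeta>))"
        unfolding exp_diff[symmetric] by (simp add: rp.E_def)
      also have "- m / l = exp (2 * \<i> * \<kappa>0)" using lm by (simp add: \<kappa>0_def)
      also have "exp (2 * \<i> * (\<zeta> + rp.E \<zeta>)) = exp (2 * \<i> * \<kappa>0) \<longleftrightarrow>
          (\<exists>i::int. 2 * \<i> * (\<zeta> + rp.E \<zeta>) = 2 * \<i> * \<kappa>0 + of_real (of_int (2 * i) * pi) * \<i>)"
        by (rule exp_eq)
      also have "\<dots> \<longleftrightarrow> (\<exists>i. \<zeta> + rp.E \<zeta> = \<kappa>0 + of_real pi * of_int i)"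
      proof (intro ex_cong1)
        fix i :: int
        have "2 * \<i> * \<kappa>0 + of_real (of_int (2 * i) * pi) * \<i> = 2 * \<i> * (\<kappa>0 + of_real pi * of_int i)"
          by (simp add: algebra_simps)
        then show "(2 * \<i> * (\<zeta> + rp.E \<zeta>) = 2 * \<i> * \<kappa>0 + of_real (of_int (2 * i) * pi) * \<i>) =
            (\<zeta> + rp.E \<zeta> = \<kappa>0 + of_real pi * of_int i)" by (simp only:) simp
      qed
      finally show ?thesis .
    qed
    obtain t j where t: "bij_betw t (UNIV :: nat set) zs"
      "eventually (\<lambda>i. t i + rp.E (t i) = \<kappa>0 + of_real pi * of_int (int i + j)) sequentially"
      using R1[of R] R by (auto simp: zs_def)
    have tZ: "t i \<in> wedge 0 \<and> R < norm (t i) \<and> (\<exists>j. t i + rp.E (t i) = \<kappa>0 + of_real pi * of_int j)" for i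
      using bij_betwE[OF t(1)] by (auto simp: zs_def)
    then have t\<Omega>: "t i \<in> \<Omega>" for i by (simp add: \<Omega>_def)
    have img: "(\<lambda>\<zeta>. d + w \<zeta>) ` zs
        = {z \<in> G R. g z = 0}"
    proof -
      have "zs = {\<zeta> \<in> \<Omega>. g (d + w \<zeta>) = 0}"
        using zero_iff by (auto simp: \<Omega>_def zs_def)
      moreover have "G R = (\<lambda>\<zeta>. d + w \<zeta>) ` \<Omega>" unfolding \<Omega>_def using R B by (intro G_eq_image) auto
      ultimately show ?thesis by auto
    qed
    have "inj_on (\<lambda>\<zeta>. d + w \<zeta>) zs"
      by (rule inj_on_subset[OF inj_on_w]) (auto simp: zs_def)
    then have "bij_betw (\<lambda>\<zeta>. d + w \<zeta>) zs {z \<in> G R. g z = 0}"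
      using img by (rule bij_betw_imageI)
    from bij_betw_trans[OF t(1) this]
    have bij: "bij_betw (\<lambda>i. d + w (t i)) UNIV {z \<in> G R. g z = 0}" by (simp add: o_def)
    have g0: "g (d + w (t i)) = 0" for i using bij_betwE[OF bij] by auto
    have E1: "norm (rp.E z) \<le> 1 * norm z" if "z \<in> wedge 0" "R < norm z" for z
    proof -
      have "z \<in> \<Omega>" using that by (simp add: \<Omega>_def)
      then have "z \<in> wedge B1" "z \<noteq> 0" using \<Omega> wedge_norm(5) by blast+
      then show ?thesis using B1[of z] by (simp add: norm_divide field_simps)
    qed
    have lim: "filterlim t wedge_at_top sequentially" "(\<lambda>i. t i / of_nat i) \<longlonglongrightarrow> of_real pi"
      using wedge_zeros_asymptotics[OF rp.E_sublinear E1 _ _ t(2)] tZ by blast+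
    have Im: "\<bar>Im (t i)\<bar> \<le> (\<bar>Im \<kappa>0\<bar> + C) + 2 * (2 * K) * pint (norm (t i))" for i
    proof -
      obtain j where "t i + rp.E (t i) = \<kappa>0 + of_real pi * of_int j" using tZ by blast
      from arg_cong[OF this, of Im] have "Im (t i) = Im \<kappa>0 - Im (rp.E (t i))" by simp
      moreover have "\<bar>Im (rp.E (t i))\<bar> \<le> norm (rp.E (t i))" by (rule abs_Im_le_cmod)
      moreover have "norm (rp.E (t i)) \<le> C + 2 * (2 * K) * pint (norm (t i))"
        using tZ[of i] R B by (intro C) auto
      ultimately show ?thesis by linarith
    qed
    have ev: "eventually (\<lambda>i. (U 1 (t i) - U (- 1) (t i)) / (2 * \<i>) = \<kappa>0 + of_real pi * of_int (int i + j)) sequentially"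
      using t(2) by eventually_elim (simp add: rp.E_def)
    have "\<exists>ak. ak \<noteq> 0 \<and> (\<lambda>i. deriv g (d + w (t i))) \<sim>[at_top]
        (\<lambda>i. (- 1) ^ i * ak * of_real (real i powr (real (p + q) / (2 * (real N + 2)))))"
      by (rule deriv_at_zeros[OF lm(1) G G' \<Omega>(1)[OF t\<Omega>] g0 ev lim])
    then show "\<exists>t C. zero_sequence g R t C"
      unfolding zero_sequence_def using tZ bij lim Im by blast
  qed
qed

end

section \<open>Assembly of all assertions for one Stokes ray\<close>

context stokes_solutions
begin

definition zeros_described :: "(complex \<Rightarrow> complex) \<Rightarrow> complex set \<Rightarrow> real \<Rightarrow> bool" where
  "zeros_described g Z r \<longleftrightarrow> (\<exists>C>0. finite (Z - loc_region N \<beta> d D k r C)) \<and>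
      (\<exists>t :: nat \<Rightarrow> complex. bij_betw t UNIV Z \<and>
         (\<lambda>n. t n - d) \<sim>[at_top]
           (\<lambda>n. of_real ((pi ^ 2 * (real N + 2) ^ 2 / (4 * cmod b)) powr (1 / (real N + 2)))
                  * cis (- \<beta> / (real N + 2)) * cis (2 * pi * of_int k / (real N + 2))
                  * of_real (real n powr (2 / (real N + 2)))) \<and>
         (\<exists>ak. ak \<noteq> 0 \<and>
            (\<lambda>n. deriv g (t n)) \<sim>[at_top]
              (\<lambda>n. (-1) ^ n * ak
                     * of_real (real n powr (real (p + q) / (2 * (real N + 2)))))) \<and>
         (N \<ge> 3 \<longrightarrow>
            (\<lambda>n. infdist (t n) (stokes_ray N \<beta> d k)) \<in> O(\<lambda>n. 1 / cmod (t n))) \<and>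
         (N = 2 \<longrightarrow>
            (\<lambda>n. infdist (t n) (stokes_ray N \<beta> d k)) \<in> O(\<lambda>n. ln (cmod (t n)) / cmod (t n))) \<and>
         (N = 1 \<longrightarrow>
            (\<lambda>n. infdist (t n) (stokes_ray N \<beta> d k)) \<in> O(\<lambda>n. cmod (t n) powr (- 1 / 2))) \<and>
         (N = 0 \<longrightarrow>
            (\<lambda>n. infdist (t n) (stokes_ray N \<beta> d k)) \<in> O(\<lambda>n. cmod D * ln (cmod (t n)) + 1)) \<and>
         (N > 0 \<longrightarrow>
            (\<lambda>n. infdist (t n) (stokes_ray N \<beta> d k)) \<longlonglongrightarrow> 0))"

lemma solution_structure:
  assumes g: "analytic_solution P Q UNIV g" and nontrivial: "\<exists>z. g z \<noteq> 0"
  shows "\<exists>r \<delta> gp gm lp lm. let G = sector N \<beta> d k r \<delta>; Z = {z \<in> G. g z = 0} in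
     r > 0 \<and> \<delta> > 0 \<and> \<delta> < 2 * pi / (real N + 2) \<and>
     fundamental_pair P Q G gp gm \<and>
     (\<forall>z\<in>G. g z = lp * gp z + lm * gm z) \<and>
     solution_asymptotics p q sb d L G 1 gp \<and>
     solution_asymptotics p q sb d L G (-1) gm \<and>
     (infinite Z \<longleftrightarrow> lp * lm \<noteq> 0) \<and>
     (lp * lm \<noteq> 0 \<longrightarrow> zeros_described g Z r)"
proof -
  obtain l m where Gl: "\<And>\<zeta>. \<zeta> \<in> wedge B \<Longrightarrow> g (d + w \<zeta>) = l * exp (U 1 \<zeta>) + m * exp (U (- 1) \<zeta>)"
    and Gl': "\<And>\<zeta>. \<zeta> \<in> wedge B \<Longrightarrow> deriv g (d + w \<zeta>) * \<psi> \<zeta> =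
       l * u 1 \<zeta> * exp (U 1 \<zeta>) + m * u (- 1) \<zeta> * exp (U (- 1) \<zeta>)"
    by (rule rp.solution_decomposition[OF pullback[OF g wedge_B FP_nonzero]]) blast+
  obtain \<tau> where \<tau>: "\<bar>\<tau>\<bar> = 1"
    "\<And>\<zeta>. \<zeta> \<in> wedge 0 \<Longrightarrow> of_real \<alpha> * sb * branch_powr L ((real N + 2) / 2) (d + w \<zeta>) = of_real \<tau> * \<zeta>"
    "\<And>\<zeta>. \<zeta> \<in> wedge 0 \<Longrightarrow> sb * branch_powr L (real N / 2) (d + w \<zeta>) = of_real \<tau> / \<psi> \<zeta>"
    by (rule obtain_sign) blast+
  have \<tau>_cases: "\<tau> = 1 \<or> \<tau> = - 1" using \<tau>(1) by auto
  obtain R0 where R0: "\<And>R. l \<noteq> 0 \<Longrightarrow> m \<noteq> 0 \<Longrightarrow> R0 \<le> R \<Longrightarrow> \<exists>t C. zero_sequence g R t C"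
    using zeros_in_wedge[OF _ _ Gl Gl'] by metis
  define R where "R = max R0 (2 * B)"
  have R: "R0 \<le> R" "2 * B \<le> R" "0 < R" using B by (auto simp: R_def)
  define r where "r = \<kappa> * R powr \<alpha>"
  have r: "0 < r" using R \<kappa>_pos by (simp add: r_def)
  define gp where "gp z = exp (U \<tau> (w_inv z))" for z
  define gm where "gm z = exp (U (- \<tau>) (w_inv z))" for z
  \<comment> \<open>If \<tau> = -1, the branch L interchanges the two solutions, so their
    coefficients are interchanged as well.\<close>
  define lp where "lp = (if \<tau> = 1 then l else m)"
  define lm where "lm = (if \<tau> = 1 then m else l)"
  define Z where "Z = {z \<in> G R. g z = 0}"
  note mem = w_inv_wedge[OF R(2)]
  have \<tau>': "\<bar>- \<tau>\<bar> = 1" using \<tau>(1) by simp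
  have B0: "0 \<le> B" using B by simp
  have sol: "analytic_solution P Q (G R) gp" "analytic_solution P Q (G R) gm"
    unfolding gp_def gm_def by (rule pushforward_exp(1)[OF \<tau>(1) _ \<tau>(1) _ _ B0 R(2)] pushforward_exp(1)[OF \<tau>' _ \<tau>' _ _ B0 R(2)]; assumption)+
  have dgp: "deriv gp z = u \<tau> (w_inv z) / \<psi> (w_inv z) * gp z"
    and dgm: "deriv gm z = u (- \<tau>) (w_inv z) / \<psi> (w_inv z) * gm z"
    if z: "z \<in> G R" for z
    unfolding gp_def gm_def by (rule pushforward_exp(2)[OF \<tau>(1) _ \<tau>(1) _ _ B0 R(2) z] pushforward_exp(2)[OF \<tau>' _ \<tau>' _ _ B0 R(2) z]; assumption)+
  have comb: "g z = lp * gp z + lm * gm z" if z: "z \<in> G R" for z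
    using Gl[OF mem(2)[OF z]] \<tau>_cases unfolding mem(3)[OF z] gp_def gm_def lp_def lm_def by auto
  obtain z0 where z0: "z0 \<in> G R"
  proof -
    have "complex_of_real (R + 1) \<in> wedge 0" "R < norm (complex_of_real (R + 1))"
      unfolding norm_of_real using R by (auto simp: wedge_def)
    then have "d + w (of_real (R + 1)) \<in> G R" using R by (intro w_in_G) auto
    then show ?thesis by (rule that)
  qed
  \<comment> \<open>A vanishing combination and its derivative at one point z0 form a linear system
    whose determinant is, up to nonzero factors, \<Delta> at the corresponding \<zeta>.\<close>
  have fund: "fundamental_pair P Q (G R) gp gm"
    unfolding fundamental_pair_def
  proof (intro conjI sol allI impI)
    fix c1 c2 assume zero: "\<forall>z\<in>G R. c1 * gp z + c2 * gm z = 0"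
    define \<zeta> where "\<zeta> = w_inv z0"
    have D: "DERIV f z0 :> deriv f z0" if "analytic_solution P Q (G R) f" for f
      using that z0 open_G by (auto simp: analytic_solution_def intro: holomorphic_derivI)
    have "DERIV (\<lambda>z. c1 * gp z + c2 * gm z) z0 :> c1 * deriv gp z0 + c2 * deriv gm z0"
      by (intro DERIV_add DERIV_cmult D sol)
    moreover have "DERIV (\<lambda>z. c1 * gp z + c2 * gm z) z0 :> 0"
      by (rule has_field_derivative_transform_within_open[OF DERIV_const[of 0] open_G z0]) (use zero in auto)
    ultimately have eq: "c1 * deriv gp z0 + c2 * deriv gm z0 = 0" by (rule DERIV_unique)
    have neg: "c2 * gm z0 = - (c1 * gp z0)" using zero z0 by (simp add: eq_neg_iff_add_eq_0 add.commute)
    have "c1 * (x / y * gp z0) + c2 * (x' / y * gm z0) = (x - x') * (c1 * gp z0) / y" for x x' y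
    proof -
      have e: "c2 * (x' / y * gm z0) = x' / y * (c2 * gm z0)" by simp
      show ?thesis unfolding e neg by (simp add: divide_inverse algebra_simps)
    qed
    then have "(u \<tau> \<zeta> - u (- \<tau>) \<zeta>)
        * (c1 * gp z0) / \<psi> \<zeta> = 0"
      using eq unfolding dgp[OF z0] dgm[OF z0] \<zeta>_def[symmetric] by (simp only:)
    moreover have "\<psi> \<zeta> \<noteq> 0" using \<psi>_nonzero[OF mem(1)[OF z0]] by (simp add: \<zeta>_def)
    moreover have "u \<tau> \<zeta> - u (- \<tau>) \<zeta> \<noteq> 0"
      (is "?x \<noteq> 0")
    proof -
      have "?x = rp.\<Delta> \<zeta> \<or> ?x = - rp.\<Delta> \<zeta>" using \<tau>_cases by (elim disjE) (simp_all add: rp.\<Delta>_def)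
      moreover have "rp.\<Delta> \<zeta> \<noteq> 0" using rp.\<Delta>_nonzero[OF mem(2)[OF z0]] by (simp add: \<zeta>_def)
      ultimately show ?thesis by (metis neg_equal_0_iff_equal)
    qed
    moreover have "gp z0 \<noteq> 0" "gm z0 \<noteq> 0" by (simp_all add: gp_def gm_def)
    ultimately have "c1 = 0" by simp
    then show "c1 = 0" "c2 = 0" using zero z0 \<open>gm z0 \<noteq> 0\<close> by auto
  qed
  have asym: "solution_asymptotics p q sb d L (G R) 1 gp" "solution_asymptotics p q sb d L (G R) (- 1) gm"
    using solution_asymptotics_exp[OF R(2) \<tau>, of 1]
      solution_asymptotics_exp[OF R(2) \<tau>, of "- 1"]
    by (simp_all add: gp_def[abs_def] gm_def[abs_def])
  have lplm: "lp * lm \<noteq> 0 \<longleftrightarrow> l \<noteq> 0 \<and> m \<noteq> 0" by (auto simp: lp_def lm_def)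
  have "infinite Z" if lm0: "lp * lm \<noteq> 0"
  proof -
    obtain t :: "nat \<Rightarrow> complex" where "bij_betw (\<lambda>i. d + w (t i)) UNIV Z"
      using R0[OF _ _ R(1)] lm0 lplm unfolding Z_def zero_sequence_def by blast
    then show ?thesis using bij_betw_finite infinite_UNIV_nat by blast
  qed
  \<comment> \<open>If both coefficients vanished, g would vanish on an open set and hence
    everywhere. So exactly one is nonzero, and g is a nonzero multiple of an exponential.\<close>
  moreover have "Z = {}" if "lp * lm = 0"
  proof -
    have hol: "g holomorphic_on UNIV" using g by (simp add: analytic_solution_def)
    have "lp \<noteq> 0 \<or> lm \<noteq> 0"
    proof (rule ccontr)
      assume "\<not> (lp \<noteq> 0 \<or> lm \<noteq> 0)"
      then have "g z = 0" if "z \<in> G R" for z using comb[OF that] by simp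
      then have "g z = 0" for z
        by (intro analytic_continuation_open[of "G R" UNIV g "\<lambda>_. 0" z])
           (use z0 open_G hol in auto)
      then show False using nontrivial by simp
    qed
    then show ?thesis using that comb by (auto simp: Z_def gp_def gm_def)
  qed
  ultimately have inf: "infinite Z \<longleftrightarrow> lp * lm \<noteq> 0" by auto
  have zeros: "zeros_described g Z r" if lm0: "lp * lm \<noteq> 0"
  proof -
    obtain t C where t: "\<And>i. t i \<in> wedge 0" "\<And>i. R < norm (t i)"
      "bij_betw (\<lambda>i. d + w (t i)) (UNIV :: nat set) Z"
      "filterlim t wedge_at_top sequentially" "(\<lambda>i. t i / of_nat i) \<longlonglongrightarrow> of_real pi"
      "\<And>i. \<bar>Im (t i)\<bar> \<le> C + 2 * (2 * K) * pint (norm (t i))"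
      and ak: "\<exists>ak. ak \<noteq> 0 \<and> (\<lambda>i. deriv g (d + w (t i))) \<sim>[at_top]
        (\<lambda>i. (- 1) ^ i * ak * of_real (real i powr (real (p + q) / (2 * (real N + 2)))))"
      using R0[OF _ _ R(1)] lm0 lplm unfolding Z_def zero_sequence_def by blast
    obtain M where M: "0 < M" "eventually (\<lambda>i. d + w (t i) \<in> loc_region N \<beta> d D k r M \<and>
       infdist (d + w (t i)) (stokes_ray N \<beta> d k) \<le> M * (norm (w (t i)) * loc_width N D (norm (w (t i))))) sequentially"
      unfolding r_def by (rule localization[OF t(1,2) _ t(4) t(6)]) (use R in auto)
    have "finite {i. \<not> d + w (t i) \<in> loc_region N \<beta> d D k r M}"
      using eventually_mono[OF M(2), of "\<lambda>i. d + w (t i) \<in> loc_region N \<beta> d D k r M"]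
      by (simp add: cofinite_eq_sequentially[symmetric] eventually_cofinite)
    moreover have "Z - loc_region N \<beta> d D k r M
        \<subseteq> (\<lambda>i. d + w (t i)) ` {i. \<not> d + w (t i) \<in> loc_region N \<beta> d D k r M}"
      using t(3) by (auto simp: bij_betw_def)
    ultimately have fin: "finite (Z - loc_region N \<beta> d D k r M)" by (meson finite_imageI finite_subset)
    have w_lim: "filterlim (\<lambda>i. norm (d + w (t i) - d)) at_top sequentially"
      using filterlim_compose[OF filterlim_norm_w t(4)] by simp
    have dist: "eventually (\<lambda>i. infdist (d + w (t i)) (stokes_ray N \<beta> d k)
       \<le> M * (norm (d + w (t i) - d) * loc_width N D (norm (d + w (t i) - d)))) sequentially"
      using M(2) by eventually_elim simp
    note rates = distance_rates[OF w_lim M(1) dist]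
    show ?thesis
      unfolding zeros_described_def
      using M(1) fin t(3) w_asymptotics[OF t(1,5)] ak rates
      by (intro conjI exI[of _ M] exI[of _ "\<lambda>i. d + w (t i)"]) simp_all
  qed
  have \<delta>: "0 < \<delta>" "\<delta> < 2 * pi / (real N + 2)"
  proof -
    have "0 < pi / (real N + 2)" by (intro divide_pos_pos) auto
    moreover have "\<delta> = 3 / 2 * (pi / (real N + 2))" "2 * pi / (real N + 2) = 2 * (pi / (real N + 2))"
      by (simp_all add: \<delta>_def)
    ultimately show "0 < \<delta>" "\<delta> < 2 * pi / (real N + 2)" by linarith+
  qed
  have GR: "sector N \<beta> d k r \<delta> = G R" by (simp add: G_def r_def)
  show ?thesis
    by (rule exI[of _ r], rule exI[of _ \<delta>], rule exI[of _ gp], rule exI[of _ gm], rule exI[of _ lp],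
        rule exI[of _ lm], unfold Let_def GR Z_def[symmetric])
       (use r \<delta> fund comb asym inf zeros in blast)
qed

end

theorem theorem2p18:
  fixes P Q S :: "complex poly"
    and p q N :: nat
    and a b c d D sb :: complex
    and \<beta> :: real
    and pz Dc :: "nat \<Rightarrow> complex"
    and g :: "complex \<Rightarrow> complex"
  assumes degP: "degree P = p" and monicP: "lead_coeff P = 1"
    and a: "a = (if p = 0 then 0 else coeff P (p - 1))"
    and Q: "Q \<noteq> 0" and degQ: "degree Q = q" and b: "b = lead_coeff Q"
    and c: "c = (if q = 0 then 0 else coeff Q (q - 1))"
    and pq: "p \<le> q" and N: "N = q - p"
    and zerosP: "P = (\<Prod>j<p. [:- pz j, 1:])"
    and degS: "degree S = N"
    and partial_fractions:
      "\<And>z. poly P z \<noteq> 0 \<Longrightarrow> poly Q z / poly P z = poly S z + (\<Sum>j<p. Dc j / (z - pz j))"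
    and d: "d = (if N \<ge> 1 then (a * b - c) / (b * of_nat N) else 0)"
    and arg_b: "is_arg_of \<beta> b"
    and sb: "sb = of_real (sqrt (cmod b)) * cis (\<beta> / 2)"
    and D: "D = (\<Sum>j<p. Dc j) / sb"
    and g: "analytic_solution P Q UNIV g"
    and nontrivial: "\<exists>z. g z \<noteq> 0"
  shows
    "\<forall>k \<in> {0 .. int N + 1}. \<forall>L. log_branch d (sector N \<beta> d k 0 0) L \<longrightarrow>
      (\<exists>r \<delta> gp gm lp lm. let G = sector N \<beta> d k r \<delta>; Z = {z \<in> G. g z = 0} in
         r > 0 \<and> \<delta> > 0 \<and> \<delta> < 2 * pi / (real N + 2) \<and>
         fundamental_pair P Q G gp gm \<and>
         (\<forall>z\<in>G. g z = lp * gp z + lm * gm z) \<and>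
         solution_asymptotics p q sb d L G 1 gp \<and>
         solution_asymptotics p q sb d L G (-1) gm \<and>
         (infinite Z \<longleftrightarrow> lp * lm \<noteq> 0) \<and>
         (lp * lm \<noteq> 0 \<longrightarrow>
            (\<exists>C>0. finite (Z - loc_region N \<beta> d D k r C)) \<and>
            (\<exists>t :: nat \<Rightarrow> complex. bij_betw t UNIV Z \<and>
               (\<lambda>n. t n - d) \<sim>[at_top]
                 (\<lambda>n. of_real ((pi ^ 2 * (real N + 2) ^ 2 / (4 * cmod b)) powr (1 / (real N + 2)))
                        * cis (- \<beta> / (real N + 2)) * cis (2 * pi * of_int k / (real N + 2))
                        * of_real (real n powr (2 / (real N + 2)))) \<and>
               (\<exists>ak. ak \<noteq> 0 \<and>
                  (\<lambda>n. deriv g (t n)) \<sim>[at_top]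
                    (\<lambda>n. (-1) ^ n * ak
                           * of_real (real n powr (real (p + q) / (2 * (real N + 2)))))) \<and>
               (N \<ge> 3 \<longrightarrow>
                  (\<lambda>n. infdist (t n) (stokes_ray N \<beta> d k)) \<in> O(\<lambda>n. 1 / cmod (t n))) \<and>
               (N = 2 \<longrightarrow>
                  (\<lambda>n. infdist (t n) (stokes_ray N \<beta> d k)) \<in> O(\<lambda>n. ln (cmod (t n)) / cmod (t n))) \<and>
               (N = 1 \<longrightarrow>
                  (\<lambda>n. infdist (t n) (stokes_ray N \<beta> d k)) \<in> O(\<lambda>n. cmod (t n) powr (- 1 / 2))) \<and>
               (N = 0 \<longrightarrow>
                  (\<lambda>n. infdist (t n) (stokes_ray N \<beta> d k)) \<in> O(\<lambda>n. cmod D * ln (cmod (t n)) + 1)) \<and>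
               (N > 0 \<longrightarrow>
                  (\<lambda>n. infdist (t n) (stokes_ray N \<beta> d k)) \<longlonglongrightarrow> 0))))"
proof (intro ballI allI impI, goal_cases)
  case (1 k L)
  interpret stokes_problem N b d \<beta> k L "2 / (real N + 2)" "stokes_angle N \<beta> k"
    "(1 / (2 / (real N + 2) * sqrt (cmod b))) powr (2 / (real N + 2))" P Q S p q a c D sb pz Dc
    by unfold_locales (fact arg_b 1(2) degP monicP a degQ b c pq N degS partial_fractions d sb D)+
  obtain B K n U where "stokes_solutions N b d \<beta> k L P Q S p q a c D sb pz Dc B K n U"
    by (rule wedge_solutions_exist) (intro that stokes_solutions.intro stokes_solutions_axioms.intro stokes_problem_axioms)
  then interpret stokes_solutions N b d \<beta> k L "2 / (real N + 2)" "stokes_angle N \<beta> k"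
    "(1 / (2 / (real N + 2) * sqrt (cmod b))) powr (2 / (real N + 2))" P Q S p q a c D sb pz Dc B K n U
    by assumption
  show ?case
    using solution_structure[OF g nontrivial] unfolding zeros_described_def .
qed

end
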